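(* The class $\mathcal{R}$ contains no regionally elementary groups.
   Context: All topological groups are Hausdorff; t.d.l.c. means totally disconnected locally compact. The normal core of a subgroup $L$ of $K$ is $\bigcap_{k\in K}kLk^{-1}$. A t.d.l.c. group $G$ is regionally expansive if some compactly generated open subgroup $O\leq G$ has a compact open subgroup $U$ whose normal core in $O$ is trivial. A locally compact group $G$ is monolithic if the intersection of all its non-trivial closed normal subgroups is non-trivial; this intersection is then the monolith. A t.d.l.c. group $G$ is robustly monolithic if it is monolithic and its monolith is non-discrete, regionally expansive and topologically simple. $\mathcal{R}$ denotes the class of robustly monolithic groups. The class of regionally elementary groups is the smallest class of t.d.l.c. groups that contains the second countable profinite groups and the discrete groups and is closed under taking closed subgroups, Hausdorff quotients, group extensions (within t.d.l.c. groups), and directed unions of open subgroups. *)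

theory Defs
  imports "HOL-Analysis.Analysis" "HOL-Algebra.Generated_Groups"
begin

section \<open>Topological groups\<close>

definition topological_group :: "('a, 'm) monoid_scheme \<Rightarrow> 'a topology \<Rightarrow> bool" where
  "topological_group G T \<longleftrightarrow>
     group G \<and> topspace T = carrier G \<and> Hausdorff_space T \<and>
     continuous_map (prod_topology T T) T (\<lambda>(x, y). x \<otimes>\<^bsub>G\<^esub> y) \<and>
     continuous_map T T (\<lambda>x. inv\<^bsub>G\<^esub> x)"

definition totally_disconnected_space :: "'a topology \<Rightarrow> bool" where
  "totally_disconnected_space T \<longleftrightarrow> (\<forall>S. connectedin T S \<longrightarrow> (\<exists>x. S \<subseteq> {x}))"

definition tdlc_group :: "('a, 'm) monoid_scheme \<Rightarrow> 'a topology \<Rightarrow> bool" where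
  "tdlc_group G T \<longleftrightarrow>
     topological_group G T \<and> totally_disconnected_space T \<and> locally_compact_space T"

definition profinite_group :: "('a, 'm) monoid_scheme \<Rightarrow> 'a topology \<Rightarrow> bool" where
  "profinite_group G T \<longleftrightarrow>
     topological_group G T \<and> compact_space T \<and> totally_disconnected_space T"

definition discrete_group :: "('a, 'm) monoid_scheme \<Rightarrow> 'a topology \<Rightarrow> bool" where
  "discrete_group G T \<longleftrightarrow> topological_group G T \<and> T = discrete_topology (carrier G)"

definition topologically_isomorphic ::
  "('a, 'm) monoid_scheme \<Rightarrow> 'a topology \<Rightarrow> ('b, 'n) monoid_scheme \<Rightarrow> 'b topology \<Rightarrow> bool" where
  "topologically_isomorphic G T H S \<longleftrightarrow> (\<exists>h \<in> iso G H. homeomorphic_map T S h)"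

abbreviation subgroup_of :: "('a, 'm) monoid_scheme \<Rightarrow> 'a set \<Rightarrow> ('a, 'm) monoid_scheme" where
  "subgroup_of G H \<equiv> G\<lparr>carrier := H\<rparr>"

definition quotient_topology ::
  "('a, 'm) monoid_scheme \<Rightarrow> 'a topology \<Rightarrow> 'a set \<Rightarrow> 'a set topology" where
  "quotient_topology G T N =
     topology (\<lambda>\<U>. \<U> \<subseteq> carrier (G Mod N) \<and> openin T {x \<in> topspace T. N #>\<^bsub>G\<^esub> x \<in> \<U>})"

lemma openin_quotient_topology:
  "openin (quotient_topology G T N) \<U> \<longleftrightarrow>
     \<U> \<subseteq> carrier (G Mod N) \<and> openin T {x \<in> topspace T. N #>\<^bsub>G\<^esub> x \<in> \<U>}"
proof -
  have "istopology (\<lambda>\<U>. \<U> \<subseteq> carrier (G Mod N) \<and> openin T {x \<in> topspace T. N #>\<^bsub>G\<^esub> x \<in> \<U>})"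
    unfolding istopology_def
  proof (intro conjI allI impI)
    fix \<U> \<V>
    assume *: "\<U> \<subseteq> carrier (G Mod N) \<and> openin T {x \<in> topspace T. N #>\<^bsub>G\<^esub> x \<in> \<U>}"
      "\<V> \<subseteq> carrier (G Mod N) \<and> openin T {x \<in> topspace T. N #>\<^bsub>G\<^esub> x \<in> \<V>}"
    show "\<U> \<inter> \<V> \<subseteq> carrier (G Mod N)"
      using * by blast
    have "{x \<in> topspace T. N #>\<^bsub>G\<^esub> x \<in> \<U> \<inter> \<V>} =
      {x \<in> topspace T. N #>\<^bsub>G\<^esub> x \<in> \<U>} \<inter> {x \<in> topspace T. N #>\<^bsub>G\<^esub> x \<in> \<V>}"
      by blast
    with * show "openin T {x \<in> topspace T. N #>\<^bsub>G\<^esub> x \<in> \<U> \<inter> \<V>}"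
      by auto
  next
    fix \<K>
    assume *: "\<forall>\<U>\<in>\<K>. \<U> \<subseteq> carrier (G Mod N) \<and> openin T {x \<in> topspace T. N #>\<^bsub>G\<^esub> x \<in> \<U>}"
    show "\<Union>\<K> \<subseteq> carrier (G Mod N)"
      using * by blast
    have "{x \<in> topspace T. N #>\<^bsub>G\<^esub> x \<in> \<Union>\<K>} =
      (\<Union>\<U>\<in>\<K>. {x \<in> topspace T. N #>\<^bsub>G\<^esub> x \<in> \<U>})"
      by blast
    with * show "openin T {x \<in> topspace T. N #>\<^bsub>G\<^esub> x \<in> \<Union>\<K>}"
      by auto
  qed
  then show ?thesis
    by (simp add: quotient_topology_def)
qed

lemma quotient_map_quotient_topology:
  assumes "topspace T = carrier G"
  shows "quotient_map T (quotient_topology G T N) (\<lambda>x. N #>\<^bsub>G\<^esub> x)"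
proof -
  have "{x \<in> topspace T. N #>\<^bsub>G\<^esub> x \<in> carrier (G Mod N)} = topspace T"
    by (auto simp: carrier_FactGroup assms)
  then have "openin (quotient_topology G T N) (carrier (G Mod N))"
    by (simp add: openin_quotient_topology)
  then have "topspace (quotient_topology G T N) = carrier (G Mod N)"
    by (metis openin_quotient_topology openin_subset openin_topspace subset_antisym)
  then show ?thesis
    by (auto simp: quotient_map_def openin_quotient_topology carrier_FactGroup assms)
qed


section \<open>Robustly monolithic groups\<close>

definition compactly_generated :: "('a, 'm) monoid_scheme \<Rightarrow> 'a topology \<Rightarrow> bool" where
  "compactly_generated G T \<longleftrightarrow> (\<exists>K. compactin T K \<and> generate G K = carrier G)"

definition normal_core :: "('a, 'm) monoid_scheme \<Rightarrow> 'a set \<Rightarrow> 'a set" where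
  "normal_core K L = (\<Inter>k \<in> carrier K. (k <#\<^bsub>K\<^esub> L) #>\<^bsub>K\<^esub> (inv\<^bsub>K\<^esub> k))"

definition regionally_expansive :: "('a, 'm) monoid_scheme \<Rightarrow> 'a topology \<Rightarrow> bool" where
  "regionally_expansive G T \<longleftrightarrow>
     tdlc_group G T \<and>
     (\<exists>O' U. subgroup O' G \<and> openin T O' \<and>
        compactly_generated (subgroup_of G O') (subtopology T O') \<and>
        subgroup U (subgroup_of G O') \<and>
        compactin (subtopology T O') U \<and> openin (subtopology T O') U \<and>
        normal_core (subgroup_of G O') U = {\<one>\<^bsub>G\<^esub>})"

text \<open>Intersecting with the carrier only matters for the trivial group, where the family of
  nontrivial closed normal subgroups is empty; the trivial group is not monolithic.\<close>

definition monolith :: "('a, 'm) monoid_scheme \<Rightarrow> 'a topology \<Rightarrow> 'a set" where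
  "monolith G T = carrier G \<inter> \<Inter>{N. N \<lhd> G \<and> closedin T N \<and> N \<noteq> {\<one>\<^bsub>G\<^esub>}}"

definition monolithic :: "('a, 'm) monoid_scheme \<Rightarrow> 'a topology \<Rightarrow> bool" where
  "monolithic G T \<longleftrightarrow>
     topological_group G T \<and> locally_compact_space T \<and> monolith G T \<noteq> {\<one>\<^bsub>G\<^esub>}"

definition topologically_simple :: "('a, 'm) monoid_scheme \<Rightarrow> 'a topology \<Rightarrow> bool" where
  "topologically_simple G T \<longleftrightarrow>
     topological_group G T \<and> carrier G \<noteq> {\<one>\<^bsub>G\<^esub>} \<and>
     (\<forall>N. N \<lhd> G \<and> closedin T N \<longrightarrow> N = {\<one>\<^bsub>G\<^esub>} \<or> N = carrier G)"

definition robustly_monolithic :: "('a, 'm) monoid_scheme \<Rightarrow> 'a topology \<Rightarrow> bool" where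
  "robustly_monolithic G T \<longleftrightarrow>
     tdlc_group G T \<and> monolithic G T \<and>
     (let M = subgroup_of G (monolith G T); S = subtopology T (monolith G T) in
        \<not> discrete_group M S \<and> regionally_expansive M S \<and> topologically_simple M S)"


section \<open>Regionally elementary groups\<close>

text \<open>The smallest class of t.d.l.c. groups with the required closure properties, among the groups
  whose elements are drawn from a fixed type. Cosets of such a group live in another type, so a
  quotient is represented by any topologically isomorphic group over the given type; in particular
  (quotient by the trivial subgroup) the class is closed under topological isomorphism.\<close>

inductive regionally_elementary_over :: "'u monoid \<Rightarrow> 'u topology \<Rightarrow> bool" where
  profinite:
    "profinite_group G T \<Longrightarrow> second_countable T \<Longrightarrow> regionally_elementary_over G T"
| discrete:
    "discrete_group G T \<Longrightarrow> regionally_elementary_over G T"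
| closed_subgroup:
    "regionally_elementary_over G T \<Longrightarrow> subgroup H G \<Longrightarrow> closedin T H \<Longrightarrow>
     regionally_elementary_over (subgroup_of G H) (subtopology T H)"
| quotient:
    "regionally_elementary_over G T \<Longrightarrow> N \<lhd> G \<Longrightarrow> closedin T N \<Longrightarrow>
     tdlc_group Q S \<Longrightarrow> topologically_isomorphic (G Mod N) (quotient_topology G T N) Q S \<Longrightarrow>
     regionally_elementary_over Q S"
| extension:
    "tdlc_group G T \<Longrightarrow> N \<lhd> G \<Longrightarrow> closedin T N \<Longrightarrow>
     regionally_elementary_over (subgroup_of G N) (subtopology T N) \<Longrightarrow>
     topologically_isomorphic (G Mod N) (quotient_topology G T N) Q S \<Longrightarrow>
     regionally_elementary_over Q S \<Longrightarrow>
     regionally_elementary_over G T"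
| directed_union:
    "tdlc_group G T \<Longrightarrow> \<O> \<noteq> {} \<Longrightarrow>
     (\<forall>A\<in>\<O>. \<forall>B\<in>\<O>. \<exists>C\<in>\<O>. A \<union> B \<subseteq> C) \<Longrightarrow>
     (\<forall>A\<in>\<O>. subgroup A G \<and> openin T A \<and>
        regionally_elementary_over (subgroup_of G A) (subtopology T A)) \<Longrightarrow>
     \<Union>\<O> = carrier G \<Longrightarrow>
     regionally_elementary_over G T"

text \<open>The witnessing construction of a regionally elementary group may pass through groups that
  are larger than the group itself. Hence the type \<open>'u\<close> that provides the elements of these
  groups is a parameter, independent of the type of the group. Every construction uses only a set
  of groups, so regional elementarity is regional elementarity over some sufficiently large
  \<open>'u\<close>, and a statement about all regionally elementary groups is one in which \<open>'u\<close> is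
  arbitrary.\<close>

definition regionally_elementary ::
  "'u itself \<Rightarrow> ('a, 'm) monoid_scheme \<Rightarrow> 'a topology \<Rightarrow> bool" where
  "regionally_elementary _ G T \<longleftrightarrow>
     tdlc_group G T \<and>
     (\<exists>(H :: 'u monoid) S. regionally_elementary_over H S \<and> topologically_isomorphic G T H S)"

end

theory Submission
  imports Defs
begin

text \<open>The proof reduces the theorem to a descent that cannot go on for ever. For a subgroup \<open>Q\<close> let the
discrete residual \<open>Res Q\<close> be the intersection of the open normal subgroups of \<open>Q\<close>. Call a closed
subgroup residually founded if it becomes trivial after finitely many steps however one alternates
between choosing a compactly generated open subgroup and passing to its discrete residual; this is
the inductive predicate \<open>residually_founded\<close>, which replaces ordinal-valued decomposition ranks by
rule induction.

Every regionally elementary group is residually founded. The class has the required closure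
properties because residuals are functorial: a continuous homomorphism maps compactly generated
subgroups into compactly generated open ones and residuals into residuals, so the property can be
pulled back along a continuous homomorphism with residually founded kernel
(\<open>residually_founded_hom\<close>). This covers closed subgroups, extensions and directed unions. Quotients are
harder, since the image of a residual need not be closed. One works instead with images of products
\<open>K V\<close>, where \<open>V\<close> is a compact open subgroup normalizing \<open>K\<close>; these are open, hence closed
(\<open>residually_founded_quotient\<close>). What makes this work is that a compactly generated group has
an open normal subgroup between \<open>Res Q\<close> and \<open>Res Q \<cdot> L\<close>, for each compact open subgroup \<open>L\<close>
(\<open>open_normal_near_residual\<close>).

On the other hand, let \<open>M\<close> be non-discrete, topologically simple and regionally expansive. Then \<open>M\<close>
has a compactly generated open subgroup \<open>Q\<close> whose residual contains a closed subgroup \<open>N\<close> that is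
again non-discrete, topologically simple and regionally expansive (\<open>smaller_expansive_simple\<close>).
Iterating this contradicts residual foundedness, and the monolith of a robustly monolithic group is
such an \<open>M\<close>.

The subgroup \<open>N\<close> is the smallest non-trivial closed normal subgroup of \<open>Q\<close>. Two compactness
arguments produce it. Expansiveness yields a compact set not containing the identity that
all non-trivial closed normal subgroups of \<open>Q\<close>, and of \<open>N\<close>, meet (\<open>meets_moved\<close>).
Simplicity of \<open>M\<close> and compactness of this set then give finitely many elements such that every
subgroup normalized by them and meeting the compact set meets finitely many prescribed open sets
(\<open>hitting\<close>). If two of these open sets consist of pairwise non-commuting elements, then any two
non-trivial closed normal subgroups fail to commute, so their intersection is non-trivial, and by
compactness the intersection of all of them is non-trivial (\<open>ample_monolith\<close>). The union of the
smallest normal subgroups, over all large \<open>Q\<close>, is a dense normal subgroup of \<open>M\<close>. Hence the finitely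
many elements can be found inside a single \<open>N\<close>, and the same argument applied to \<open>N\<close> gives a smallest
non-trivial closed normal subgroup of \<open>N\<close>; it is normal in \<open>Q\<close>, hence equal to \<open>N\<close>, so \<open>N\<close> is
topologically simple.\<close>

section \<open>Topological groups and their compact open subgroups\<close>

lemma (in group) cancel_left [simp]:
  assumes "x \<in> carrier G" "y \<in> carrier G"
  shows "inv x \<otimes> (x \<otimes> y) = y" "x \<otimes> (inv x \<otimes> y) = y"
  using assms by (simp_all add: m_assoc[symmetric])

locale top_group = group G for G (structure) +
  fixes T :: "'a topology"
  assumes top_group: "topological_group G T"
begin

lemma topspace [simp]: "topspace T = carrier G"
  using top_group by (simp add: topological_group_def)

lemma Hausdorff: "Hausdorff_space T"
  using top_group by (simp add: topological_group_def)

lemma continuous_mult: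
  assumes "continuous_map X T f" "continuous_map X T g"
  shows "continuous_map X T (\<lambda>x. f x \<otimes> g x)"
proof -
  have "continuous_map (prod_topology T T) T (\<lambda>(x, y). x \<otimes> y)"
    using top_group by (simp add: topological_group_def)
  moreover have "continuous_map X (prod_topology T T) (\<lambda>x. (f x, g x))"
    using assms by (simp add: continuous_map_pairedI)
  ultimately have "continuous_map X T ((\<lambda>(x, y). x \<otimes> y) \<circ> (\<lambda>x. (f x, g x)))"
    by (rule continuous_map_compose[rotated])
  then show ?thesis by (simp add: comp_def)
qed

lemma continuous_inv:
  assumes "continuous_map X T f"
  shows "continuous_map X T (\<lambda>x. inv f x)"
proof -
  have "continuous_map T T (\<lambda>x. inv x)"
    using top_group by (simp add: topological_group_def)
  from continuous_map_compose[OF assms this] show ?thesis by (simp add: comp_def)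
qed

lemma continuous_const: "g \<in> carrier G \<Longrightarrow> continuous_map X T (\<lambda>x. g)"
  by simp

lemma continuous_id: "continuous_map T T (\<lambda>x. x)"
  by simp

lemmas continuous_intro = continuous_mult continuous_inv continuous_const continuous_id
  continuous_map_fst continuous_map_snd

lemma open_preimage:
  assumes "continuous_map T T f" "openin T V"
  shows "openin T {x \<in> carrier G. f x \<in> V}"
  using openin_continuous_map_preimage[OF assms] by simp

lemma compact_closed: "compactin T K \<Longrightarrow> closedin T K"
  using compactin_imp_closedin[OF Hausdorff] .

lemma compact_carrier: "compactin T K \<Longrightarrow> K \<subseteq> carrier G"
  using compactin_subset_topspace by fastforce

lemma open_carrier: "openin T V \<Longrightarrow> V \<subseteq> carrier G"
  using openin_subset by fastforce

lemma closed_carrier: "closedin T V \<Longrightarrow> V \<subseteq> carrier G"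
  using closedin_subset by fastforce

lemma closed_one: "closedin T {\<one>}"
  using Hausdorff by (simp add: closedin_Hausdorff_singleton)

text \<open>The tube lemma for two-variable expressions in a topological group: a condition that holds at one
point uniformly along a compact set persists on a neighbourhood of the point.\<close>
lemma tube:
  assumes f: "continuous_map (prod_topology T T) T (\<lambda>p. f (fst p) (snd p))"
    and K: "compactin T K" and W: "openin T W" and a: "a \<in> carrier G"
    and sub: "\<And>k. k \<in> K \<Longrightarrow> f a k \<in> W"
  obtains V where "openin T V" "a \<in> V" "\<And>x k. x \<in> V \<Longrightarrow> k \<in> K \<Longrightarrow> f x k \<in> W"
proof -
  let ?P = "{p \<in> topspace (prod_topology T T). f (fst p) (snd p) \<in> W}"
  have P: "openin (prod_topology T T) ?P"
    using openin_continuous_map_preimage[OF f W] .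
  have ca: "compactin T {a}" using a by (simp add: finite_imp_compactin)
  have "{a} \<times> K \<subseteq> ?P"
    using a sub compact_carrier[OF K] by auto
  then obtain U V where *: "openin T U" "openin T V" "{a} \<subseteq> U" "K \<subseteq> V" "U \<times> V \<subseteq> ?P"
    by (rule Wallace_theorem_prod_topology[OF ca K P])
  show ?thesis
  proof (rule that[of U])
    show "f x k \<in> W" if "x \<in> U" "k \<in> K" for x k
    proof -
      have "(x, k) \<in> ?P" using * that by blast
      then show ?thesis by simp
    qed
  qed (use * in auto)
qed

lemma conj_tube:
  assumes K: "compactin T K" and W: "openin T W" "\<one> \<in> W"
  obtains V where "openin T V" "\<one> \<in> V" "\<And>x k. x \<in> V \<Longrightarrow> k \<in> K \<Longrightarrow> k \<otimes> x \<otimes> inv k \<in> W"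
proof -
  have c: "continuous_map (prod_topology T T) T (\<lambda>p. snd p \<otimes> fst p \<otimes> inv (snd p))"
    by (intro continuous_intro)
  have "k \<otimes> \<one> \<otimes> inv k \<in> W" if "k \<in> K" for k
    using compact_carrier[OF K] that W by auto
  from tube[OF c K W(1) one_closed this] that show ?thesis by blast
qed

text \<open>A subgroup is a union of translates of any neighbourhood of the identity inside it, so openness
relative to \<open>A\<close> can be tested at the identity.\<close>
lemma open_subgroup:
  assumes A: "subgroup A G" and Q: "subgroup Q G" "Q \<subseteq> A"
    and V: "openin T V" "\<one> \<in> V" "V \<inter> A \<subseteq> Q"
  shows "openin (subtopology T A) Q"
proof -
  let ?O = "\<Union>q\<in>Q. {x \<in> carrier G. inv q \<otimes> x \<in> V}"
  have Qc: "Q \<subseteq> carrier G" using Q by (simp add: subgroup.subset)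
  have "openin T ?O"
    using Qc by (intro openin_Union ballI; clarsimp)
      (intro open_preimage continuous_intro V(1); auto)
  moreover have "Q = ?O \<inter> A"
  proof
    show "Q \<subseteq> ?O \<inter> A"
    proof
      fix x assume "x \<in> Q"
      then have "x \<in> {y \<in> carrier G. inv x \<otimes> y \<in> V}" "x \<in> A" using Qc Q V by auto
      then show "x \<in> ?O \<inter> A" using \<open>x \<in> Q\<close> by blast
    qed
    show "?O \<inter> A \<subseteq> Q"
    proof
      fix x assume "x \<in> ?O \<inter> A"
      then obtain q where q: "q \<in> Q" "x \<in> carrier G" "inv q \<otimes> x \<in> V" "x \<in> A" by blast
      then have "inv q \<otimes> x \<in> A"
        using A Q by (meson subgroup.m_closed subgroup.m_inv_closed subsetD)
      then have "inv q \<otimes> x \<in> Q" using q V by blast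
      then have "q \<otimes> (inv q \<otimes> x) \<in> Q" using q Q by (simp add: subgroup.m_closed)
      then show "x \<in> Q" using q Qc by auto
    qed
  qed
  ultimately show ?thesis by (auto simp: openin_subtopology)
qed

lemma open_nbhd:
  assumes "openin (subtopology T A) Q" "\<one> \<in> Q"
  obtains V where "openin T V" "\<one> \<in> V" "V \<inter> A \<subseteq> Q"
  using assms by (auto simp: openin_subtopology)

text \<open>The complement is a union of cosets, which are open as well.\<close>
lemma open_subgroup_closed:
  assumes A: "subgroup A G" and Q: "subgroup Q G" "openin (subtopology T A) Q"
  shows "closedin (subtopology T A) Q"
proof -
  obtain V where V: "openin T V" "\<one> \<in> V" "V \<inter> A \<subseteq> Q"
    using open_nbhd[OF Q(2)] Q(1) subgroup.one_closed by blast
  let ?O = "\<Union>q\<in>A - Q. {x \<in> carrier G. inv q \<otimes> x \<in> V}"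
  have Ac: "A \<subseteq> carrier G" using A by (simp add: subgroup.subset)
  have QA: "Q \<subseteq> A" using Q(2) openin_subset by fastforce
  have "openin T ?O"
    using Ac by (intro openin_Union ballI; clarsimp)
      (intro open_preimage continuous_intro V(1); auto)
  moreover have "A - Q = ?O \<inter> A"
  proof
    show "A - Q \<subseteq> ?O \<inter> A"
    proof
      fix x assume x: "x \<in> A - Q"
      then have "x \<in> {y \<in> carrier G. inv x \<otimes> y \<in> V}" using Ac V by auto
      then show "x \<in> ?O \<inter> A" using x by blast
    qed
    show "?O \<inter> A \<subseteq> A - Q"
    proof
      fix x assume "x \<in> ?O \<inter> A"
      then obtain q where q: "q \<in> A" "q \<notin> Q" "inv q \<otimes> x \<in> V" "x \<in> A" by blast
      then have "inv q \<otimes> x \<in> A"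
        using A by (meson subgroup.m_closed subgroup.m_inv_closed)
      then have *: "inv q \<otimes> x \<in> Q" using q V by blast
      have "x \<notin> Q"
      proof
        assume "x \<in> Q"
        then have "x \<otimes> inv (inv q \<otimes> x) \<in> Q" using * Q(1) by (simp add: subgroup.m_closed subgroup.m_inv_closed)
        moreover have "x \<otimes> inv (inv q \<otimes> x) = q"
          using q Ac by (simp add: inv_mult_group subset_iff m_assoc[symmetric])
        ultimately show False using q by simp
      qed
      then show "x \<in> A - Q" using q by simp
    qed
  qed
  ultimately have "openin (subtopology T A) (A - Q)" by (auto simp: openin_subtopology)
  moreover have "topspace (subtopology T A) = A" using Ac by auto
  ultimately show ?thesis using QA by (auto simp: closedin_def)
qed

lemma open_subgroup_closed_ambient:
  assumes "subgroup A G" "closedin T A" "subgroup Q G" "openin (subtopology T A) Q"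
  shows "closedin T Q"
  using open_subgroup_closed assms closedin_trans_full by blast

lemma open_subgroup_of_nbhd:
  assumes "subgroup Q G" "openin T V" "\<one> \<in> V" "V \<subseteq> Q"
  shows "openin T Q" "closedin T Q"
proof -
  have st: "subtopology T (carrier G) = T" by (metis subtopology_topspace topspace)
  have "openin (subtopology T (carrier G)) Q"
    by (rule open_subgroup[OF subgroup_self assms(1) subgroup.subset[OF assms(1)] assms(2,3)])
      (use assms in auto)
  then show "openin T Q" "closedin T Q"
    using open_subgroup_closed[OF subgroup_self assms(1)] st by auto
qed

lemma compact_cover:
  assumes K: "compactin T K" "K \<subseteq> A" and A: "subgroup A G"
    and Q: "subgroup Q G" "openin (subtopology T A) Q"
  obtains F where "finite F" "F \<subseteq> K" "\<And>k. k \<in> K \<Longrightarrow> \<exists>f\<in>F. inv f \<otimes> k \<in> Q"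
proof -
  obtain V where V: "openin T V" "\<one> \<in> V" "V \<inter> A \<subseteq> Q"
    using open_nbhd[OF Q(2)] Q(1) subgroup.one_closed by blast
  have Kc: "K \<subseteq> carrier G" using K compact_carrier by blast
  let ?W = "\<lambda>q. {x \<in> carrier G. inv q \<otimes> x \<in> V}"
  have "\<forall>U\<in>?W ` K. openin T U"
    using Kc by (auto intro!: open_preimage continuous_intro V(1))
  moreover have "K \<subseteq> \<Union>(?W ` K)"
  proof
    fix x assume x: "x \<in> K"
    then have "x \<in> ?W x" using Kc V by auto
    then show "x \<in> \<Union>(?W ` K)" using x by blast
  qed
  ultimately obtain \<F> where \<F>: "finite \<F>" "\<F> \<subseteq> ?W ` K" "K \<subseteq> \<Union>\<F>"
    using K(1) unfolding compactin_def by meson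
  obtain F where F: "F \<subseteq> K" "finite F" "\<F> = ?W ` F"
    using finite_subset_image[OF \<F>(1,2)] by blast
  show ?thesis
  proof (rule that[OF F(2,1)])
    fix k assume "k \<in> K"
    then obtain f where f: "f \<in> F" "inv f \<otimes> k \<in> V" using F \<F>(3) by auto
    have "inv f \<otimes> k \<in> A"
      using f F K A \<open>k \<in> K\<close> by (meson subgroup.m_closed subgroup.m_inv_closed subsetD)
    then show "\<exists>f\<in>F. inv f \<otimes> k \<in> Q" using f V by blast
  qed
qed

lemma compact_conj:
  assumes "compactin T K" "compactin T L"
  shows "compactin T {k \<otimes> l \<otimes> inv k |k l. k \<in> K \<and> l \<in> L}"
proof -
  have "compactin (prod_topology T T) (K \<times> L)"
    using assms by (simp add: compactin_Times)
  moreover have "continuous_map (prod_topology T T) T (\<lambda>p. fst p \<otimes> snd p \<otimes> inv (fst p))"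
    by (intro continuous_intro)
  ultimately have "compactin T ((\<lambda>p. fst p \<otimes> snd p \<otimes> inv (fst p)) ` (K \<times> L))"
    by (rule image_compactin)
  moreover have "(\<lambda>p. fst p \<otimes> snd p \<otimes> inv (fst p)) ` (K \<times> L) = {k \<otimes> l \<otimes> inv k |k l. k \<in> K \<and> l \<in> L}"
    by force
  ultimately show ?thesis by simp
qed

end

text \<open>The conclusion of van Dantzig's theorem, taken as the standing assumption on topological groups:
it passes to closed subgroups without any discussion of local compactness or connectedness.\<close>
locale van_dantzig_group = top_group +
  assumes small_subgroup:
    "openin T W \<Longrightarrow> \<one> \<in> W \<Longrightarrow> \<exists>V. subgroup V G \<and> compactin T V \<and> openin T V \<and> V \<subseteq> W"

text \<open>Inside a compact neighbourhood, quasi-components coincide with components and hence are points, so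
the identity can be separated by a clopen set from the part that is not interior.\<close>
lemma (in top_group) compact_open_nbhd:
  assumes td: "totally_disconnected_space T" and lc: "locally_compact_space T"
    and W: "openin T W" "\<one> \<in> W"
  obtains C where "openin T C" "compactin T C" "\<one> \<in> C" "C \<subseteq> W"
proof -
  have "neighbourhood_base_of (compactin T) T"
    using locally_compact_space_neighbourhood_base Hausdorff lc by blast
  then obtain u K where uK: "openin T u" "compactin T K" "\<one> \<in> u" "u \<subseteq> K" "K \<subseteq> W"
    using W unfolding neighbourhood_base_of by metis
  let ?K = "subtopology T K"
  have topK: "topspace ?K = K" using compact_carrier[OF uK(2)] by auto
  have cK: "compact_space ?K" using uK by (simp add: compact_space_subtopology)
  have hK: "Hausdorff_space ?K" using Hausdorff by (simp add: Hausdorff_space_subtopology)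
  have q: "quasi_components_of ?K = connected_components_of ?K"
    by (rule quasi_eq_connected_components_of) (use cK hK in blast)
  have "\<one> \<in> topspace ?K" using uK topK by auto
  moreover have "connected_component_of_set ?K \<one> = {\<one>}"
  proof -
    have "connectedin T (connected_component_of_set ?K \<one>)"
      using connectedin_connected_component_of[of ?K \<one>] by (simp add: connectedin_subtopology)
    then obtain x where "connected_component_of_set ?K \<one> \<subseteq> {x}"
      using td unfolding totally_disconnected_space_def by blast
    moreover have "\<one> \<in> connected_component_of_set ?K \<one>"
      using \<open>\<one> \<in> topspace ?K\<close> by (simp add: connected_component_of_refl)
    ultimately show ?thesis by auto
  qed
  ultimately have "{\<one>} \<in> quasi_components_of ?K"
    unfolding q connected_components_of_def by (auto simp: image_iff intro!: bexI[of _ "\<one>"])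
  moreover have "compactin ?K (K - u)"
  proof -
    have "closedin T (K - u)" using uK compact_closed by (simp add: closedin_diff)
    then have "compactin T (K - u)" using closed_compactin[OF uK(2)] by blast
    then show ?thesis by (simp add: compactin_subtopology)
  qed
  ultimately have "separated_between ?K {\<one>} (K - u)"
    using separated_between_quasi_component_compact uK by (fastforce simp: disjnt_iff)
  then obtain C where C: "closedin ?K C" "openin ?K C" "{\<one>} \<subseteq> C" "K - u \<subseteq> topspace ?K - C"
    by (auto simp: separated_between)
  have "C \<subseteq> K" using C(1) closedin_subset topK by blast
  then have "C \<subseteq> u" using C(4) by blast
  have "closedin T C" using C(1) compact_closed[OF uK(2)] closedin_trans_full by blast
  then have "compactin T C" using closed_compactin[OF uK(2) \<open>C \<subseteq> K\<close>] by blast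
  moreover have "openin T C"
  proof -
    obtain O' where "openin T O'" "C = O' \<inter> K" using C(2) by (auto simp: openin_subtopology)
    then have "C = O' \<inter> u" using \<open>C \<subseteq> u\<close> uK by blast
    then show ?thesis using \<open>openin T O'\<close> uK by blast
  qed
  moreover have "\<one> \<in> C" "C \<subseteq> W" using C \<open>C \<subseteq> K\<close> uK by auto
  ultimately show ?thesis by (intro that)
qed

text \<open>A compact open neighbourhood \<open>C\<close> of the identity satisfies \<open>V C \<subseteq> C\<close> for some symmetric
neighbourhood \<open>V\<close>; the subgroup generated by \<open>V\<close> then stays in \<open>C\<close>.\<close>
lemma tdlc_imp_van_dantzig_group:
  fixes G (structure)
  assumes "tdlc_group G T"
  shows "van_dantzig_group G T"
proof -
  interpret top_group G T
    using assms by (simp add: tdlc_group_def top_group_def top_group_axioms_def topological_group_def)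
  show ?thesis
  proof
    fix W assume "openin T W" "\<one> \<in> W"
    then obtain C where C: "openin T C" "compactin T C" "\<one> \<in> C" "C \<subseteq> W"
      using compact_open_nbhd assms unfolding tdlc_group_def by metis
    have Cc: "C \<subseteq> carrier G" using C compact_carrier by blast
    have "continuous_map (prod_topology T T) T (\<lambda>p. fst p \<otimes> snd p)"
      by (intro continuous_intro)
    from tube[OF this C(2) C(1) one_closed] Cc
    obtain V0 where V0: "openin T V0" "\<one> \<in> V0" "\<And>x k. x \<in> V0 \<Longrightarrow> k \<in> C \<Longrightarrow> x \<otimes> k \<in> C"
      by (metis (mono_tags, lifting) l_one subsetD)
    define V where "V = V0 \<inter> {x \<in> carrier G. inv x \<in> V0}"
    have "openin T {x \<in> carrier G. inv x \<in> V0}"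
      by (intro open_preimage continuous_intro V0(1))
    then have V: "openin T V" "\<one> \<in> V"
      unfolding V_def using V0 by auto
    have Vc: "V \<subseteq> carrier G" using V_def by blast
    have step: "x \<otimes> k \<in> C" if "x \<in> generate G V" "k \<in> C" for x k
      using that
    proof (induction arbitrary: k rule: generate.induct)
      case one then show ?case using Cc by auto
    next
      case (incl h) then show ?case using V0 V_def by auto
    next
      case (inv h) then show ?case using V0 V_def by auto
    next
      case (eng h1 h2)
      have "h1 \<in> carrier G" "h2 \<in> carrier G" using eng generate_in_carrier[OF Vc] by auto
      then show ?case using eng Cc by (simp add: m_assoc subset_iff)
    qed
    let ?H = "generate G V"
    have sH: "subgroup ?H G" using generate_is_subgroup[OF Vc] .
    have HC: "?H \<subseteq> C"
      using step[OF _ C(3)] generate_in_carrier[OF Vc] by fastforce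
    have VH: "V \<subseteq> ?H" by (auto intro: generate.incl)
    have oH: "openin T ?H" and "closedin T ?H"
      using open_subgroup_of_nbhd[OF sH V VH] by auto
    then have "compactin T ?H" using closed_compactin[OF C(2) HC] by blast
    then show "\<exists>V. subgroup V G \<and> compactin T V \<and> openin T V \<and> V \<subseteq> W"
      using sH oH HC C by blast
  qed
qed

section \<open>The discrete residual\<close>

text \<open>Only one inclusion is required, and \<open>A\<close> may be any set. When \<open>A\<close> is closed under inverses, as a
subgroup is, conjugation by its elements maps \<open>N\<close> onto itself.\<close>
definition normalizes :: "('a, 'm) monoid_scheme \<Rightarrow> 'a set \<Rightarrow> 'a set \<Rightarrow> bool" where
  "normalizes G A N \<longleftrightarrow> (\<forall>g\<in>A. \<forall>x\<in>N. g \<otimes>\<^bsub>G\<^esub> x \<otimes>\<^bsub>G\<^esub> inv\<^bsub>G\<^esub> g \<in> N)"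

definition open_normals :: "('a, 'm) monoid_scheme \<Rightarrow> 'a topology \<Rightarrow> 'a set \<Rightarrow> 'a set set" where
  "open_normals G T Q =
     {N. subgroup N G \<and> N \<subseteq> Q \<and> openin (subtopology T Q) N \<and> normalizes G Q N}"

definition residual :: "('a, 'm) monoid_scheme \<Rightarrow> 'a topology \<Rightarrow> 'a set \<Rightarrow> 'a set" where
  "residual G T Q = \<Inter>(open_normals G T Q)"

definition cpt_generated :: "('a, 'm) monoid_scheme \<Rightarrow> 'a topology \<Rightarrow> 'a set \<Rightarrow> bool" where
  "cpt_generated G T Q \<longleftrightarrow> (\<exists>K. compactin T K \<and> generate G K = Q)"

lemma normalizesI:
  "(\<And>g x. g \<in> A \<Longrightarrow> x \<in> N \<Longrightarrow> g \<otimes>\<^bsub>G\<^esub> x \<otimes>\<^bsub>G\<^esub> inv\<^bsub>G\<^esub> g \<in> N) \<Longrightarrow> normalizes G A N"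
  by (simp add: normalizes_def)

lemma normalizesD:
  "normalizes G A N \<Longrightarrow> g \<in> A \<Longrightarrow> x \<in> N \<Longrightarrow> g \<otimes>\<^bsub>G\<^esub> x \<otimes>\<^bsub>G\<^esub> inv\<^bsub>G\<^esub> g \<in> N"
  by (simp add: normalizes_def)

lemma subset_generate: "K \<subseteq> generate G K"
  by (auto intro: generate.incl)

context group begin

lemma conj_mult:
  assumes "g \<in> carrier G" "x \<in> carrier G" "y \<in> carrier G"
  shows "g \<otimes> (x \<otimes> y) \<otimes> inv g = (g \<otimes> x \<otimes> inv g) \<otimes> (g \<otimes> y \<otimes> inv g)"
  using assms by (simp add: m_assoc)

lemma conj_inv:
  assumes "g \<in> carrier G" "x \<in> carrier G"
  shows "g \<otimes> inv x \<otimes> inv g = inv (g \<otimes> x \<otimes> inv g)"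
  using assms by (simp add: m_assoc inv_mult_group)

lemma conj_conj:
  assumes "g \<in> carrier G" "h \<in> carrier G" "x \<in> carrier G"
  shows "g \<otimes> (h \<otimes> x \<otimes> inv h) \<otimes> inv g = (g \<otimes> h) \<otimes> x \<otimes> inv (g \<otimes> h)"
  using assms by (simp add: m_assoc inv_mult_group)

lemma conj_of_conj:
  assumes "g \<in> carrier G" "h \<in> carrier G" "x \<in> carrier G"
  shows "g \<otimes> (h \<otimes> x \<otimes> inv h) \<otimes> inv g =
    (g \<otimes> h \<otimes> inv g) \<otimes> (g \<otimes> x \<otimes> inv g) \<otimes> inv (g \<otimes> h \<otimes> inv g)"
  using assms by (simp add: m_assoc inv_mult_group)

lemma normalizes_self: "subgroup A G \<Longrightarrow> normalizes G A A"
  by (auto intro!: normalizesI simp: subgroup.m_closed subgroup.m_inv_closed)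

lemma normalizes_mono: "normalizes G A N \<Longrightarrow> B \<subseteq> A \<Longrightarrow> normalizes G B N"
  by (auto simp: normalizes_def)

lemma normalizes_Int: "normalizes G A N \<Longrightarrow> normalizes G A M \<Longrightarrow> normalizes G A (N \<inter> M)"
  by (auto simp: normalizes_def)

lemma normalizes_generate:
  assumes K: "K \<subseteq> carrier G" and N: "N \<subseteq> carrier G"
    and "\<And>k x. k \<in> K \<Longrightarrow> x \<in> N \<Longrightarrow> k \<otimes> x \<otimes> inv k \<in> N"
    and "\<And>k x. k \<in> K \<Longrightarrow> x \<in> N \<Longrightarrow> inv k \<otimes> x \<otimes> k \<in> N"
  shows "normalizes G (generate G K) N"
proof (rule normalizesI)
  fix g x assume "g \<in> generate G K" "x \<in> N"
  then show "g \<otimes> x \<otimes> inv g \<in> N"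
  proof (induction arbitrary: x rule: generate.induct)
    case one then show ?case using N by auto
  next
    case (incl h) then show ?case using assms by auto
  next
    case (inv h) then show ?case using assms by auto
  next
    case (eng h1 h2)
    have "h1 \<in> carrier G" "h2 \<in> carrier G" "x \<in> carrier G"
      using eng generate_in_carrier[OF K] N by auto
    then have "h1 \<otimes> h2 \<otimes> x \<otimes> inv (h1 \<otimes> h2) = h1 \<otimes> (h2 \<otimes> x \<otimes> inv h2) \<otimes> inv h1"
      by (simp add: conj_conj)
    then show ?case using eng by simp
  qed
qed

lemma generate_normalized:
  assumes K: "K \<subseteq> carrier G" and V: "V \<subseteq> carrier G" and n: "normalizes G V K"
  shows "normalizes G V (generate G K)"
proof (rule normalizesI)
  fix g x assume g: "g \<in> V" and x: "x \<in> generate G K"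
  have gc: "g \<in> carrier G" using g V by auto
  from x show "g \<otimes> x \<otimes> inv g \<in> generate G K"
  proof (induction rule: generate.induct)
    case one then show ?case using gc by (simp add: generate.one)
  next
    case (incl h) then show ?case using normalizesD[OF n g] by (simp add: generate.incl)
  next
    case (inv h)
    then have "g \<otimes> inv h \<otimes> inv g = inv (g \<otimes> h \<otimes> inv g)" using gc K by (simp add: conj_inv subset_iff)
    then show ?case using normalizesD[OF n g inv] by (simp add: generate.inv)
  next
    case (eng h1 h2)
    have "h1 \<in> carrier G" "h2 \<in> carrier G" using eng generate_in_carrier[OF K] by auto
    then show ?case using eng gc by (simp add: conj_mult generate.eng)
  qed
qed

lemma set_mult_iff: "x \<in> A <#> B \<longleftrightarrow> (\<exists>a\<in>A. \<exists>b\<in>B. x = a \<otimes> b)"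
  by (auto simp: set_mult_def)

lemma product_subgroup:
  assumes R: "subgroup R G" and L: "subgroup L G" and n: "normalizes G L R"
  shows "subgroup (R <#> L) G"
proof -
  have Rc: "R \<subseteq> carrier G" and Lc: "L \<subseteq> carrier G" using R L by (auto simp: subgroup.subset)
  show ?thesis
  proof (rule subgroupI)
    show "R <#> L \<subseteq> carrier G" using Rc Lc by (auto simp: set_mult_iff subset_iff)
    show "R <#> L \<noteq> {}" using R L subgroup.one_closed unfolding set_mult_def by blast
  next
    fix x assume "x \<in> R <#> L"
    then obtain r l where *: "r \<in> R" "l \<in> L" "x = r \<otimes> l" by (auto simp: set_mult_iff)
    have c: "r \<in> carrier G" "l \<in> carrier G" using * Rc Lc by auto
    have "inv l \<otimes> inv r \<otimes> inv (inv l) \<in> R"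
      using normalizesD[OF n] * R L by (simp add: subgroup.m_inv_closed)
    moreover have "inv x = (inv l \<otimes> inv r \<otimes> inv (inv l)) \<otimes> inv l"
      using * c by (simp add: inv_mult_group m_assoc)
    moreover have "inv l \<in> L" using * L by (simp add: subgroup.m_inv_closed)
    ultimately show "inv x \<in> R <#> L" unfolding set_mult_iff by blast
  next
    fix x y assume "x \<in> R <#> L" "y \<in> R <#> L"
    then obtain r l s m where *: "r \<in> R" "l \<in> L" "x = r \<otimes> l" "s \<in> R" "m \<in> L" "y = s \<otimes> m"
      by (auto simp: set_mult_iff)
    have c: "r \<in> carrier G" "l \<in> carrier G" "s \<in> carrier G" "m \<in> carrier G" using * Rc Lc by auto
    have "r \<otimes> (l \<otimes> s \<otimes> inv l) \<in> R"
      using normalizesD[OF n] * R by (simp add: subgroup.m_closed)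
    moreover have "x \<otimes> y = (r \<otimes> (l \<otimes> s \<otimes> inv l)) \<otimes> (l \<otimes> m)"
      using * c by (simp add: m_assoc)
    moreover have "l \<otimes> m \<in> L" using * L by (simp add: subgroup.m_closed)
    ultimately show "x \<otimes> y \<in> R <#> L" unfolding set_mult_iff by blast
  qed
qed

end

context top_group begin

lemma open_normals_self:
  assumes "subgroup Q G" shows "Q \<in> open_normals G T Q"
proof -
  have "openin (subtopology T Q) Q"
    using openin_topspace[of "subtopology T Q"] subgroup.subset[OF assms]
    by (simp add: Int_absorb1)
  then show ?thesis using assms normalizes_self by (simp add: open_normals_def)
qed

lemma open_normals_Int:
  assumes "N \<in> open_normals G T Q" "M \<in> open_normals G T Q"
  shows "N \<inter> M \<in> open_normals G T Q"
  using assms by (auto simp: open_normals_def subgroups_Inter_pair normalizes_Int)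

lemma residual_subset: "subgroup Q G \<Longrightarrow> residual G T Q \<subseteq> Q"
  using open_normals_self by (auto simp: residual_def)

lemma residual_subgroup:
  assumes "subgroup Q G" shows "subgroup (residual G T Q) G"
  unfolding residual_def
proof (rule subgroups_Inter)
  show "open_normals G T Q \<noteq> {}" using open_normals_self[OF assms] by auto
qed (simp add: open_normals_def)

lemma residual_normal: "normalizes G Q (residual G T Q)"
  by (auto simp: residual_def open_normals_def normalizes_def)

lemma residual_closed:
  assumes "subgroup Q G" "closedin T Q"
  shows "closedin T (residual G T Q)"
  unfolding residual_def
proof (rule closedin_Inter)
  show "open_normals G T Q \<noteq> {}" using open_normals_self[OF assms(1)] by auto
  show "closedin T N" if "N \<in> open_normals G T Q" for N
    using that open_subgroup_closed_ambient[OF assms] by (simp add: open_normals_def)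
qed

end

text \<open>Preimages of open normal subgroups are open and normal.\<close>
lemma residual_hom:
  fixes G (structure)
  assumes G: "top_group G T" and H: "top_group H S"
    and Q: "subgroup Q G" and P: "subgroup P H"
    and f: "f \<in> hom (G\<lparr>carrier := Q\<rparr>) H" "continuous_map (subtopology T Q) S f" "f ` Q \<subseteq> P"
  shows "f ` residual G T Q \<subseteq> residual H S P"
proof -
  interpret G: top_group G T by fact
  interpret H: top_group H S by fact
  have Qc: "Q \<subseteq> carrier G" using Q by (simp add: subgroup.subset)
  interpret f: group_hom "G\<lparr>carrier := Q\<rparr>" H f
    using f(1) Q G.subgroup_imp_group by (simp add: group_hom_def group_hom_axioms_def H.group_axioms)
  have mult: "f (x \<otimes> y) = f x \<otimes>\<^bsub>H\<^esub> f y" if "x \<in> Q" "y \<in> Q" for x y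
    using f.hom_mult that by simp
  have finv: "f (inv x) = inv\<^bsub>H\<^esub> (f x)" if "x \<in> Q" for x
    using f.hom_inv[of x] that Q by simp
  have fone: "f \<one> = \<one>\<^bsub>H\<^esub>" using f.hom_one by simp
  have "f x \<in> N" if x: "x \<in> residual G T Q" and N: "N \<in> open_normals H S P" for x N
  proof -
    have sN: "subgroup N H" "openin (subtopology S P) N" "normalizes H P N"
      using N by (auto simp: open_normals_def)
    let ?M = "{y \<in> Q. f y \<in> N}"
    have "subgroup ?M G"
    proof (rule G.subgroupI)
      have "\<one> \<in> ?M" using fone sN Q by (simp add: subgroup.one_closed)
      then show "?M \<noteq> {}" by blast
    qed (use Q sN Qc in \<open>auto simp: mult finv subgroup.m_closed subgroup.m_inv_closed\<close>)
    moreover have "openin (subtopology T Q) ?M"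
    proof -
      obtain W where W: "openin S W" "N = W \<inter> P" using sN by (auto simp: openin_subtopology)
      have "openin (subtopology T Q) {y \<in> topspace (subtopology T Q). f y \<in> W}"
        using openin_continuous_map_preimage[OF f(2) W(1)] .
      moreover have "{y \<in> topspace (subtopology T Q). f y \<in> W} = ?M"
        using W f(3) Qc by auto
      ultimately show ?thesis by simp
    qed
    moreover have "normalizes G Q ?M"
    proof (rule normalizesI)
      fix g x assume gx: "g \<in> Q" "x \<in> ?M"
      then have "g \<otimes> x \<otimes> inv g \<in> Q"
        using Q by (simp add: subgroup.m_closed subgroup.m_inv_closed)
      moreover have "f (g \<otimes> x \<otimes> inv g) = f g \<otimes>\<^bsub>H\<^esub> f x \<otimes>\<^bsub>H\<^esub> inv\<^bsub>H\<^esub> f g"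
        using gx Q by (simp add: mult finv subgroup.m_closed subgroup.m_inv_closed)
      moreover have "f g \<in> P" using gx f(3) by auto
      ultimately show "g \<otimes> x \<otimes> inv g \<in> ?M"
        using normalizesD[OF sN(3)] gx by simp
    qed
    ultimately have "?M \<in> open_normals G T Q" by (auto simp: open_normals_def)
    then show ?thesis using x by (auto simp: residual_def)
  qed
  then show ?thesis by (auto simp: residual_def)
qed

context top_group begin

lemma residual_mono:
  assumes "subgroup Q G" "subgroup P G" "Q \<subseteq> P"
  shows "residual G T Q \<subseteq> residual G T P"
proof -
  have "(\<lambda>x. x) ` residual G T Q \<subseteq> residual G T P"
  proof (rule residual_hom)
    show "(\<lambda>x. x) \<in> hom (G\<lparr>carrier := Q\<rparr>) G"
      using subgroup.subset[OF assms(1)] by (auto simp: hom_def)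
    show "continuous_map (subtopology T Q) T (\<lambda>x. x)"
      using continuous_map_from_subtopology[OF continuous_id] .
  qed (use assms top_group_axioms in auto)
  then show ?thesis by simp
qed

lemma residual_normalized:
  assumes Q: "subgroup Q G" and V: "V \<subseteq> carrier G" "normalizes G V Q"
  shows "normalizes G V (residual G T Q)"
proof (rule normalizesI)
  fix g x assume g: "g \<in> V" and x: "x \<in> residual G T Q"
  have gc: "g \<in> carrier G" using g V by auto
  have Qc: "Q \<subseteq> carrier G" using Q by (simp add: subgroup.subset)
  have "(\<lambda>x. g \<otimes> x \<otimes> inv g) ` residual G T Q \<subseteq> residual G T Q"
  proof (rule residual_hom)
    show "(\<lambda>x. g \<otimes> x \<otimes> inv g) \<in> hom (G\<lparr>carrier := Q\<rparr>) G"
      using Qc gc by (auto simp: hom_def conj_mult subset_iff)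
    have "continuous_map T T (\<lambda>x. g \<otimes> x \<otimes> inv g)"
      using gc by (intro continuous_intro) auto
    then show "continuous_map (subtopology T Q) T (\<lambda>x. g \<otimes> x \<otimes> inv g)"
      by (rule continuous_map_from_subtopology)
    show "(\<lambda>x. g \<otimes> x \<otimes> inv g) ` Q \<subseteq> Q" using normalizesD[OF V(2) g] by auto
  qed (use Q top_group_axioms in auto)
  then show "g \<otimes> x \<otimes> inv g \<in> residual G T Q" using x by auto
qed

text \<open>Intersecting the conjugates of an open subgroup under a compact group keeps it open, because
conjugation by a compact set is uniformly continuous at the identity.\<close>
lemma invariant_core:
  assumes Q: "subgroup Q G" and W: "subgroup W G" "W \<subseteq> Q" "openin (subtopology T Q) W"
    and V: "subgroup V G" "compactin T V" "normalizes G V Q"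
  defines "C \<equiv> {x \<in> Q. \<forall>v\<in>V. v \<otimes> x \<otimes> inv v \<in> W}"
  shows "subgroup C G" "openin (subtopology T Q) C" "C \<subseteq> W" "normalizes G V C"
    "normalizes G Q W \<Longrightarrow> normalizes G Q C"
proof -
  have Qc: "Q \<subseteq> carrier G" and Wc: "W \<subseteq> carrier G" and Vc: "V \<subseteq> carrier G"
    using Q W V by (auto simp: subgroup.subset)
  show C: "subgroup C G"
  proof (rule subgroupI)
    show "C \<noteq> {}" using Q W V Vc by (auto simp: C_def subgroup.one_closed intro!: exI[of _ "\<one>"])
  next
    fix a assume a: "a \<in> C"
    have "v \<otimes> inv a \<otimes> inv v \<in> W" if "v \<in> V" for v
    proof -
      have "v \<otimes> inv a \<otimes> inv v = inv (v \<otimes> a \<otimes> inv v)"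
        using a that Qc Vc by (intro conj_inv) (auto simp: C_def)
      then show ?thesis using a that W(1) by (simp add: C_def subgroup.m_inv_closed)
    qed
    then show "inv a \<in> C" using a Q by (simp add: C_def subgroup.m_inv_closed)
  next
    fix a b assume ab: "a \<in> C" "b \<in> C"
    have "v \<otimes> (a \<otimes> b) \<otimes> inv v \<in> W" if "v \<in> V" for v
    proof -
      have "v \<otimes> (a \<otimes> b) \<otimes> inv v = (v \<otimes> a \<otimes> inv v) \<otimes> (v \<otimes> b \<otimes> inv v)"
        using ab that Qc Vc by (intro conj_mult) (auto simp: C_def)
      then show ?thesis using ab that W(1) by (simp add: C_def subgroup.m_closed)
    qed
    then show "a \<otimes> b \<in> C" using ab Q by (simp add: C_def subgroup.m_closed)
  qed (use Qc in \<open>auto simp: C_def\<close>)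
  show "openin (subtopology T Q) C"
  proof -
    obtain W' where W': "openin T W'" "\<one> \<in> W'" "W' \<inter> Q \<subseteq> W"
      using open_nbhd[OF W(3)] W(1) subgroup.one_closed by blast
    obtain O' where O': "openin T O'" "\<one> \<in> O'"
      "\<And>x k. x \<in> O' \<Longrightarrow> k \<in> V \<Longrightarrow> k \<otimes> x \<otimes> inv k \<in> W'"
      using conj_tube[OF V(2) W'(1,2)] by blast
    have "O' \<inter> Q \<subseteq> C"
      using O' W' normalizesD[OF V(3)] by (auto simp: C_def)
    then show ?thesis using open_subgroup[OF Q C _ O'(1,2)] by (auto simp: C_def)
  qed
  show "C \<subseteq> W"
  proof
    fix x assume x: "x \<in> C"
    have "\<one> \<in> V" using V(1) by (rule subgroup.one_closed)
    then have "\<one> \<otimes> x \<otimes> inv \<one> \<in> W" using x unfolding C_def by blast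
    then show "x \<in> W" using x Qc by (auto simp: C_def)
  qed
  show "normalizes G V C"
  proof (rule normalizesI)
    fix g x assume gx: "g \<in> V" "x \<in> C"
    have "v \<otimes> (g \<otimes> x \<otimes> inv g) \<otimes> inv v \<in> W" if "v \<in> V" for v
    proof -
      have "v \<otimes> (g \<otimes> x \<otimes> inv g) \<otimes> inv v = (v \<otimes> g) \<otimes> x \<otimes> inv (v \<otimes> g)"
        using gx that Qc Vc by (intro conj_conj) (auto simp: C_def)
      then show ?thesis using gx that V(1) by (simp add: C_def subgroup.m_closed)
    qed
    then show "g \<otimes> x \<otimes> inv g \<in> C" using gx normalizesD[OF V(3)] by (simp add: C_def)
  qed
  show "normalizes G Q C" if n: "normalizes G Q W"
  proof (rule normalizesI)
    fix g x assume gx: "g \<in> Q" "x \<in> C"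
    have "v \<otimes> (g \<otimes> x \<otimes> inv g) \<otimes> inv v \<in> W" if "v \<in> V" for v
    proof -
      have "v \<otimes> (g \<otimes> x \<otimes> inv g) \<otimes> inv v =
        (v \<otimes> g \<otimes> inv v) \<otimes> (v \<otimes> x \<otimes> inv v) \<otimes> inv (v \<otimes> g \<otimes> inv v)"
        using gx that Qc Vc by (intro conj_of_conj) (auto simp: C_def)
      moreover have "v \<otimes> g \<otimes> inv v \<in> Q" using normalizesD[OF V(3)] that gx by simp
      moreover have "v \<otimes> x \<otimes> inv v \<in> W" using gx that by (simp add: C_def)
      ultimately show ?thesis using normalizesD[OF n] by simp
    qed
    then show "g \<otimes> x \<otimes> inv g \<in> C" using gx Q by (simp add: C_def subgroup.m_closed subgroup.m_inv_closed)
  qed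
qed

text \<open>The open normal subgroups are closed and directed downwards, so compactness lets one of them
already avoid a compact set that misses their intersection.\<close>
lemma compact_disjoint_residual:
  assumes Q: "subgroup Q G" and X: "compactin T X" "X \<subseteq> Q" "X \<inter> residual G T Q = {}"
  obtains N where "N \<in> open_normals G T Q" "N \<inter> X = {}"
proof -
  have "\<exists>U. openin T U \<and> x \<in> U \<and> (\<exists>N\<in>open_normals G T Q. N \<inter> U = {})" if "x \<in> X" for x
  proof -
    have "x \<notin> residual G T Q" "x \<in> Q" using that X by auto
    then obtain N where N: "N \<in> open_normals G T Q" "x \<notin> N" by (auto simp: residual_def)
    then have "closedin (subtopology T Q) N"
      using open_subgroup_closed[OF Q] by (simp add: open_normals_def)
    then obtain D where D: "closedin T D" "N = D \<inter> Q" by (auto simp: closedin_subtopology)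
    have "openin T (topspace T - D)" using D by blast
    moreover have "x \<in> topspace T - D" using N D \<open>x \<in> Q\<close> subgroup.subset[OF Q] by auto
    moreover have "N \<inter> (topspace T - D) = {}" using D by auto
    ultimately show ?thesis using N by blast
  qed
  then obtain U where U: "\<And>x. x \<in> X \<Longrightarrow> openin T (U x)" "\<And>x. x \<in> X \<Longrightarrow> x \<in> U x"
    "\<And>x. x \<in> X \<Longrightarrow> \<exists>N\<in>open_normals G T Q. N \<inter> U x = {}" by metis
  have "\<forall>B\<in>U ` X. openin T B" "X \<subseteq> \<Union>(U ` X)" using U by auto
  then obtain \<F> where \<F>: "finite \<F>" "\<F> \<subseteq> U ` X" "X \<subseteq> \<Union>\<F>"
    using X(1) unfolding compactin_def by meson
  have "\<exists>N\<in>open_normals G T Q. N \<inter> \<Union>\<F> = {}"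
    using \<F>(1,2)
  proof (induction rule: finite_induct)
    case empty then show ?case using open_normals_self[OF Q] by auto
  next
    case (insert B \<F>)
    then obtain N where N: "N \<in> open_normals G T Q" "N \<inter> \<Union>\<F> = {}" by auto
    obtain x where x: "x \<in> X" "B = U x" using insert.prems by auto
    then obtain M where M: "M \<in> open_normals G T Q" "M \<inter> B = {}" using U(3)[OF x(1)] by auto
    have "(N \<inter> M) \<inter> \<Union>(insert B \<F>) = {}" using N M by auto
    then show ?case using open_normals_Int[OF N(1) M(1)] by blast
  qed
  then show ?thesis using that \<F>(3) by blast
qed

text \<open>Choose an open normal subgroup \<open>N\<close> that avoids the elements of the conjugates
of \<open>L\<close> under the generators that lie outside \<open>R L\<close>, a compact set disjoint from the residual \<open>R\<close>. Then
each generator maps \<open>N \<inter> R L\<close> into itself, so this intersection is normal. Thus, modulo its residual,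
a compactly generated group has arbitrarily small open normal subgroups.\<close>
lemma open_normal_near_residual:
  assumes Q: "subgroup Q G" "cpt_generated G T Q"
    and L: "subgroup L G" "compactin T L" "L \<subseteq> Q" "openin (subtopology T Q) L"
  obtains W where "W \<in> open_normals G T Q" "residual G T Q \<subseteq> W" "W \<subseteq> residual G T Q <#> L"
proof -
  define R where "R = residual G T Q"
  obtain K where K: "compactin T K" "generate G K = Q" using Q(2) by (auto simp: cpt_generated_def)
  have Qc: "Q \<subseteq> carrier G" and Lc: "L \<subseteq> carrier G" using Q L by (auto simp: subgroup.subset)
  have Kc: "K \<subseteq> carrier G" using K compact_carrier by auto
  have KQ: "K \<subseteq> Q" using K(2) subset_generate[of K G] by simp
  have R: "subgroup R G" "R \<subseteq> Q" "normalizes G Q R"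
    using residual_subgroup residual_subset residual_normal Q by (auto simp: R_def)
  define K' where "K' = K \<union> (\<lambda>k. inv k) ` K"
  have K': "compactin T K'" "K' \<subseteq> Q"
  proof -
    have "compactin T ((\<lambda>k. inv k) ` K)"
      by (rule image_compactin[OF K(1)]) (intro continuous_intro)
    then show "compactin T K'" using K(1) by (simp add: K'_def compactin_Un)
    show "K' \<subseteq> Q" using KQ Q(1) by (auto simp: K'_def subgroup.m_inv_closed)
  qed
  have RL: "subgroup (R <#> L) G"
    by (rule product_subgroup[OF R(1) L(1)]) (use R(3) L(3) normalizes_mono in blast)
  have RLQ: "R <#> L \<subseteq> Q" using R L Q by (auto simp: set_mult_iff subgroup.m_closed subset_iff)
  have LRL: "L \<subseteq> R <#> L"
  proof
    fix l assume "l \<in> L"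
    then have "l = \<one> \<otimes> l" using Lc by auto
    then show "l \<in> R <#> L" using \<open>l \<in> L\<close> R(1) subgroup.one_closed unfolding set_mult_iff by blast
  qed
  have RRL: "R \<subseteq> R <#> L"
  proof
    fix l assume "l \<in> R"
    then have "l = l \<otimes> \<one>" using R Qc by auto
    then show "l \<in> R <#> L" using \<open>l \<in> R\<close> L(1) subgroup.one_closed unfolding set_mult_iff by blast
  qed
  have oRL: "openin (subtopology T Q) (R <#> L)"
  proof -
    obtain V where V: "openin T V" "\<one> \<in> V" "V \<inter> Q \<subseteq> L"
      using open_nbhd[OF L(4)] L(1) subgroup.one_closed by blast
    show ?thesis by (rule open_subgroup[OF Q(1) RL RLQ V(1,2)]) (use V LRL in auto)
  qed
  then obtain O' where O': "openin T O'" "R <#> L = O' \<inter> Q" by (auto simp: openin_subtopology)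
  define C where "C = {k \<otimes> l \<otimes> inv k |k l. k \<in> K' \<and> l \<in> L}"
  have C: "compactin T C" unfolding C_def by (rule compact_conj[OF K'(1) L(2)])
  have CQ: "C \<subseteq> Q" using K' L Q by (auto simp: C_def subset_iff subgroup.m_closed subgroup.m_inv_closed)
  have "closedin T (C - O')" using C compact_closed O' by (simp add: closedin_diff)
  then have X: "compactin T (C - O')" using closed_compactin[OF C] by auto
  have "(C - O') \<inter> residual G T Q = {}" using O' RRL R(2) CQ by (auto simp: R_def)
  then obtain N where N: "N \<in> open_normals G T Q" "N \<inter> (C - O') = {}"
    using compact_disjoint_residual[OF Q(1) X] CQ by blast
  have sN: "subgroup N G" "openin (subtopology T Q) N" "normalizes G Q N" "N \<subseteq> Q"
    using N by (auto simp: open_normals_def)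
  have RN: "R \<subseteq> N" using N by (auto simp: R_def residual_def)
  \<comment> \<open>Modulo \<open>R\<close> the conjugate of \<open>w\<close> is \<open>k \<otimes> l \<otimes> inv k\<close>, which lies in \<open>C\<close> and in \<open>N\<close>, so not outside \<open>R L\<close>.\<close>
  have key: "k \<otimes> w \<otimes> inv k \<in> N \<inter> (R <#> L)" if k: "k \<in> K'" and w: "w \<in> N \<inter> (R <#> L)" for k w
  proof -
    obtain r l where rl: "r \<in> R" "l \<in> L" "w = r \<otimes> l" using w by (auto simp: set_mult_iff)
    have kQ: "k \<in> Q" using k K' by auto
    have c: "k \<in> carrier G" "r \<in> carrier G" "l \<in> carrier G" using kQ rl R Qc Lc by auto
    have n: "k \<otimes> w \<otimes> inv k \<in> N" using normalizesD[OF sN(3) kQ] w by auto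
    have kr: "k \<otimes> r \<otimes> inv k \<in> R" using normalizesD[OF R(3) kQ] rl by auto
    have eq: "k \<otimes> w \<otimes> inv k = (k \<otimes> r \<otimes> inv k) \<otimes> (k \<otimes> l \<otimes> inv k)"
      using rl c by (simp add: conj_mult)
    have "k \<otimes> l \<otimes> inv k = inv (k \<otimes> r \<otimes> inv k) \<otimes> (k \<otimes> w \<otimes> inv k)"
      unfolding eq using c by simp
    also have "\<dots> \<in> N" using n kr RN sN(1) by (auto simp: subgroup.m_closed subgroup.m_inv_closed)
    finally have "k \<otimes> l \<otimes> inv k \<in> N" .
    moreover have "k \<otimes> l \<otimes> inv k \<in> C" using k rl by (auto simp: C_def)
    ultimately have "k \<otimes> l \<otimes> inv k \<in> R <#> L" using N O' CQ by auto
    then have "k \<otimes> w \<otimes> inv k \<in> R <#> L" unfolding eq using kr RRL RL by (auto simp: subgroup.m_closed)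
    then show ?thesis using n by simp
  qed
  have "N \<inter> (R <#> L) \<in> open_normals G T Q"
  proof -
    have "normalizes G (generate G K) (N \<inter> (R <#> L))"
    proof (rule normalizes_generate)
      show "inv k \<otimes> x \<otimes> k \<in> N \<inter> (R <#> L)" if "k \<in> K" "x \<in> N \<inter> (R <#> L)" for k x
        using key[of "inv k" x] that Kc by (auto simp: K'_def)
      show "N \<inter> (R <#> L) \<subseteq> carrier G" using sN Qc by auto
    qed (use key Kc in \<open>auto simp: K'_def\<close>)
    then show ?thesis
      using K sN RL oRL by (auto simp: open_normals_def subgroups_Inter_pair)
  qed
  then show ?thesis using that RN RRL by (auto simp: R_def)
qed

end

context van_dantzig_group begin

lemma residual_compact:
  assumes Q: "subgroup Q G" "compactin T Q"
  shows "residual G T Q = {\<one>}"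
proof -
  have "x = \<one>" if x: "x \<in> residual G T Q" for x
  proof (rule ccontr)
    assume "x \<noteq> \<one>"
    have xc: "x \<in> carrier G" using x residual_subset[OF Q(1)] subgroup.subset[OF Q(1)] by auto
    have "closedin T {x}" using xc Hausdorff by (simp add: closedin_Hausdorff_singleton)
    then have "openin T (topspace T - {x})" by blast
    then obtain V where V: "subgroup V G" "openin T V" "V \<subseteq> topspace T - {x}"
      using small_subgroup[of "topspace T - {x}"] \<open>x \<noteq> \<one>\<close> by auto
    have VQ: "subgroup (V \<inter> Q) G" "openin (subtopology T Q) (V \<inter> Q)"
      using V Q by (auto simp: subgroups_Inter_pair openin_subtopology)
    let ?C = "{x \<in> Q. \<forall>v\<in>Q. v \<otimes> x \<otimes> inv v \<in> V \<inter> Q}"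
    note C = invariant_core[OF Q(1) VQ(1) _ VQ(2) Q normalizes_self[OF Q(1)]]
    have "?C \<in> open_normals G T Q" using C by (auto simp: open_normals_def)
    moreover have "x \<notin> ?C" using C(3) V(3) by auto
    ultimately show False using x by (auto simp: residual_def)
  qed
  moreover have "\<one> \<in> residual G T Q" using subgroup.one_closed[OF residual_subgroup[OF Q(1)]] .
  ultimately show ?thesis by blast
qed

text \<open>Adding a compact open subgroup to a compact generating set makes the generated subgroup open.
This is how compactly generated subgroups are compared along homomorphisms.\<close>
lemma envelope:
  assumes A: "subgroup A G" "closedin T A" and C: "compactin T C" "C \<subseteq> A"
  obtains Q where "subgroup Q G" "Q \<subseteq> A" "openin (subtopology T A) Q" "cpt_generated G T Q" "C \<subseteq> Q"
proof -
  obtain V where V: "subgroup V G" "compactin T V" "openin T V"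
    using small_subgroup[OF openin_topspace] by auto
  have VA: "compactin T (V \<inter> A)" using V A by (simp add: compact_Int_closedin)
  let ?K = "C \<union> (V \<inter> A)"
  have K: "compactin T ?K" using C VA by (simp add: compactin_Un)
  have Kc: "?K \<subseteq> carrier G" using K compact_carrier by blast
  have KA: "?K \<subseteq> A" using C by auto
  have Q: "subgroup (generate G ?K) G" "generate G ?K \<subseteq> A"
    using generate_is_subgroup[OF Kc] generate_subgroup_incl[OF KA A(1)] by auto
  have "openin (subtopology T A) (generate G ?K)"
    by (rule open_subgroup[OF A(1) Q V(3)]) (use V subset_generate[of ?K G] in \<open>auto simp: subgroup.one_closed\<close>)
  then show ?thesis
    using that[OF Q] K subset_generate[of ?K G] unfolding cpt_generated_def by blast
qed

end

section \<open>Residually founded subgroups\<close>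

text \<open>The trivial subgroup has to be a separate base case: it is its own residual, so the second rule
alone would generate nothing.\<close>
inductive residually_founded :: "('a, 'm) monoid_scheme \<Rightarrow> 'a topology \<Rightarrow> 'a set \<Rightarrow> bool"
  for G T where
  trivial: "residually_founded G T {\<one>\<^bsub>G\<^esub>}"
| step: "subgroup A G \<Longrightarrow> closedin T A \<Longrightarrow>
    (\<And>Q. subgroup Q G \<Longrightarrow> Q \<subseteq> A \<Longrightarrow> openin (subtopology T A) Q \<Longrightarrow> cpt_generated G T Q \<Longrightarrow>
       residually_founded G T (residual G T Q)) \<Longrightarrow>
    residually_founded G T A"

context van_dantzig_group begin

lemma residually_founded_subgroup:
  assumes "residually_founded G T A" "subgroup B G" "closedin T B" "B \<subseteq> A"
  shows "residually_founded G T B"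
  using assms
proof (induction arbitrary: B rule: residually_founded.induct)
  case trivial
  then have "B = {\<one>}" using subgroup.one_closed by blast
  then show ?case by (simp add: residually_founded.trivial)
next
  case (step A)
  show ?case
  proof (rule residually_founded.step[OF step.prems(1,2)])
    fix Q assume Q: "subgroup Q G" "Q \<subseteq> B" "openin (subtopology T B) Q" "cpt_generated G T Q"
    obtain K where K: "compactin T K" "generate G K = Q" using Q by (auto simp: cpt_generated_def)
    have "K \<subseteq> A" using K(2) Q(2) step.prems(3) subset_generate[of K G] by blast
    then obtain P where P: "subgroup P G" "P \<subseteq> A" "openin (subtopology T A) P" "cpt_generated G T P" "K \<subseteq> P"
      using envelope[OF step.hyps(1,2) K(1)] by blast
    have QP: "Q \<subseteq> P" using generate_subgroup_incl[OF P(5,1)] K by simp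
    have "closedin T Q" using open_subgroup_closed_ambient[OF step.prems(1,2) Q(1,3)] .
    then show "residually_founded G T (residual G T Q)"
      using step.IH[OF P(1-4)] residual_subgroup[OF Q(1)] residual_closed[OF Q(1)] 
        residual_mono[OF Q(1) P(1) QP] by blast
  qed
qed

end

text \<open>The image of a compactly generated open subgroup \<open>Q\<close> of \<open>B\<close> lies in a compactly generated open
subgroup of \<open>A\<close>, and the residual of \<open>Q\<close> is mapped to the residual of the latter. At the end of the
induction the image is trivial and what is left lies in \<open>K\<close>. Only residuals are
compared, never images, because in an extension the image of a closed subgroup in the quotient can
fail to be closed.\<close>
lemma residually_founded_hom:
  fixes G (structure)
  assumes A: "residually_founded H S A" and G: "van_dantzig_group G T" and H: "van_dantzig_group H S"
    and K: "residually_founded G T K"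
    and B: "subgroup B G" "closedin T B"
    and f: "f \<in> hom (G\<lparr>carrier := B\<rparr>) H" "continuous_map (subtopology T B) S f" "f ` B \<subseteq> A"
    and ker: "\<And>x. x \<in> B \<Longrightarrow> f x = \<one>\<^bsub>H\<^esub> \<Longrightarrow> x \<in> K"
  shows "residually_founded G T B"
proof -
  interpret G: van_dantzig_group G T by fact
  interpret H: van_dantzig_group H S by fact
  show ?thesis using A B f ker
  proof (induction arbitrary: B rule: residually_founded.induct)
    case trivial
    then have "B \<subseteq> K" by auto
    then show ?case using G.residually_founded_subgroup[OF K] trivial by blast
  next
    case (step A)
    show ?case
    proof (rule residually_founded.step[OF step.prems(1,2)])
      fix Q assume Q: "subgroup Q G" "Q \<subseteq> B" "openin (subtopology T B) Q" "cpt_generated G T Q"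
      obtain C where C: "compactin T C" "generate G C = Q" using Q by (auto simp: cpt_generated_def)
      have CQ: "C \<subseteq> Q" using C(2) subset_generate[of C G] by simp
      have sub: "f \<in> hom (G\<lparr>carrier := Q'\<rparr>) H \<and> continuous_map (subtopology T Q') S f" if "Q' \<subseteq> B" for Q'
      proof
        show "f \<in> hom (G\<lparr>carrier := Q'\<rparr>) H" using step.prems(3) that by (auto simp: hom_def Pi_iff)
        show "continuous_map (subtopology T Q') S f"
          using continuous_map_from_subtopology_mono[OF step.prems(4) that] .
      qed
      have fC: "compactin S (f ` C)"
        by (rule image_compactin[OF _ conjunct2[OF sub[OF Q(2)]]]) (use C CQ in \<open>simp add: compactin_subtopology\<close>)
      have "f ` C \<subseteq> A" using step.prems(5) CQ Q by auto
      then obtain P where P: "subgroup P H" "P \<subseteq> A" "openin (subtopology S A) P" "cpt_generated H S P" "f ` C \<subseteq> P"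
        using H.envelope[OF step.hyps(1,2) fC] by blast
      have fQP: "f ` Q \<subseteq> P"
      proof -
        interpret f: group_hom "G\<lparr>carrier := B\<rparr>" H f
          using step.prems(1,3) G.subgroup_imp_group 
          by (simp add: group_hom_def group_hom_axioms_def H.group_axioms)
        have "generate H (f ` C) = f ` generate (G\<lparr>carrier := B\<rparr>) C"
          by (rule f.generate_img) (use CQ Q in auto)
        moreover have "generate (G\<lparr>carrier := B\<rparr>) C = Q"
          using G.generate_consistent[OF _ step.prems(1)] CQ Q C by auto
        ultimately show ?thesis using H.generate_subgroup_incl[OF P(5,1)] by simp
      qed
      have rQ: "residual G T Q \<subseteq> Q" using G.residual_subset[OF Q(1)] .
      show "residually_founded G T (residual G T Q)"
      proof (rule step.IH[OF P(1-4)])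
        show "subgroup (residual G T Q) G" using G.residual_subgroup[OF Q(1)] .
        show "closedin T (residual G T Q)" 
          using G.residual_closed[OF Q(1)] G.open_subgroup_closed_ambient[OF step.prems(1,2) Q(1,3)] by blast
        show "f \<in> hom (G\<lparr>carrier := residual G T Q\<rparr>) H" 
          "continuous_map (subtopology T (residual G T Q)) S f"
          using sub[of "residual G T Q"] rQ Q by auto
        show "f ` residual G T Q \<subseteq> residual H S P"
          by (rule residual_hom[OF G.top_group_axioms H.top_group_axioms Q(1) P(1) _ _ fQP])
            (use sub[OF Q(2)] in auto)
        show "x \<in> K" if "x \<in> residual G T Q" "f x = \<one>\<^bsub>H\<^esub>" for x
          using that step.prems(6) rQ Q by blast
      qed
    qed
  qed
qed

section \<open>Images of residually founded subgroups\<close>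

context van_dantzig_group begin

lemma residually_founded_compact:
  assumes A: "subgroup A G" "compactin T A"
  shows "residually_founded G T A"
proof (rule residually_founded.step[OF A(1) compact_closed[OF A(2)]])
  fix Q assume Q: "subgroup Q G" "Q \<subseteq> A" "openin (subtopology T A) Q"
  have "closedin T Q" using open_subgroup_closed_ambient[OF A(1) compact_closed[OF A(2)] Q(1,3)] .
  then have "compactin T Q" using closed_compactin[OF A(2) Q(2)] by blast
  then have "residual G T Q = {\<one>}" using residual_compact Q(1) by blast
  then show "residually_founded G T (residual G T Q)" by (simp add: residually_founded.trivial)
qed

text \<open>The group \<open>V\<close> acts by conjugation on the discrete group \<open>K / W\<close>. Since \<open>K\<close> is compactly generated, an
open subgroup \<open>V0\<close> of \<open>V\<close> acts trivially: it has to fix only the images of a compact generating set. Therefore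
\<open>W V0\<close> is normalized by \<open>K\<close>, and unlike \<open>W\<close> it is open in the whole group.\<close>
lemma open_normal_extension:
  assumes V: "subgroup V G" "compactin T V" "openin T V"
    and K: "subgroup K G" "cpt_generated G T K" "normalizes G V K"
    and W: "subgroup W G" "openin (subtopology T K) W" "W \<subseteq> K" "normalizes G V W" "normalizes G K W"
  obtains V0 where "subgroup V0 G" "V0 \<subseteq> V" "openin T (W <#> V0)" "subgroup (W <#> V0) G"
    "normalizes G V (W <#> V0)" "normalizes G K (W <#> V0)"
proof -
  define c where "c v k = v \<otimes> k \<otimes> inv v \<otimes> inv k" for v k
  define V0 where "V0 = {v \<in> V. \<forall>k\<in>K. c v k \<in> W}"
  have Vc: "V \<subseteq> carrier G" and Kc: "K \<subseteq> carrier G" and Wc: "W \<subseteq> carrier G"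
    using V K W by (auto simp: subgroup.subset)
  have V0: "subgroup V0 G"
  proof (rule subgroupI)
    show "V0 \<subseteq> carrier G" using Vc by (auto simp: V0_def)
    have "\<one> \<in> V0" using V(1) W(1) Kc by (auto simp: V0_def c_def subgroup.one_closed subset_iff)
    then show "V0 \<noteq> {}" by blast
  next
    fix v assume v: "v \<in> V0"
    have "c (inv v) k \<in> W" if k: "k \<in> K" for k
    proof -
      have cc: "v \<in> carrier G" "k \<in> carrier G" using v k Vc Kc by (auto simp: V0_def)
      have "inv v \<otimes> inv (c v k) \<otimes> inv (inv v) \<in> W"
        using v k V(1) W(1) normalizesD[OF W(4)] by (simp add: V0_def subgroup.m_inv_closed)
      moreover have "inv v \<otimes> inv (c v k) \<otimes> inv (inv v) = c (inv v) k"
        using cc by (simp add: c_def m_assoc inv_mult_group)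
      ultimately show ?thesis by simp
    qed
    then show "inv v \<in> V0" using v V(1) by (simp add: V0_def subgroup.m_inv_closed)
  next
    fix v w assume v: "v \<in> V0" and w: "w \<in> V0"
    have "c (v \<otimes> w) k \<in> W" if k: "k \<in> K" for k
    proof -
      have cc: "v \<in> carrier G" "w \<in> carrier G" "k \<in> carrier G" using v w k Vc Kc by (auto simp: V0_def)
      have "(v \<otimes> c w k \<otimes> inv v) \<otimes> c v k \<in> W"
        using v w k W(1) normalizesD[OF W(4)] by (simp add: V0_def subgroup.m_closed)
      moreover have "(v \<otimes> c w k \<otimes> inv v) \<otimes> c v k = c (v \<otimes> w) k"
        using cc by (simp add: c_def m_assoc inv_mult_group)
      ultimately show ?thesis by simp
    qed
    then show "v \<otimes> w \<in> V0" using v w V(1) by (simp add: V0_def subgroup.m_closed)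
  qed
  have V0V: "V0 \<subseteq> V" by (auto simp: V0_def)
  have nVV0: "normalizes G V V0"
  proof (rule normalizesI)
    fix v w assume v: "v \<in> V" and w: "w \<in> V0"
    have "c (v \<otimes> w \<otimes> inv v) k \<in> W" if k: "k \<in> K" for k
    proof -
      have cc: "v \<in> carrier G" "w \<in> carrier G" "k \<in> carrier G" using v w k Vc Kc by (auto simp: V0_def)
      have "inv v \<otimes> k \<otimes> inv (inv v) \<in> K"
        using normalizesD[OF K(3) _ k] v V(1) by (simp add: subgroup.m_inv_closed)
      then have "v \<otimes> c w (inv v \<otimes> k \<otimes> inv (inv v)) \<otimes> inv v \<in> W"
        using w v normalizesD[OF W(4)] by (simp add: V0_def)
      moreover have "v \<otimes> c w (inv v \<otimes> k \<otimes> inv (inv v)) \<otimes> inv v = c (v \<otimes> w \<otimes> inv v) k"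
        using cc by (simp add: c_def m_assoc inv_mult_group)
      ultimately show ?thesis by simp
    qed
    then show "v \<otimes> w \<otimes> inv v \<in> V0" 
      using v w V(1) by (simp add: V0_def subgroup.m_closed subgroup.m_inv_closed)
  qed
  obtain D where D: "compactin T D" "generate G D = K" using K(2) by (auto simp: cpt_generated_def)
  have DK: "D \<subseteq> K" using subset_generate[of D G] D by simp
  obtain W' where W': "openin T W'" "\<one> \<in> W'" "W' \<inter> K \<subseteq> W"
    using open_nbhd[OF W(2) subgroup.one_closed[OF W(1)]] by blast
  have cont: "continuous_map (prod_topology T T) T (\<lambda>p. c (fst p) (snd p))"
    unfolding c_def by (intro continuous_intro)
  have "c \<one> k \<in> W'" if "k \<in> D" for k using that DK Kc W'(2) by (auto simp: c_def subset_iff)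
  then obtain V' where V': "openin T V'" "\<one> \<in> V'" "\<And>v k. v \<in> V' \<Longrightarrow> k \<in> D \<Longrightarrow> c v k \<in> W'"
    using tube[OF cont D(1) W'(1) one_closed] by blast
  have "V' \<inter> V \<subseteq> V0"
  proof
    fix v assume v: "v \<in> V' \<inter> V"
    have vc: "v \<in> carrier G" using v Vc by auto
    have "c v k \<in> W" if "k \<in> K" for k
      using that unfolding D(2)[symmetric]
    proof (induction rule: generate.induct)
      case one then show ?case using vc W(1) by (simp add: c_def subgroup.one_closed)
    next
      have d: "c v d \<in> W" if "d \<in> D" for d
      proof -
        have "d \<in> K" using that DK by auto
        then have "c v d \<in> K" unfolding c_def
          using normalizesD[OF K(3)] v K(1) by (simp add: subgroup.m_closed subgroup.m_inv_closed)
        then show ?thesis using V'(3)[OF _ that] v W'(3) by auto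
      qed
      case (incl d) then show ?case using d by simp
      case (inv d)
      have dK: "d \<in> K" using inv DK by auto
      then have dc: "d \<in> carrier G" using Kc by auto
      have "inv d \<otimes> inv (c v d) \<otimes> inv (inv d) \<in> W"
        using d[OF inv] dK K(1) W(1) normalizesD[OF W(5)] by (simp add: subgroup.m_inv_closed)
      moreover have "inv d \<otimes> inv (c v d) \<otimes> inv (inv d) = c v (inv d)"
        using vc dc by (simp add: c_def m_assoc inv_mult_group)
      ultimately show ?case by simp
    next
      case (eng h1 h2)
      have h: "h1 \<in> K" "h2 \<in> K" using eng D by auto
      then have hc: "h1 \<in> carrier G" "h2 \<in> carrier G" using Kc by auto
      have "c v h1 \<otimes> (h1 \<otimes> c v h2 \<otimes> inv h1) \<in> W"
        using eng h W(1) normalizesD[OF W(5)] by (simp add: subgroup.m_closed)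
      moreover have "c v h1 \<otimes> (h1 \<otimes> c v h2 \<otimes> inv h1) = c v (h1 \<otimes> h2)"
        using vc hc by (simp add: c_def m_assoc inv_mult_group)
      ultimately show ?case by simp
    qed
    then show "v \<in> V0" using v by (simp add: V0_def)
  qed
  moreover have "V0 \<subseteq> W <#> V0"
  proof
    fix v assume v: "v \<in> V0"
    then have "v = \<one> \<otimes> v" using V0V Vc by auto
    then show "v \<in> W <#> V0" using v subgroup.one_closed[OF W(1)] unfolding set_mult_iff by blast
  qed
  ultimately have nb: "V' \<inter> V \<subseteq> W <#> V0" by blast
  have P: "subgroup (W <#> V0) G"
    by (rule product_subgroup[OF W(1) V0 normalizes_mono[OF W(4) V0V]])
  show ?thesis
  proof (rule that[OF V0 V0V _ P])
    have "openin T (V' \<inter> V)" using V' V(3) by blast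
    then show "openin T (W <#> V0)"
      using open_subgroup_of_nbhd(1)[OF P _ _ nb] V'(2) subgroup.one_closed[OF V(1)] by blast
    show "normalizes G V (W <#> V0)"
    proof (rule normalizesI)
      fix v x assume v: "v \<in> V" and "x \<in> W <#> V0"
      then obtain w u where wu: "w \<in> W" "u \<in> V0" "x = w \<otimes> u" by (auto simp: set_mult_iff)
      have "v \<otimes> x \<otimes> inv v = (v \<otimes> w \<otimes> inv v) \<otimes> (v \<otimes> u \<otimes> inv v)"
        unfolding wu(3) using v wu Vc Wc V0V by (intro conj_mult) auto
      then show "v \<otimes> x \<otimes> inv v \<in> W <#> V0"
        using normalizesD[OF W(4) v wu(1)] normalizesD[OF nVV0 v wu(2)] unfolding set_mult_iff by blast
    qed
    show "normalizes G K (W <#> V0)"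
    proof (rule normalizesI)
      fix k x assume k: "k \<in> K" and "x \<in> W <#> V0"
      then obtain w u where wu: "w \<in> W" "u \<in> V0" "x = w \<otimes> u" by (auto simp: set_mult_iff)
      have cc: "k \<in> carrier G" "w \<in> carrier G" "u \<in> carrier G" using k wu Kc Wc V0V Vc by auto
      have "c u k \<in> W" using wu k by (simp add: V0_def)
      then have "(k \<otimes> w \<otimes> inv k) \<otimes> inv (c u k) \<in> W"
        using normalizesD[OF W(5) k wu(1)] W(1) by (simp add: subgroup.m_closed subgroup.m_inv_closed)
      moreover have "k \<otimes> x \<otimes> inv k = ((k \<otimes> w \<otimes> inv k) \<otimes> inv (c u k)) \<otimes> u"
        unfolding wu(3) using cc by (simp add: c_def m_assoc inv_mult_group)
      ultimately show "k \<otimes> x \<otimes> inv k \<in> W <#> V0" using wu(2) unfolding set_mult_iff by blast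
    qed
  qed
qed

end

text \<open>With \<open>V\<close> included, every image that occurs in the induction is open, so the failure of residuals to
have closed image does no harm. In the induction step a compactly generated open subgroup of the
image lies in the image of \<open>K1 V\<close> for a compactly generated, \<open>V\<close>-invariant, relatively open subgroup
\<open>K1\<close> of \<open>K\<close>. With \<open>R\<close> the residual of \<open>K1\<close>, there is an open normal subgroup of \<open>K1 V\<close> inside \<open>R V\<close>, so
the residual of the image of \<open>K1 V\<close> lies in the image of \<open>R V\<close>, to which the induction hypothesis
applies.\<close>
lemma residually_founded_quotient:
  fixes G (structure)
  assumes K: "residually_founded G T K" and G: "van_dantzig_group G T" and H: "van_dantzig_group H S"
    and V: "subgroup V G" "compactin T V" "openin T V" "normalizes G V K"
    and f: "f \<in> hom G H" "continuous_map T S f" "open_map T S f"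
  shows "residually_founded H S (f ` (K <#> V))"
proof -
  interpret G: van_dantzig_group G T by fact
  interpret H: van_dantzig_group H S by fact
  interpret f: group_hom G H f
    using f(1) by (simp add: group_hom_def group_hom_axioms_def G.group_axioms H.group_axioms)
  have Vc: "V \<subseteq> carrier G" using V by (simp add: subgroup.subset)
  have fV: "subgroup (f ` V) H" "compactin S (f ` V)" "openin S (f ` V)"
    using f.subgroup_img_is_subgroup[OF V(1)] image_compactin[OF V(2) f(2)] f(3) V(3)
    by (auto simp: open_map_def)
  show ?thesis using K V(4)
  proof (induction rule: residually_founded.induct)
    case trivial
    have "{\<one>} <#> V = V" using Vc by (force simp: set_mult_def)
    then show ?case using H.residually_founded_compact fV by simp
  next
    case (step K)
    note nVK = step.prems
    have Kc: "K \<subseteq> carrier G" using step.hyps by (simp add: subgroup.subset)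
    define B where "B = f ` (K <#> V)"
    have sub: "subgroup (f ` (K' <#> V)) H" "f ` V \<subseteq> f ` (K' <#> V)"
      "openin S (f ` (K' <#> V))" "closedin S (f ` (K' <#> V))"
      if K': "subgroup K' G" "normalizes G V K'" for K'
    proof -
      show s: "subgroup (f ` (K' <#> V)) H"
        using f.subgroup_img_is_subgroup[OF G.product_subgroup[OF K'(1) V(1) K'(2)]] .
      have "V \<subseteq> K' <#> V"
      proof
        fix v assume v: "v \<in> V"
        then have "v = \<one> \<otimes> v" using Vc by auto
        then show "v \<in> K' <#> V" 
          using v subgroup.one_closed[OF K'(1)] unfolding G.set_mult_iff by blast
      qed
      then show sb: "f ` V \<subseteq> f ` (K' <#> V)" by blast
      show "openin S (f ` (K' <#> V))" "closedin S (f ` (K' <#> V))"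
        using H.open_subgroup_of_nbhd[OF s fV(3) subgroup.one_closed[OF fV(1)] sb] by auto
    qed
    note B = sub[OF step.hyps(1) nVK, folded B_def]
    show ?case
      unfolding B_def[symmetric]
    proof (rule residually_founded.step[OF B(1,4)])
      fix Q assume Q: "subgroup Q H" "Q \<subseteq> B" "openin (subtopology S B) Q" "cpt_generated H S Q"
      obtain C where C: "compactin S C" "generate H C = Q" using Q(4) by (auto simp: cpt_generated_def)
      have CB: "C \<subseteq> B" using subset_generate[of C H] C Q by auto
      have "openin (subtopology S B) (f ` V)" using fV(3) B(2) by (auto simp: openin_subtopology)
      then obtain F where F: "finite F" "F \<subseteq> C" "\<And>c. c \<in> C \<Longrightarrow> \<exists>q\<in>F. inv\<^bsub>H\<^esub> q \<otimes>\<^bsub>H\<^esub> c \<in> f ` V"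
        using H.compact_cover[OF C(1) CB B(1) fV(1)] by blast
      have "\<forall>q\<in>F. \<exists>k\<in>K. \<exists>v\<in>V. q = f (k \<otimes> v)"
        using F(2) CB unfolding B_def by (fastforce simp: G.set_mult_iff)
      then obtain k where k: "\<And>q. q \<in> F \<Longrightarrow> k q \<in> K" "\<And>q. q \<in> F \<Longrightarrow> \<exists>v\<in>V. q = f (k q \<otimes> v)"
        by metis
      define L where "L = V \<inter> K"
      have L: "subgroup L G" "compactin T L" "L \<subseteq> K" "normalizes G V L"
        using V step.hyps nVK G.normalizes_self
        by (auto simp: L_def G.subgroups_Inter_pair compact_Int_closedin G.normalizes_Int)
      define E where "E = {v \<otimes> x \<otimes> inv v |v x. v \<in> V \<and> x \<in> k ` F}"
      have "compactin T (k ` F)" using F(1) k(1) Kc by (intro finite_imp_compactin) auto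
      then have E: "compactin T E" unfolding E_def using G.compact_conj V(2) by blast
      have EK: "E \<subseteq> K" using k(1) normalizesD[OF nVK] by (auto simp: E_def)
      have nVE: "normalizes G V E"
      proof (rule normalizesI)
        fix u y assume u: "u \<in> V" and "y \<in> E"
        then obtain v x where vx: "v \<in> V" "x \<in> k ` F" "y = v \<otimes> x \<otimes> inv v" by (auto simp: E_def)
        have "x \<in> carrier G" using vx k(1) Kc by auto
        then have "u \<otimes> y \<otimes> inv u = (u \<otimes> v) \<otimes> x \<otimes> inv (u \<otimes> v)"
          unfolding vx(3) using u vx Vc by (intro G.conj_conj) auto
        moreover have "u \<otimes> v \<in> V" using u vx V(1) by (simp add: subgroup.m_closed)
        ultimately show "u \<otimes> y \<otimes> inv u \<in> E" using vx(2) unfolding E_def by blast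
      qed
      \<comment> \<open>Including \<open>L\<close> makes \<open>K1\<close> relatively open, and \<open>E\<close> is the \<open>V\<close>-invariant hull of the chosen lifts.\<close>
      define K1 where "K1 = generate G (L \<union> E)"
      have LE: "L \<union> E \<subseteq> K" "L \<union> E \<subseteq> carrier G" using L EK Kc by auto
      have K1: "subgroup K1 G" "K1 \<subseteq> K" "L \<subseteq> K1" "E \<subseteq> K1"
        using G.generate_is_subgroup[OF LE(2)] G.generate_subgroup_incl[OF LE(1) step.hyps(1)]
          subset_generate[of "L \<union> E" G] by (auto simp: K1_def)
      have cgK1: "cpt_generated G T K1" using compactin_Un[OF L(2) E] unfolding cpt_generated_def K1_def by blast
      have nVK1: "normalizes G V K1"
        unfolding K1_def using L(4) nVE by (intro G.generate_normalized[OF LE(2) Vc]) (auto simp: normalizes_def)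
      have oK1: "openin (subtopology T K) K1"
        by (rule G.open_subgroup[OF step.hyps(1) K1(1,2) V(3) subgroup.one_closed[OF V(1)]])
          (use K1(3) in \<open>simp add: L_def\<close>)
      have clK1: "closedin T K1" using G.open_subgroup_closed_ambient[OF step.hyps(1,2) K1(1) oK1] .
      define R where "R = residual G T K1"
      have R: "subgroup R G" "R \<subseteq> K1" "normalizes G V R"
        using G.residual_subgroup[OF K1(1)] G.residual_subset[OF K1(1)] 
          G.residual_normalized[OF K1(1) Vc nVK1] by (auto simp: R_def)
      have IH: "residually_founded H S (f ` (R <#> V))"
        using step.IH[OF K1(1,2) oK1 cgK1] R(3) by (simp add: R_def)
      have oL: "openin (subtopology T K1) L"
        by (rule G.open_subgroup[OF K1(1) L(1) K1(3) V(3) subgroup.one_closed[OF V(1)]])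
          (use K1(2) in \<open>auto simp: L_def\<close>)
      obtain W1 where W1: "W1 \<in> open_normals G T K1" "W1 \<subseteq> R <#> L"
        using G.open_normal_near_residual[OF K1(1) cgK1 L(1,2) K1(3) oL] unfolding R_def by blast
      have sW1: "subgroup W1 G" "W1 \<subseteq> K1" "openin (subtopology T K1) W1" "normalizes G K1 W1"
        using W1(1) by (auto simp: open_normals_def)
      define W2 where "W2 = {x \<in> K1. \<forall>v\<in>V. v \<otimes> x \<otimes> inv v \<in> W1}"
      note W2 = G.invariant_core[OF K1(1) sW1(1-3) V(1,2) nVK1, folded W2_def]
      have W2K1: "W2 \<subseteq> K1" by (auto simp: W2_def)
      obtain V0 where V0: "subgroup V0 G" "V0 \<subseteq> V" "openin T (W2 <#> V0)" "subgroup (W2 <#> V0) G"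
        "normalizes G V (W2 <#> V0)" "normalizes G K1 (W2 <#> V0)"
        using G.open_normal_extension[OF V(1-3) K1(1) cgK1 nVK1 W2(1,2) W2K1 W2(4) W2(5)[OF sW1(4)]] by blast
      define W where "W = W2 <#> V0"
      have WK1V: "W \<subseteq> K1 <#> V" using W2K1 V0(2) unfolding W_def set_mult_def by blast
      have WRV: "W \<subseteq> R <#> V"
      proof
        fix x assume "x \<in> W"
        then obtain w u where wu: "w \<in> W2" "u \<in> V0" "x = w \<otimes> u" by (auto simp: W_def G.set_mult_iff)
        have "w \<in> R <#> L" using wu W2(3) W1(2) by auto
        then obtain r l where rl: "r \<in> R" "l \<in> L" "w = r \<otimes> l" by (auto simp: G.set_mult_iff)
        have "l \<otimes> u \<in> V" using rl wu V0 V(1) by (auto simp: L_def subgroup.m_closed)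
        moreover have "x = r \<otimes> (l \<otimes> u)"
          unfolding wu(3) rl(3) using rl wu V0(2) Vc R(2) K1(2) L(3) Kc by (intro G.m_assoc) auto
        ultimately show "x \<in> R <#> V" using rl unfolding G.set_mult_iff by blast
      qed
      define P where "P = f ` (K1 <#> V)"
      note P = sub[OF K1(1) nVK1, folded P_def]
      have fW: "f ` W \<in> open_normals H S P"
        unfolding open_normals_def
      proof (intro CollectI conjI)
        show "subgroup (f ` W) H" using f.subgroup_img_is_subgroup V0(4) by (simp add: W_def)
        show WP: "f ` W \<subseteq> P" using WK1V by (auto simp: P_def)
        have "openin S (f ` W)" using f(3) V0(3) by (simp add: open_map_def W_def)
        then show "openin (subtopology S P) (f ` W)" using WP by (auto simp: openin_subtopology)
        show "normalizes H P (f ` W)"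
        proof (rule normalizesI)
          fix p y assume "p \<in> P" "y \<in> f ` W"
          then obtain a v x where *: "a \<in> K1" "v \<in> V" "p = f (a \<otimes> v)" "x \<in> W" "y = f x"
            by (auto simp: P_def G.set_mult_iff)
          have c: "a \<in> carrier G" "v \<in> carrier G" "x \<in> carrier G"
            using * K1(2) Kc Vc subgroup.subset[OF V0(4)] by (auto simp: W_def)
          have "a \<otimes> (v \<otimes> x \<otimes> inv v) \<otimes> inv a \<in> W"
            using normalizesD[OF V0(6) *(1) normalizesD[OF V0(5) *(2)]] *(4) by (simp add: W_def)
          then have "(a \<otimes> v) \<otimes> x \<otimes> inv (a \<otimes> v) \<in> W" using c by (simp add: G.conj_conj)
          moreover have "p \<otimes>\<^bsub>H\<^esub> y \<otimes>\<^bsub>H\<^esub> inv\<^bsub>H\<^esub> p = f ((a \<otimes> v) \<otimes> x \<otimes> inv (a \<otimes> v))"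
            using * c by simp
          ultimately show "p \<otimes>\<^bsub>H\<^esub> y \<otimes>\<^bsub>H\<^esub> inv\<^bsub>H\<^esub> p \<in> f ` W" by simp
        qed
      qed
      have CP: "C \<subseteq> P"
      proof
        fix c assume c: "c \<in> C"
        then obtain q where q: "q \<in> F" "inv\<^bsub>H\<^esub> q \<otimes>\<^bsub>H\<^esub> c \<in> f ` V" using F(3) by blast
        then obtain w where w: "w \<in> V" "inv\<^bsub>H\<^esub> q \<otimes>\<^bsub>H\<^esub> c = f w" by blast
        obtain v where v: "v \<in> V" "q = f (k q \<otimes> v)" using k(2)[OF q(1)] by blast
        have cc: "c \<in> carrier H" "q \<in> carrier H" using c q F(2) C(1) H.compact_carrier by auto
        have kc: "k q \<in> carrier G" "v \<in> carrier G" "w \<in> carrier G" using k(1)[OF q(1)] v w Kc Vc by auto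
        have "c = q \<otimes>\<^bsub>H\<^esub> (inv\<^bsub>H\<^esub> q \<otimes>\<^bsub>H\<^esub> c)" using cc by simp
        also have "\<dots> = f (k q \<otimes> v) \<otimes>\<^bsub>H\<^esub> f w" using w v by simp
        also have "\<dots> = f (k q \<otimes> (v \<otimes> w))" using kc by (simp add: G.m_assoc flip: f.hom_mult)
        finally have e: "c = f (k q \<otimes> (v \<otimes> w))" .
        have "\<one> \<otimes> k q \<otimes> inv \<one> \<in> E" unfolding E_def
          using subgroup.one_closed[OF V(1)] q(1) by blast
        then have "k q \<in> K1" using kc K1(4) by auto
        moreover have "v \<otimes> w \<in> V" using v w V(1) by (simp add: subgroup.m_closed)
        ultimately have "k q \<otimes> (v \<otimes> w) \<in> K1 <#> V" unfolding G.set_mult_iff by blast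
        then show "c \<in> P" unfolding P_def e by blast
      qed
      have QP: "Q \<subseteq> P" using H.generate_subgroup_incl[OF CP P(1)] C(2) by simp
      have "residual H S P \<subseteq> f ` W" using fW by (auto simp: residual_def)
      then have "residual H S Q \<subseteq> f ` (R <#> V)"
        using H.residual_mono[OF Q(1) P(1) QP] WRV by blast
      moreover have "closedin S Q" using H.open_subgroup_closed_ambient[OF B(1,4) Q(1,3)] .
      ultimately show "residually_founded H S (residual H S Q)"
        using H.residually_founded_subgroup[OF IH H.residual_subgroup[OF Q(1)]] H.residual_closed[OF Q(1)] by blast
    qed
  qed
qed

section \<open>Regionally elementary groups are residually founded\<close>

lemma (in top_group) subtopology_nested: "Q \<subseteq> X \<Longrightarrow> subtopology (subtopology T X) Q = subtopology T Q"
  by (simp add: subtopology_subtopology Int_absorb1)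

lemma (in top_group) top_group_subgroup:
  assumes H: "subgroup H G"
  shows "top_group (G\<lparr>carrier := H\<rparr>) (subtopology T H)"
proof -
  have Hc: "H \<subseteq> carrier G" using H by (simp add: subgroup.subset)
  let ?T = "subtopology T H"
  have top: "topspace ?T = H" using Hc by auto
  have gr: "group (G\<lparr>carrier := H\<rparr>)" using subgroup_imp_group[OF H] .
  have 1: "continuous_map (prod_topology ?T ?T) T (\<lambda>p. fst p \<otimes> snd p)"
  proof (rule continuous_mult)
    show "continuous_map (prod_topology ?T ?T) T fst"
      using continuous_map_into_fulltopology[OF continuous_map_fst] .
    show "continuous_map (prod_topology ?T ?T) T snd"
      using continuous_map_into_fulltopology[OF continuous_map_snd] .
  qed
  have "continuous_map (prod_topology ?T ?T) ?T (\<lambda>p. fst p \<otimes> snd p)"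
  proof (rule continuous_map_into_subtopology[OF 1], rule Pi_I)
    fix p assume "p \<in> topspace (prod_topology ?T ?T)"
    then have "p \<in> H \<times> H" using top by (simp only: topspace_prod_topology)
    then show "fst p \<otimes> snd p \<in> H" using subgroup.m_closed[OF H] by auto
  qed
  moreover have "(\<lambda>p. fst p \<otimes> snd p) = (\<lambda>(x, y). x \<otimes> y)" by auto
  ultimately have m: "continuous_map (prod_topology ?T ?T) ?T (\<lambda>(x, y). x \<otimes> y)" by simp
  have 2: "continuous_map ?T T (\<lambda>x. inv x)"
    by (rule continuous_inv[OF continuous_map_from_subtopology[OF continuous_id]])
  have "continuous_map ?T ?T (\<lambda>x. inv x)"
  proof (rule continuous_map_into_subtopology[OF 2], rule Pi_I)
    fix x assume "x \<in> topspace ?T"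
    then show "inv x \<in> H" using subgroup.m_inv_closed[OF H] by simp
  qed
  then have i: "continuous_map ?T ?T (\<lambda>x. inv\<^bsub>G\<lparr>carrier := H\<rparr>\<^esub> x)"
    by (rule continuous_map_eq) (use top H in auto)
  show ?thesis
    unfolding top_group_def top_group_axioms_def topological_group_def
    using gr top m i Hausdorff by (simp add: Hausdorff_space_subtopology)
qed

lemma (in van_dantzig_group) van_dantzig_group_subgroup:
  assumes H: "subgroup H G" "closedin T H"
  shows "van_dantzig_group (G\<lparr>carrier := H\<rparr>) (subtopology T H)"
proof -
  interpret H: top_group "G\<lparr>carrier := H\<rparr>" "subtopology T H" using top_group_subgroup[OF H(1)] .
  show ?thesis
  proof
    fix W assume W: "openin (subtopology T H) W" "\<one>\<^bsub>G\<lparr>carrier := H\<rparr>\<^esub> \<in> W"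
    then have "\<one> \<in> W" by simp
    then obtain W' where W': "openin T W'" "\<one> \<in> W'" "W' \<inter> H \<subseteq> W" using open_nbhd[OF W(1)] by blast
    obtain V where V: "subgroup V G" "compactin T V" "openin T V" "V \<subseteq> W'"
      using small_subgroup[OF W'(1,2)] by blast
    have "subgroup (V \<inter> H) (G\<lparr>carrier := H\<rparr>)"
      using V(1) H(1) by (intro subgroup_incl subgroups_Inter_pair) auto
    moreover have "compactin (subtopology T H) (V \<inter> H)"
      using V(2) H(2) by (simp add: compactin_subtopology compact_Int_closedin)
    moreover have "openin (subtopology T H) (V \<inter> H)" using V(3) by (auto simp: openin_subtopology)
    ultimately show "\<exists>V. subgroup V (G\<lparr>carrier := H\<rparr>) \<and> compactin (subtopology T H) V \<and> 
        openin (subtopology T H) V \<and> V \<subseteq> W"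
      using V(4) W'(3) by blast
  qed
qed

text \<open>Cosets and the isomorphic copy of the quotient are eliminated here: afterwards a quotient is just a
continuous open surjective homomorphism.\<close>
lemma (in top_group) hom_from_quotient:
  assumes N: "N \<lhd> G" and iso: "topologically_isomorphic (G Mod N) (quotient_topology G T N) Q S"
    and Q: "group Q"
  obtains f where "f \<in> hom G Q" "continuous_map T S f" "open_map T S f" "f ` carrier G = carrier Q"
    "{x \<in> carrier G. f x = \<one>\<^bsub>Q\<^esub>} \<subseteq> N"
proof -
  interpret N: normal N G by fact
  let ?q = "\<lambda>x. N #> x"
  let ?Q = "quotient_topology G T N"
  obtain h where h: "h \<in> iso (G Mod N) Q" "homeomorphic_map ?Q S h"
    using iso by (auto simp: topologically_isomorphic_def)
  have q: "?q \<in> hom G (G Mod N)" using N.r_coset_hom_Mod .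
  have qm: "quotient_map T ?Q ?q" using quotient_map_quotient_topology[OF topspace] .
  have qo: "open_map T ?Q ?q"
    unfolding open_map_def
  proof (intro allI impI)
    fix V assume V: "openin T V"
    have Vc: "V \<subseteq> carrier G" using open_carrier[OF V] .
    have Nc: "N \<subseteq> carrier G" using N.subset .
    have "{x \<in> topspace T. ?q x \<in> ?q ` V} = (\<Union>n\<in>N. {x \<in> carrier G. n \<otimes> x \<in> V})"
    proof
      show "{x \<in> topspace T. ?q x \<in> ?q ` V} \<subseteq> (\<Union>n\<in>N. {x \<in> carrier G. n \<otimes> x \<in> V})"
      proof
        fix x assume "x \<in> {x \<in> topspace T. ?q x \<in> ?q ` V}"
        then obtain y where y: "x \<in> carrier G" "y \<in> V" "N #> x = N #> y" by auto
        then have "y \<in> N #> x" using rcos_self[of y N] Vc N.subgroup_axioms by auto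
        then obtain n where "n \<in> N" "y = n \<otimes> x" by (auto simp: r_coset_def)
        then show "x \<in> (\<Union>n\<in>N. {x \<in> carrier G. n \<otimes> x \<in> V})" using y by blast
      qed
      show "(\<Union>n\<in>N. {x \<in> carrier G. n \<otimes> x \<in> V}) \<subseteq> {x \<in> topspace T. ?q x \<in> ?q ` V}"
      proof
        fix x assume "x \<in> (\<Union>n\<in>N. {x \<in> carrier G. n \<otimes> x \<in> V})"
        then obtain n where n: "n \<in> N" "x \<in> carrier G" "n \<otimes> x \<in> V" by blast
        have "n \<otimes> x \<in> N #> x" using n by (auto simp: r_coset_def)
        then have "N #> x = N #> (n \<otimes> x)" using n repr_independence N.subgroup_axioms by blast
        then show "x \<in> {x \<in> topspace T. ?q x \<in> ?q ` V}" using n by auto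
      qed
    qed
    moreover have "openin T (\<Union>n\<in>N. {x \<in> carrier G. n \<otimes> x \<in> V})"
      using Nc by (intro openin_Union ballI; clarsimp) (intro open_preimage continuous_intro V; auto)
    moreover have "?q ` V \<subseteq> carrier (G Mod N)" using Vc by (auto simp: carrier_FactGroup)
    ultimately show "openin ?Q (?q ` V)" by (simp add: openin_quotient_topology)
  qed
  have qs: "?q ` carrier G = carrier (G Mod N)" by (simp add: carrier_FactGroup)
  have hb: "bij_betw h (carrier (G Mod N)) (carrier Q)" "h \<in> hom (G Mod N) Q"
    using h(1) by (auto simp: iso_def)
  interpret h: group_hom "G Mod N" Q h
    using hb(2) Q N.factorgroup_is_group by (simp add: group_hom_def group_hom_axioms_def)
  show ?thesis
  proof (rule that[of "\<lambda>x. h (N #> x)"])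
    show "(\<lambda>x. h (N #> x)) \<in> hom G Q" using Group.hom_compose[OF q hb(2)] by (simp add: comp_def)
    show "continuous_map T S (\<lambda>x. h (N #> x))"
      using continuous_map_compose[OF quotient_imp_continuous_map[OF qm] homeomorphic_imp_continuous_map[OF h(2)]]
      by (simp add: comp_def)
    show "open_map T S (\<lambda>x. h (N #> x))"
      using open_map_compose[OF qo homeomorphic_imp_open_map[OF h(2)]] by (simp add: comp_def)
    show "(\<lambda>x. h (N #> x)) ` carrier G = carrier Q"
      using hb(1) qs by (metis bij_betw_imp_surj_on image_image)
    have "x \<in> N" if x: "x \<in> carrier G" "h (N #> x) = \<one>\<^bsub>Q\<^esub>" for x
    proof -
      have "h (N #> x) = h \<one>\<^bsub>G Mod N\<^esub>" using x by (metis h.hom_one)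
      moreover have "N #> x \<in> carrier (G Mod N)" using x qs by blast
      ultimately have "N #> x = \<one>\<^bsub>G Mod N\<^esub>" 
        using hb(1) h.one_closed unfolding bij_betw_def inj_on_def by blast
      then have "N #> x = N" by simp
      then show ?thesis using rcos_self[OF x(1) N.subgroup_axioms] by simp
    qed
    then show "{x \<in> carrier G. h (N #> x) = \<one>\<^bsub>Q\<^esub>} \<subseteq> N" by blast
  qed
qed

text \<open>Both directions are pullbacks along the identity map, which is continuous either way.\<close>
lemma (in van_dantzig_group) residually_founded_ambient:
  assumes A: "subgroup A G" "closedin T A"
  shows "residually_founded (G\<lparr>carrier := A\<rparr>) (subtopology T A) A \<longleftrightarrow> residually_founded G T A"
proof -
  have vd: "van_dantzig_group G T" "van_dantzig_group (G\<lparr>carrier := A\<rparr>) (subtopology T A)"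
    using van_dantzig_group_axioms van_dantzig_group_subgroup[OF A] .
  have Ac: "A \<subseteq> carrier G" using A by (simp add: subgroup.subset)
  interpret A: van_dantzig_group "G\<lparr>carrier := A\<rparr>" "subtopology T A" using vd(2) .
  show ?thesis
  proof
    assume R: "residually_founded (G\<lparr>carrier := A\<rparr>) (subtopology T A) A"
    show "residually_founded G T A"
    proof (rule residually_founded_hom[OF R vd residually_founded.trivial A, where f = "\<lambda>x. x"])
      show "continuous_map (subtopology T A) (subtopology T A) (\<lambda>x. x)" by simp
    qed (auto simp: hom_def)
  next
    assume R: "residually_founded G T A"
    show "residually_founded (G\<lparr>carrier := A\<rparr>) (subtopology T A) A"
    proof (rule residually_founded_hom[OF R vd(2,1) residually_founded.trivial, where f = "\<lambda>x. x"])
      show "subgroup A (G\<lparr>carrier := A\<rparr>)" using A.subgroup_self by simp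
      show "closedin (subtopology T A) A" using A.topspace closedin_topspace[of "subtopology T A"] by simp
      show "continuous_map (subtopology (subtopology T A) A) T (\<lambda>x. x)"
        by (intro continuous_map_from_subtopology continuous_id)
    qed (use Ac in \<open>auto simp: hom_def\<close>)
  qed
qed

text \<open>The base cases hold because compact and discrete groups have trivial residuals; each
closure property is an instance of one of the two pullback and image lemmas.\<close>
lemma regionally_elementary_over_imp:
  assumes "regionally_elementary_over G T"
  shows "van_dantzig_group G T \<and> residually_founded G T (carrier G)"
  using assms
proof (induction rule: regionally_elementary_over.induct)
  case (profinite G T)
  then have "tdlc_group G T"
    by (simp add: profinite_group_def tdlc_group_def compact_imp_locally_compact_space)
  then interpret van_dantzig_group G T by (rule tdlc_imp_van_dantzig_group)
  have "compactin T (carrier G)" using profinite by (simp add: profinite_group_def compact_space_def)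
  then show ?case using van_dantzig_group_axioms residually_founded_compact[OF subgroup_self] by simp
next
  case (discrete G T)
  have tg: "topological_group G T" using discrete unfolding discrete_group_def by blast
  then have "group G" by (simp add: topological_group_def)
  then interpret top_group G T using tg by (simp add: top_group_def top_group_axioms_def)
  have T: "T = discrete_topology (carrier G)" using discrete by (simp add: discrete_group_def)
  interpret van_dantzig_group G T
  proof
    fix W assume "\<one>\<^bsub>G\<^esub> \<in> W"
    then show "\<exists>V. subgroup V G \<and> compactin T V \<and> openin T V \<and> V \<subseteq> W"
      using triv_subgroup by (intro exI[of _ "{\<one>\<^bsub>G\<^esub>}"]) (auto simp: T)
  qed
  have "residually_founded G T (carrier G)"
  proof (rule residually_founded.step)
    fix Q assume Q: "subgroup Q G"
    have "{\<one>\<^bsub>G\<^esub>} \<in> open_normals G T Q"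
      using Q triv_subgroup subgroup.one_closed[OF Q] subgroup.subset[OF Q]
      by (auto simp: open_normals_def normalizes_def T openin_subtopology subset_iff intro!: exI[of _ "{\<one>\<^bsub>G\<^esub>}"])
    then have "residual G T Q = {\<one>\<^bsub>G\<^esub>}"
      using subgroup.one_closed[OF residual_subgroup[OF Q]] by (auto simp: residual_def)
    then show "residually_founded G T (residual G T Q)" by (simp add: residually_founded.trivial)
  qed (auto simp: subgroup_self T)
  then show ?case using van_dantzig_group_axioms by simp
next
  case (closed_subgroup G T H)
  interpret van_dantzig_group G T using closed_subgroup.IH by blast
  have "residually_founded G T H" 
    using residually_founded_subgroup[OF _ closed_subgroup.hyps(2,3) subgroup.subset[OF closed_subgroup.hyps(2)]]
      closed_subgroup.IH by blast
  then show ?case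
    using residually_founded_ambient[OF closed_subgroup.hyps(2,3)] van_dantzig_group_subgroup[OF closed_subgroup.hyps(2,3)]
    by simp
next
  case (quotient G T N Q S)
  interpret G: van_dantzig_group G T using quotient.IH by blast
  interpret Q: van_dantzig_group Q S using tdlc_imp_van_dantzig_group[OF quotient.hyps(4)] .
  obtain f where f: "f \<in> hom G Q" "continuous_map T S f" "open_map T S f" "f ` carrier G = carrier Q"
    "{x \<in> carrier G. f x = \<one>\<^bsub>Q\<^esub>} \<subseteq> N"
    by (rule G.hom_from_quotient[OF quotient.hyps(2,5) Q.is_group])
  obtain V where V: "subgroup V G" "compactin T V" "openin T V"
    using G.small_subgroup[OF openin_topspace] by auto
  have Vc: "V \<subseteq> carrier G" using V by (simp add: subgroup.subset)
  have n: "normalizes G V (carrier G)" using Vc by (auto simp: normalizes_def)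
  have "carrier G <#>\<^bsub>G\<^esub> V = carrier G"
  proof
    show "carrier G <#>\<^bsub>G\<^esub> V \<subseteq> carrier G" using Vc by (auto simp: G.set_mult_iff subset_iff)
    show "carrier G \<subseteq> carrier G <#>\<^bsub>G\<^esub> V"
    proof
      fix x assume x: "x \<in> carrier G"
      then have "x = x \<otimes>\<^bsub>G\<^esub> \<one>\<^bsub>G\<^esub>" by simp
      then show "x \<in> carrier G <#>\<^bsub>G\<^esub> V" 
        using x subgroup.one_closed[OF V(1)] unfolding G.set_mult_iff by blast
    qed
  qed
  then have "residually_founded Q S (carrier Q)"
    using residually_founded_quotient[OF _ G.van_dantzig_group_axioms Q.van_dantzig_group_axioms V n f(1-3)] quotient.IH f(4) by simp
  then show ?case using Q.van_dantzig_group_axioms by simp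
next
  case (extension G T N Q S)
  interpret G: van_dantzig_group G T using tdlc_imp_van_dantzig_group[OF extension.hyps(1)] .
  interpret Q: van_dantzig_group Q S using extension.IH by blast
  obtain f where f: "f \<in> hom G Q" "continuous_map T S f" "open_map T S f" "f ` carrier G = carrier Q"
    "{x \<in> carrier G. f x = \<one>\<^bsub>Q\<^esub>} \<subseteq> N"
    by (rule G.hom_from_quotient[OF extension.hyps(2,5) Q.is_group])
  have sN: "subgroup N G" using extension.hyps(2) G.normal_inv_iff by blast
  have RN: "residually_founded G T N"
    using G.residually_founded_ambient[OF sN extension.hyps(3)] extension.IH by simp
  have RQ: "residually_founded Q S (carrier Q)" using extension.IH by blast
  have "residually_founded G T (carrier G)"
  proof (rule residually_founded_hom[OF RQ G.van_dantzig_group_axioms Q.van_dantzig_group_axioms RN, where f = f])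
    show "f \<in> hom (G\<lparr>carrier := carrier G\<rparr>) Q" using f(1) by (simp add: hom_def)
    show "continuous_map (subtopology T (carrier G)) S f" 
      by (intro continuous_map_from_subtopology f(2))
    show "closedin T (carrier G)" by (metis G.topspace closedin_topspace)
    show "subgroup (carrier G) G" using G.subgroup_self .
    show "f ` carrier G \<subseteq> carrier Q" using f(4) by simp
    show "x \<in> N" if "x \<in> carrier G" "f x = \<one>\<^bsub>Q\<^esub>" for x using f(5) that by blast
  qed
  then show ?case using G.van_dantzig_group_axioms by simp
next
  case (directed_union G T \<O>)
  interpret G: van_dantzig_group G T using tdlc_imp_van_dantzig_group[OF directed_union.hyps(1)] .
  have A: "subgroup A G" "openin T A" "closedin T A" "residually_founded G T A" if "A \<in> \<O>" for A
  proof -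
    show s: "subgroup A G" "openin T A" using directed_union.IH that by blast+
    show c: "closedin T A" using G.open_subgroup_of_nbhd(2)[OF s subgroup.one_closed[OF s(1)]] by simp
    show "residually_founded G T A" 
      using G.residually_founded_ambient[OF s(1) c] directed_union.IH that by simp
  qed
  have "residually_founded G T (carrier G)"
  proof (rule residually_founded.step)
    show "closedin T (carrier G)" by (metis G.topspace closedin_topspace)
    fix Q assume Q: "subgroup Q G" "openin (subtopology T (carrier G)) Q" "cpt_generated G T Q"
    have oQ: "openin T Q" using Q(2) by (metis G.topspace subtopology_topspace)
    have cQ: "closedin T Q" using G.open_subgroup_of_nbhd(2)[OF Q(1) oQ subgroup.one_closed[OF Q(1)]] by simp
    obtain K where K: "compactin T K" "generate G K = Q" using Q(3) by (auto simp: cpt_generated_def)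
    have "K \<subseteq> \<Union>\<O>" using G.compact_carrier[OF K(1)] directed_union.hyps by simp
    moreover have "\<forall>B\<in>\<O>. openin T B" using A by blast
    ultimately obtain \<F> where \<F>: "finite \<F>" "\<F> \<subseteq> \<O>" "K \<subseteq> \<Union>\<F>"
      using K(1) unfolding compactin_def by meson
    have "\<exists>A\<in>\<O>. \<Union>\<F> \<subseteq> A" using \<F>(1,2)
    proof (induction rule: finite_induct)
      case empty then show ?case using directed_union.hyps by auto
    next
      case (insert B \<F>)
      then obtain A where A: "A \<in> \<O>" "\<Union>\<F> \<subseteq> A" by auto
      have "B \<in> \<O>" using insert by simp
      then obtain C where "C \<in> \<O>" "A \<union> B \<subseteq> C" using directed_union.hyps(3) A(1) by blast
      then show ?case using A(2) by (intro bexI[of _ C]) auto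
    qed
    then obtain A' where "A' \<in> \<O>" "\<Union>\<F> \<subseteq> A'" ..
    then have A': "A' \<in> \<O>" "K \<subseteq> A'" using \<F>(3) by simp_all
    have "Q \<subseteq> A'" using G.generate_subgroup_incl[OF A'(2) A(1)[OF A'(1)]] K by simp
    then have "residually_founded G T Q" using G.residually_founded_subgroup[OF A(4)[OF A'(1)] Q(1) cQ] by simp
    then show "residually_founded G T (residual G T Q)"
      using G.residually_founded_subgroup[OF _ G.residual_subgroup[OF Q(1)] G.residual_closed[OF Q(1) cQ] G.residual_subset[OF Q(1)]]
      by simp
  qed (rule G.subgroup_self)
  then show ?case using G.van_dantzig_group_axioms by simp
qed

section \<open>Quasi-centres and closed normal subgroups\<close>

context top_group begin

abbreviation cl :: "'a set \<Rightarrow> 'a set" where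
  "cl D \<equiv> Abstract_Topology.closure_of T D"

lemma closure_subgroup:
  assumes D: "subgroup D G"
  shows "subgroup (cl D) G"
proof -
  let ?C = "cl D"
  have Dc: "D \<subseteq> carrier G" using D by (simp add: subgroup.subset)
  have sub: "D \<subseteq> ?C" using closure_of_subset[of D T] Dc by simp
  show ?thesis
  proof (rule subgroupI)
    show "?C \<subseteq> carrier G" using closure_of_subset_topspace[of T D] by simp
    show "?C \<noteq> {}" using sub subgroup.one_closed[OF D] by blast
  next
    fix a assume "a \<in> ?C"
    have "continuous_map T T (\<lambda>x. inv x)" by (intro continuous_intro)
    then have "(\<lambda>x. inv x) ` ?C \<subseteq> cl ((\<lambda>x. inv x) ` D)"
      by (rule continuous_map_image_closure_subset)
    also have "\<dots> \<subseteq> ?C" using D by (intro closure_of_mono) (auto simp: subgroup.m_inv_closed)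
    finally show "inv a \<in> ?C" using \<open>a \<in> ?C\<close> by auto
  next
    fix a b assume ab: "a \<in> ?C" "b \<in> ?C"
    have "continuous_map (prod_topology T T) T (\<lambda>p. fst p \<otimes> snd p)" by (intro continuous_intro)
    then have "(\<lambda>p. fst p \<otimes> snd p) ` (Abstract_Topology.closure_of (prod_topology T T) (D \<times> D))
      \<subseteq> cl ((\<lambda>p. fst p \<otimes> snd p) ` (D \<times> D))"
      by (rule continuous_map_image_closure_subset)
    also have "\<dots> \<subseteq> ?C" using D by (intro closure_of_mono) (auto simp: subgroup.m_closed)
    finally have "(\<lambda>p. fst p \<otimes> snd p) ` (?C \<times> ?C) \<subseteq> ?C" by (simp add: closure_of_Times)
    then show "a \<otimes> b \<in> ?C" using ab by force
  qed
qed

lemma closure_normalized: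
  assumes n: "normalizes G A D" and A: "A \<subseteq> carrier G"
  shows "normalizes G A (cl D)"
proof (rule normalizesI)
  fix g x assume g: "g \<in> A" and x: "x \<in> cl D"
  have "continuous_map T T (\<lambda>x. g \<otimes> x \<otimes> inv g)" using g A by (intro continuous_intro) auto
  then have "(\<lambda>x. g \<otimes> x \<otimes> inv g) ` (cl D) \<subseteq> cl ((\<lambda>x. g \<otimes> x \<otimes> inv g) ` D)"
    by (rule continuous_map_image_closure_subset)
  also have "\<dots> \<subseteq> cl D" using normalizesD[OF n g] by (intro closure_of_mono) auto
  finally show "g \<otimes> x \<otimes> inv g \<in> cl D" using x by auto
qed

definition dense :: "'a set \<Rightarrow> bool" where
  "dense D \<longleftrightarrow> (\<forall>V. openin T V \<longrightarrow> V \<noteq> {} \<longrightarrow> V \<inter> D \<noteq> {})"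

text \<open>The elements that conjugate a given point of \<open>N\<close> into \<open>N\<close> form a closed set.\<close>
lemma normalized_by_dense:
  assumes N: "closedin T N" and n: "normalizes G D N" and D: "dense D"
  shows "normalizes G (carrier G) N"
proof (rule normalizesI)
  fix g x assume g: "g \<in> carrier G" and x: "x \<in> N"
  have xc: "x \<in> carrier G" using x closed_carrier[OF N] by auto
  show "g \<otimes> x \<otimes> inv g \<in> N"
  proof (rule ccontr)
    assume no: "g \<otimes> x \<otimes> inv g \<notin> N"
    let ?V = "{h \<in> carrier G. h \<otimes> x \<otimes> inv h \<in> topspace T - N}"
    have "continuous_map T T (\<lambda>h. h \<otimes> x \<otimes> inv h)" using xc by (intro continuous_intro) auto
    moreover have "openin T (topspace T - N)" using N by blast
    ultimately have "openin T ?V" by (rule open_preimage)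
    moreover have "g \<in> ?V" using g xc no by simp
    ultimately obtain d where "d \<in> ?V" "d \<in> D" using D unfolding dense_def by blast
    then show False using normalizesD[OF n _ x] by auto
  qed
qed

definition closed_normals :: "'a set \<Rightarrow> 'a set set" where
  "closed_normals N = {Y. subgroup Y G \<and> closedin T Y \<and> Y \<subseteq> N \<and> normalizes G N Y \<and> Y \<noteq> {\<one>}}"

text \<open>The elements whose centralizer in \<open>N\<close> is relatively open.\<close>
definition quasi_centre :: "'a set \<Rightarrow> 'a set" where
  "quasi_centre N = {g \<in> N. \<exists>V. openin T V \<and> \<one> \<in> V \<and> (\<forall>x\<in>V \<inter> N. x \<otimes> g = g \<otimes> x)}"

lemma commute_inv:
  assumes "x \<in> carrier G" "g \<in> carrier G" "x \<otimes> g = g \<otimes> x"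
  shows "x \<otimes> inv g = inv g \<otimes> x"
proof -
  have "x \<otimes> inv g = inv g \<otimes> (g \<otimes> x) \<otimes> inv g" using assms(1,2) by (simp add: m_assoc)
  also have "\<dots> = inv g \<otimes> (x \<otimes> g) \<otimes> inv g" using assms(3) by simp
  also have "\<dots> = inv g \<otimes> x" using assms(1,2) by (simp add: m_assoc)
  finally show ?thesis .
qed

lemma commute_mult:
  assumes "x \<in> carrier G" "g \<in> carrier G" "h \<in> carrier G" "x \<otimes> g = g \<otimes> x" "x \<otimes> h = h \<otimes> x"
  shows "x \<otimes> (g \<otimes> h) = (g \<otimes> h) \<otimes> x"
proof -
  have "x \<otimes> (g \<otimes> h) = (g \<otimes> x) \<otimes> h" using assms(1-3) by (simp add: m_assoc flip: assms(4))
  also have "\<dots> = g \<otimes> (h \<otimes> x)" using assms(1-3) by (simp add: m_assoc assms(5))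
  finally show ?thesis using assms(1-3) by (simp add: m_assoc)
qed

lemma quasi_centre_subgroup:
  assumes N: "subgroup N G" shows "subgroup (quasi_centre N) G"
proof -
  have Nc: "N \<subseteq> carrier G" using N by (simp add: subgroup.subset)
  show ?thesis
  proof (rule subgroupI)
    show "quasi_centre N \<subseteq> carrier G" using Nc by (auto simp: quasi_centre_def)
    have "\<one> \<in> quasi_centre N"
      using Nc subgroup.one_closed[OF N] openin_topspace[of T] unfolding quasi_centre_def 
      by (auto intro!: exI[of _ "carrier G"])
    then show "quasi_centre N \<noteq> {}" by blast
  next
    fix a assume "a \<in> quasi_centre N"
    then obtain V where V: "a \<in> N" "openin T V" "\<one> \<in> V" "\<forall>x\<in>V \<inter> N. x \<otimes> a = a \<otimes> x"
      by (auto simp: quasi_centre_def)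
    have "\<forall>x\<in>V \<inter> N. x \<otimes> inv a = inv a \<otimes> x" using V Nc commute_inv by blast
    moreover have "inv a \<in> N" using V N by (simp add: subgroup.m_inv_closed)
    ultimately show "inv a \<in> quasi_centre N" using V unfolding quasi_centre_def by blast
  next
    fix a b assume "a \<in> quasi_centre N" "b \<in> quasi_centre N"
    then obtain V W where V: "a \<in> N" "openin T V" "\<one> \<in> V" "\<forall>x\<in>V \<inter> N. x \<otimes> a = a \<otimes> x"
      and W: "b \<in> N" "openin T W" "\<one> \<in> W" "\<forall>x\<in>W \<inter> N. x \<otimes> b = b \<otimes> x"
      by (auto simp: quasi_centre_def)
    have "\<forall>x\<in>(V \<inter> W) \<inter> N. x \<otimes> (a \<otimes> b) = (a \<otimes> b) \<otimes> x"
    proof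
      fix x assume "x \<in> (V \<inter> W) \<inter> N"
      then show "x \<otimes> (a \<otimes> b) = (a \<otimes> b) \<otimes> x" 
        using V W Nc by (intro commute_mult) auto
    qed
    moreover have "a \<otimes> b \<in> N" using V W N by (simp add: subgroup.m_closed)
    moreover have "openin T (V \<inter> W)" using V W by blast
    ultimately show "a \<otimes> b \<in> quasi_centre N" using V W unfolding quasi_centre_def by blast
  qed
qed

lemma quasi_centre_normalized:
  assumes N: "subgroup N G" and A: "subgroup A G" and n: "normalizes G A N"
  shows "normalizes G A (quasi_centre N)"
proof (rule normalizesI)
  fix g a assume g: "g \<in> A" and "a \<in> quasi_centre N"
  then obtain V where V: "a \<in> N" "openin T V" "\<one> \<in> V" "\<forall>x\<in>V \<inter> N. x \<otimes> a = a \<otimes> x"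
    by (auto simp: quasi_centre_def)
  have Nc: "N \<subseteq> carrier G" and gc: "g \<in> carrier G" 
    using N A g by (auto simp: subgroup.subset subgroup.mem_carrier)
  have ac: "a \<in> carrier G" using V Nc by auto
  let ?W = "{x \<in> carrier G. inv g \<otimes> x \<otimes> g \<in> V}"
  have "openin T ?W" using gc by (intro open_preimage continuous_intro V(2)) auto
  moreover have "\<one> \<in> ?W" using gc V by simp
  moreover have "x \<otimes> (g \<otimes> a \<otimes> inv g) = (g \<otimes> a \<otimes> inv g) \<otimes> x" if "x \<in> ?W \<inter> N" for x
  proof -
    have xc: "x \<in> carrier G" using that by simp
    have "inv g \<otimes> x \<otimes> inv (inv g) \<in> N"
      using that normalizesD[OF n, of "inv g" x] g A by (auto simp: subgroup.m_inv_closed)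
    then have "(inv g \<otimes> x \<otimes> g) \<otimes> a = a \<otimes> (inv g \<otimes> x \<otimes> g)" using that gc V by auto
    then have "g \<otimes> ((inv g \<otimes> x \<otimes> g) \<otimes> a) \<otimes> inv g = g \<otimes> (a \<otimes> (inv g \<otimes> x \<otimes> g)) \<otimes> inv g" by simp
    then show ?thesis using gc xc ac by (simp add: m_assoc)
  qed
  moreover have "g \<otimes> a \<otimes> inv g \<in> N" using normalizesD[OF n g V(1)] .
  ultimately show "g \<otimes> a \<otimes> inv g \<in> quasi_centre N" unfolding quasi_centre_def by blast
qed

text \<open>For \<open>y\<close> in \<open>Y\<close> and \<open>x\<close> in \<open>N\<close> near the identity, the commutator of \<open>x\<close> and \<open>y\<close> lies in \<open>Y\<close> and is close to
the identity, hence trivial.\<close>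
lemma discrete_normal_quasi_central:
  assumes N: "subgroup N G" and Y: "subgroup Y G" "Y \<subseteq> N" "normalizes G N Y"
    and V: "openin T V" "\<one> \<in> V" "Y \<inter> V \<subseteq> {\<one>}"
  shows "Y \<subseteq> quasi_centre N"
proof
  fix y assume y: "y \<in> Y"
  have yc: "y \<in> carrier G" using y Y(1) by (simp add: subgroup.mem_carrier)
  let ?W = "{x \<in> carrier G. (x \<otimes> y \<otimes> inv x) \<otimes> inv y \<in> V}"
  have "openin T ?W" using yc by (intro open_preimage continuous_intro V(1)) auto
  moreover have "\<one> \<in> ?W" using yc V by simp
  moreover have "x \<otimes> y = y \<otimes> x" if x: "x \<in> ?W \<inter> N" for x
  proof -
    have "x \<otimes> y \<otimes> inv x \<in> Y" using normalizesD[OF Y(3)] x y by auto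
    then have "(x \<otimes> y \<otimes> inv x) \<otimes> inv y \<in> Y" using y Y(1) by (simp add: subgroup.m_closed subgroup.m_inv_closed)
    then have "(x \<otimes> y \<otimes> inv x) \<otimes> inv y = \<one>" using x V by auto
    then have "x \<otimes> y \<otimes> inv x = y" using inv_equality[of "x \<otimes> y \<otimes> inv x" "inv y"] x yc by simp
    then have "x \<otimes> y \<otimes> inv x \<otimes> x = y \<otimes> x" by simp
    then show ?thesis using x yc by (simp add: m_assoc)
  qed
  ultimately show "y \<in> quasi_centre N" using y Y unfolding quasi_centre_def by blast
qed

end

text \<open>Non-discrete, topologically simple and regionally expansive, with expansiveness in the following
form: some compact open subgroup \<open>U\<close> contains no non-trivial subgroup that is normalized by \<open>U\<close> and a
compact set \<open>F\<close>. Here \<open>U\<close> and \<open>F\<close> generate the compactly generated open subgroup of the usual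
definition, and the normal core of \<open>U\<close> in it is the largest subgroup excluded.\<close>
definition expansive_simple :: "('a, 'm) monoid_scheme \<Rightarrow> 'a topology \<Rightarrow> 'a set \<Rightarrow> bool" where
  "expansive_simple G T X \<longleftrightarrow>
     subgroup X G \<and> closedin T X \<and> \<not> openin (subtopology T X) {\<one>\<^bsub>G\<^esub>} \<and>
     (\<forall>Y. subgroup Y G \<and> closedin T Y \<and> Y \<subseteq> X \<and> normalizes G X Y \<longrightarrow> Y = {\<one>\<^bsub>G\<^esub>} \<or> Y = X) \<and>
     (\<exists>U F. subgroup U G \<and> compactin T U \<and> U \<subseteq> X \<and> openin (subtopology T X) U \<and>
        compactin T F \<and> F \<subseteq> X \<and>
        (\<forall>L. subgroup L G \<and> L \<subseteq> U \<and> normalizes G U L \<and> normalizes G F L \<longrightarrow> L = {\<one>\<^bsub>G\<^esub>}))"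

text \<open>The same notion for a whole group. The compact set is covered by finitely many left cosets of \<open>U\<close>, and
as far as subgroups normalized by \<open>U\<close> are concerned, representatives \<open>S\<close> of these cosets do the same
work.\<close>
locale expansive_simple_group = top_group +
  fixes U S
  assumes nondiscrete: "\<not> openin T {\<one>}"
    and simple: "\<And>Y. subgroup Y G \<Longrightarrow> closedin T Y \<Longrightarrow> normalizes G (carrier G) Y \<Longrightarrow>
      Y = {\<one>} \<or> Y = carrier G"
    and U: "subgroup U G" "compactin T U" "openin T U"
    and S: "finite S" "S \<subseteq> carrier G"
    and expansive: "\<And>L. subgroup L G \<Longrightarrow> L \<subseteq> U \<Longrightarrow> normalizes G U L \<Longrightarrow> normalizes G S L \<Longrightarrow>
      L = {\<one>}"
begin

lemma U_carrier: "U \<subseteq> carrier G"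
  using U by (simp add: subgroup.subset)

text \<open>A set that spans meets each coset \<open>s U\<close> with \<open>s\<close> in \<open>S\<close>. For subgroups normalized by \<open>U\<close>, being
normalized by these elements is the same as being normalized by \<open>S\<close>.\<close>
definition spans :: "'a set \<Rightarrow> bool" where
  "spans N \<longleftrightarrow> (\<forall>s\<in>S. \<exists>n\<in>N. inv s \<otimes> n \<in> U)"

text \<open>Expansiveness forces subgroups to contain elements that leave \<open>U\<close> when conjugated by \<open>S\<close>; their
conjugates are recorded here. The further conjugation by \<open>U\<close> serves subgroups that \<open>U\<close> does not
normalize.\<close>
definition moved :: "'a set" where
  "moved = {u \<otimes> x \<otimes> inv u |u x. u \<in> U \<and> x \<in> {s \<otimes> w \<otimes> inv s |s w. s \<in> S \<and> w \<in> U} - U}"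

lemma moved_compact: "compactin T moved"
proof -
  have "compactin T S" using S by (simp add: finite_imp_compactin)
  then have c: "compactin T {s \<otimes> w \<otimes> inv s |s w. s \<in> S \<and> w \<in> U}" using compact_conj U(2) by blast
  have "compactin T ({s \<otimes> w \<otimes> inv s |s w. s \<in> S \<and> w \<in> U} - U)"
    by (rule closed_compactin[OF c Diff_subset closedin_diff[OF compact_closed[OF c] U(3)]])
  then show ?thesis unfolding moved_def by (rule compact_conj[OF U(2)])
qed

lemma moved_carrier: "moved \<subseteq> carrier G"
  using compact_carrier[OF moved_compact] .

lemma one_not_moved: "\<one> \<notin> moved"
proof
  assume "\<one> \<in> moved"
  then obtain u x where ux: "u \<in> U" "x \<notin> U" "\<one> = u \<otimes> x \<otimes> inv u"
      "x \<in> {s \<otimes> w \<otimes> inv s |s w. s \<in> S \<and> w \<in> U}" unfolding moved_def by blast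
  have c: "u \<in> carrier G" "x \<in> carrier G" using ux U_carrier S by auto
  have "x = inv u \<otimes> (u \<otimes> x \<otimes> inv u) \<otimes> u" using c by (simp add: m_assoc)
  also have "\<dots> = \<one>" using ux c by (metis l_inv r_one inv_closed)
  finally show False using ux subgroup.one_closed[OF U(1)] by simp
qed

text \<open>The closure is normalized by \<open>E\<close>, hence by the closure of \<open>E\<close>, and simplicity applies to it.\<close>
lemma dense_of_normalized:
  assumes D: "subgroup D G" "D \<noteq> {\<one>}" and n: "normalizes G E D" and E: "dense E" "E \<subseteq> carrier G"
  shows "dense D"
proof -
  let ?C = "cl D"
  have C: "subgroup ?C G" "closedin T ?C" using closure_subgroup[OF D(1)] by auto
  have "normalizes G (carrier G) ?C"
    using normalized_by_dense[OF C(2) closure_normalized[OF n E(2)] E(1)] .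
  then have "?C = {\<one>} \<or> ?C = carrier G" using simple C by blast
  moreover have "D \<subseteq> ?C" using closure_of_subset[of D T] subgroup.subset[OF D(1)] by simp
  ultimately have "?C = carrier G" using D subgroup.one_closed[OF D(1)] by blast
  then show ?thesis
    unfolding dense_def using openin_Int_closure_of_eq_empty[of T _ D] open_carrier by blast
qed

lemma dense_carrier: "dense (carrier G)"
  unfolding dense_def using open_carrier by blast

lemma dense_spans: "dense D \<Longrightarrow> spans D"
  unfolding spans_def
proof
  fix s assume D: "dense D" and s: "s \<in> S"
  have sc: "s \<in> carrier G" using s S by auto
  have "openin T {x \<in> carrier G. inv s \<otimes> x \<in> U}" 
    using sc by (intro open_preimage continuous_intro U(3)) auto
  moreover have "s \<in> {x \<in> carrier G. inv s \<otimes> x \<in> U}" using sc subgroup.one_closed[OF U(1)] by simp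
  ultimately show "\<exists>n\<in>D. inv s \<otimes> n \<in> U" using D unfolding dense_def by blast
qed

text \<open>Products of conjugates of a variable and of its inverse, as functions of the variable.
Treating them as functions turns membership in a normal closure into an open condition on the element
whose conjugates are taken.\<close>
inductive_set words :: "'a set \<Rightarrow> ('a \<Rightarrow> 'a) set" for E where
  one: "(\<lambda>c. \<one>) \<in> words E"
| conj: "d \<in> E \<Longrightarrow> (\<lambda>c. d \<otimes> c \<otimes> inv d) \<in> words E"
| inv: "w \<in> words E \<Longrightarrow> (\<lambda>c. inv (w c)) \<in> words E"
| mult: "w \<in> words E \<Longrightarrow> w' \<in> words E \<Longrightarrow> (\<lambda>c. w c \<otimes> w' c) \<in> words E"

lemma words_continuous:
  assumes "w \<in> words E" "E \<subseteq> carrier G" shows "continuous_map T T w"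
  using assms(1)
proof induction
  case (conj d)
  then show ?case using assms(2) by (intro continuous_intro) auto
qed (intro continuous_intro; simp)+

text \<open>A word involves only finitely many conjugating elements.\<close>
lemma words_finite:
  assumes "w \<in> words E"
  shows "\<exists>F. finite F \<and> F \<subseteq> E \<and> (\<forall>Y. subgroup Y G \<longrightarrow> normalizes G F Y \<longrightarrow> (\<forall>c\<in>Y. w c \<in> Y))"
  using assms
proof induction
  case one
  then show ?case by (intro exI[of _ "{}"]) (auto simp: subgroup.one_closed)
next
  case (conj d)
  then show ?case by (intro exI[of _ "{d}"]) (auto simp: normalizes_def)
next
  case (inv w)
  then show ?case by (meson subgroup.m_inv_closed)
next
  case (mult w w')
  then obtain F F' where F: "finite F" "F \<subseteq> E" "\<forall>Y. subgroup Y G \<longrightarrow> normalizes G F Y \<longrightarrow> (\<forall>c\<in>Y. w c \<in> Y)"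
    and F': "finite F'" "F' \<subseteq> E" "\<forall>Y. subgroup Y G \<longrightarrow> normalizes G F' Y \<longrightarrow> (\<forall>c\<in>Y. w' c \<in> Y)"
    by blast
  have "\<forall>Y. subgroup Y G \<longrightarrow> normalizes G (F \<union> F') Y \<longrightarrow> (\<forall>c\<in>Y. w c \<otimes> w' c \<in> Y)"
  proof (intro allI impI ballI)
    fix Y c assume Y: "subgroup Y G" "normalizes G (F \<union> F') Y" "c \<in> Y"
    have "normalizes G F Y" "normalizes G F' Y" using Y(2) normalizes_mono by blast+
    then have "w c \<in> Y" "w' c \<in> Y" using F(3) F'(3) Y by blast+
    then show "w c \<otimes> w' c \<in> Y" using Y(1) by (simp add: subgroup.m_closed)
  qed
  then show ?case using F F' by (intro exI[of _ "F \<union> F'"]) simp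
qed

lemma words_carrier:
  assumes "w \<in> words E" "E \<subseteq> carrier G" "c \<in> carrier G" shows "w c \<in> carrier G"
  using assms by induction auto

lemma words_subgroup:
  assumes E: "E \<subseteq> carrier G" and c: "c \<in> carrier G"
  shows "subgroup ((\<lambda>w. w c) ` words E) G"
proof (rule subgroupI)
  show "(\<lambda>w. w c) ` words E \<subseteq> carrier G" using words_carrier[OF _ E c] by auto
  show "(\<lambda>w. w c) ` words E \<noteq> {}" using words.one by blast
qed (auto intro: image_eqI[OF _ words.inv] image_eqI[OF _ words.mult])

lemma words_normalized:
  assumes E: "subgroup E G" and c: "c \<in> carrier G"
  shows "normalizes G E ((\<lambda>w. w c) ` words E)"
proof (rule normalizesI)
  have Ec: "E \<subseteq> carrier G" using E by (simp add: subgroup.subset)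
  fix d x assume d: "d \<in> E" and "x \<in> (\<lambda>w. w c) ` words E"
  then obtain w where w: "w \<in> words E" "x = w c" by blast
  have dc: "d \<in> carrier G" using d Ec by auto
  note sub = words_subgroup[OF Ec c]
  have "d \<otimes> w c \<otimes> inv d \<in> (\<lambda>w. w c) ` words E" using w(1)
  proof induction
    case one
    then show ?case using dc sub by (simp add: subgroup.one_closed)
  next
    case (conj e)
    have "e \<in> carrier G" using conj Ec by auto
    then have "d \<otimes> (e \<otimes> c \<otimes> inv e) \<otimes> inv d = (d \<otimes> e) \<otimes> c \<otimes> inv (d \<otimes> e)"
      using dc c by (simp add: conj_conj)
    moreover have "d \<otimes> e \<in> E" using conj d E by (simp add: subgroup.m_closed)
    ultimately show ?case using words.conj by (intro image_eqI[where x = "\<lambda>c. (d \<otimes> e) \<otimes> c \<otimes> inv (d \<otimes> e)"]) auto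
  next
    case (inv w)
    have "d \<otimes> inv w c \<otimes> inv d = inv (d \<otimes> w c \<otimes> inv d)"
      using inv dc words_carrier[OF _ Ec c] by (simp add: conj_inv)
    then show ?case using inv sub by (simp add: subgroup.m_inv_closed)
  next
    case (mult w w')
    have "d \<otimes> (w c \<otimes> w' c) \<otimes> inv d = (d \<otimes> w c \<otimes> inv d) \<otimes> (d \<otimes> w' c \<otimes> inv d)"
      using mult dc words_carrier[OF _ Ec c] by (simp add: conj_mult)
    then show ?case using mult sub by (simp add: subgroup.m_closed)
  qed
  then show "d \<otimes> x \<otimes> inv d \<in> (\<lambda>w. w c) ` words E" using w by simp
qed

text \<open>For each \<open>c\<close> in the compact set, the values at \<open>c\<close> of the words over \<open>E\<close> form a non-trivial subgroup
normalized by \<open>E\<close>, which is dense; hence some word has its value at \<open>c\<close> in \<open>V\<close>. By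
continuity the same word works near \<open>c\<close>, and by compactness finitely many words suffice. Together these
involve finitely many elements of \<open>E\<close>.\<close>
lemma hitting_one:
  assumes E: "subgroup E G" "dense E" and V: "openin T V" "V \<noteq> {}"
  obtains F where "finite F" "F \<subseteq> E"
    "\<And>Y. subgroup Y G \<Longrightarrow> normalizes G F Y \<Longrightarrow> Y \<inter> moved \<noteq> {} \<Longrightarrow> Y \<inter> V \<noteq> {}"
proof -
  have Ec: "E \<subseteq> carrier G" using E by (simp add: subgroup.subset)
  have "\<exists>w\<in>words E. w c \<in> V" if c: "c \<in> moved" for c
  proof -
    have cc: "c \<in> carrier G" using c moved_carrier by auto
    have "\<one> \<otimes> c \<otimes> inv \<one> \<in> (\<lambda>w. w c) ` words E"
      using words.conj[OF subgroup.one_closed[OF E(1)]] by (rule rev_image_eqI) simp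
    then have "c \<in> (\<lambda>w. w c) ` words E" using cc by simp
    moreover have "c \<noteq> \<one>" using c one_not_moved by blast
    ultimately have "(\<lambda>w. w c) ` words E \<noteq> {\<one>}" by (metis singletonD)
    then have "dense ((\<lambda>w. w c) ` words E)"
      using dense_of_normalized[OF words_subgroup[OF Ec cc] _ words_normalized[OF E(1) cc] E(2) Ec] by blast
    then show ?thesis using V unfolding dense_def by blast
  qed
  then obtain w where w: "\<And>c. c \<in> moved \<Longrightarrow> w c \<in> words E" "\<And>c. c \<in> moved \<Longrightarrow> w c c \<in> V" by metis
  let ?W = "\<lambda>c. {x \<in> carrier G. w c x \<in> V}"
  have "\<forall>B\<in>?W ` moved. openin T B"
    using open_preimage[OF words_continuous[OF w(1) Ec] V(1)] by blast
  moreover have "moved \<subseteq> \<Union>(?W ` moved)" using w(2) moved_carrier by blast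
  ultimately obtain \<F> where \<F>: "finite \<F>" "\<F> \<subseteq> ?W ` moved" "moved \<subseteq> \<Union>\<F>"
    using moved_compact unfolding compactin_def by meson
  obtain C where C: "C \<subseteq> moved" "finite C" "\<F> = ?W ` C" using finite_subset_image[OF \<F>(1,2)] by blast
  have "\<forall>c\<in>C. \<exists>F. finite F \<and> F \<subseteq> E \<and> (\<forall>Y. subgroup Y G \<longrightarrow> normalizes G F Y \<longrightarrow> (\<forall>x\<in>Y. w c x \<in> Y))"
    using words_finite[OF w(1)] C(1) by blast
  then obtain F where F: "\<forall>c\<in>C. finite (F c) \<and> F c \<subseteq> E \<and> 
      (\<forall>Y. subgroup Y G \<longrightarrow> normalizes G (F c) Y \<longrightarrow> (\<forall>x\<in>Y. w c x \<in> Y))" by metis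
  show ?thesis
  proof (rule that[of "\<Union>(F ` C)"])
    show "finite (\<Union>(F ` C))" "\<Union>(F ` C) \<subseteq> E" using F C by auto
    fix Y assume Y: "subgroup Y G" "normalizes G (\<Union>(F ` C)) Y" "Y \<inter> moved \<noteq> {}"
    then obtain x where x: "x \<in> Y" "x \<in> moved" by blast
    then obtain c where c: "c \<in> C" "w c x \<in> V" using \<F>(3) C(3) by blast
    have "normalizes G (F c) Y" using normalizes_mono[OF Y(2)] c by blast
    then have "w c x \<in> Y" using F c x Y(1) by blast
    then show "Y \<inter> V \<noteq> {}" using c by blast
  qed
qed

lemma hitting:
  assumes E: "subgroup E G" "dense E" and \<V>: "finite \<V>" "\<And>V. V \<in> \<V> \<Longrightarrow> openin T V \<and> V \<noteq> {}"
  obtains F where "finite F" "F \<subseteq> E"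
    "\<And>Y V. subgroup Y G \<Longrightarrow> normalizes G F Y \<Longrightarrow> Y \<inter> moved \<noteq> {} \<Longrightarrow> V \<in> \<V> \<Longrightarrow> Y \<inter> V \<noteq> {}"
proof -
  have "\<forall>V\<in>\<V>. \<exists>F. finite F \<and> F \<subseteq> E \<and>
    (\<forall>Y. subgroup Y G \<longrightarrow> normalizes G F Y \<longrightarrow> Y \<inter> moved \<noteq> {} \<longrightarrow> Y \<inter> V \<noteq> {})"
  proof
    fix V assume "V \<in> \<V>"
    then have V: "openin T V" "V \<noteq> {}" using \<V> by auto
    show "\<exists>F. finite F \<and> F \<subseteq> E \<and>
      (\<forall>Y. subgroup Y G \<longrightarrow> normalizes G F Y \<longrightarrow> Y \<inter> moved \<noteq> {} \<longrightarrow> Y \<inter> V \<noteq> {})"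
      by (rule hitting_one[OF E V]) blast
  qed
  then obtain F where F: "\<forall>V\<in>\<V>. finite (F V) \<and> F V \<subseteq> E \<and>
    (\<forall>Y. subgroup Y G \<longrightarrow> normalizes G (F V) Y \<longrightarrow> Y \<inter> moved \<noteq> {} \<longrightarrow> Y \<inter> V \<noteq> {})" by metis
  show ?thesis
  proof (rule that[of "\<Union>(F ` \<V>)"])
    show "finite (\<Union>(F ` \<V>))" "\<Union>(F ` \<V>) \<subseteq> E" using F \<V> by auto
    fix Y V assume Y: "subgroup Y G" "normalizes G (\<Union>(F ` \<V>)) Y" "Y \<inter> moved \<noteq> {}" "V \<in> \<V>"
    have "normalizes G (F V) Y" using normalizes_mono[OF Y(2)] Y(4) by blast
    then show "Y \<inter> V \<noteq> {}" using F Y by blast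
  qed
qed

end

context expansive_simple_group begin

text \<open>The conjugates of \<open>L\<close> under \<open>U\<close> generate a subgroup of \<open>U\<close> that is normalized by \<open>U\<close>. It is also normalized
by each \<open>n s\<close>, because \<open>L\<close> is normalized by the conjugates of \<open>n s\<close> under \<open>U\<close>; hence by \<open>s\<close>. So
expansiveness applies to it although \<open>L\<close> itself need not be normalized by \<open>U\<close>.\<close>
lemma invariant_trivial:
  assumes L: "subgroup L G" "L \<subseteq> U"
    and n: "\<And>s. s \<in> S \<Longrightarrow> n s \<in> carrier G" "\<And>s. s \<in> S \<Longrightarrow> inv s \<otimes> n s \<in> U"
    and inv: "\<And>s u x. s \<in> S \<Longrightarrow> u \<in> U \<Longrightarrow> x \<in> L \<Longrightarrow>
      (u \<otimes> n s \<otimes> inv u) \<otimes> x \<otimes> inv (u \<otimes> n s \<otimes> inv u) \<in> L"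
  shows "L = {\<one>}"
proof -
  define K where "K = {u \<otimes> x \<otimes> inv u |u x. u \<in> U \<and> x \<in> L}"
  have Lc: "L \<subseteq> carrier G" using L by (simp add: subgroup.subset)
  have KU: "K \<subseteq> U" using L U(1) by (auto simp: K_def subgroup.m_closed subgroup.m_inv_closed subset_iff)
  have Kc: "K \<subseteq> carrier G" using KU U_carrier by auto
  have nU: "normalizes G U K"
  proof (rule normalizesI)
    fix v k assume v: "v \<in> U" and "k \<in> K"
    then obtain u x where ux: "u \<in> U" "x \<in> L" "k = u \<otimes> x \<otimes> inv u" by (auto simp: K_def)
    have "v \<otimes> k \<otimes> inv v = (v \<otimes> u) \<otimes> x \<otimes> inv (v \<otimes> u)"
      using ux v U_carrier Lc by (simp add: conj_conj subset_iff)
    moreover have "v \<otimes> u \<in> U" using ux v U(1) by (simp add: subgroup.m_closed)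
    ultimately show "v \<otimes> k \<otimes> inv v \<in> K" using ux unfolding K_def by blast
  qed
  have nn: "normalizes G {n s} K" if s: "s \<in> S" for s
  proof (rule normalizesI)
    fix m k assume m: "m \<in> {n s}" and "k \<in> K"
    then obtain u x where ux: "u \<in> U" "x \<in> L" "k = u \<otimes> x \<otimes> inv u" by (auto simp: K_def)
    have c: "u \<in> carrier G" "x \<in> carrier G" "n s \<in> carrier G"
      using ux U_carrier Lc n(1)[OF s] by auto
    \<comment> \<open>Conjugating by \<open>n s\<close> after \<open>u\<close> is conjugating by \<open>u\<close> after a conjugate of \<open>n s\<close>.\<close>
    let ?g = "inv u \<otimes> n s \<otimes> inv (inv u)"
    have "?g \<otimes> x \<otimes> inv ?g \<in> L" using inv[OF s _ ux(2)] ux(1) U(1) by (simp add: subgroup.m_inv_closed)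
    moreover have "n s \<otimes> k \<otimes> inv (n s) = u \<otimes> (?g \<otimes> x \<otimes> inv ?g) \<otimes> inv u"
      using c ux by (simp add: m_assoc inv_mult_group)
    ultimately show "m \<otimes> k \<otimes> inv m \<in> K" using ux(1) m unfolding K_def by blast
  qed
  have "generate G K = {\<one>}"
  proof (rule expansive)
    show "subgroup (generate G K) G" using generate_is_subgroup[OF Kc] .
    show sub: "generate G K \<subseteq> U" using generate_subgroup_incl[OF KU U(1)] .
    show gU: "normalizes G U (generate G K)" using generate_normalized[OF Kc U_carrier nU] .
    show "normalizes G S (generate G K)"
    proof (rule normalizesI)
      fix s x assume s: "s \<in> S" and x: "x \<in> generate G K"
      have gn: "normalizes G {n s} (generate G K)"
        using generate_normalized[OF Kc _ nn[OF s]] n(1)[OF s] by simp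
      have c: "s \<in> carrier G" "n s \<in> carrier G" "x \<in> carrier G"
        using s S n(1) x sub U_carrier by auto
      have "inv (inv s \<otimes> n s) \<in> U" using n(2)[OF s] U(1) by (simp add: subgroup.m_inv_closed)
      then have v: "inv (n s) \<otimes> s \<in> U" using c by (simp add: inv_mult_group)
      have "n s \<otimes> ((inv (n s) \<otimes> s) \<otimes> x \<otimes> inv (inv (n s) \<otimes> s)) \<otimes> inv (n s) \<in> generate G K"
        using normalizesD[OF gn _ normalizesD[OF gU v x]] by simp
      moreover have "n s \<otimes> ((inv (n s) \<otimes> s) \<otimes> x \<otimes> inv (inv (n s) \<otimes> s)) \<otimes> inv (n s) = s \<otimes> x \<otimes> inv s"
        using c by (simp add: m_assoc inv_mult_group)
      ultimately show "s \<otimes> x \<otimes> inv s \<in> generate G K" by simp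
    qed
  qed
  moreover have "L \<subseteq> K"
  proof
    fix x assume x: "x \<in> L"
    then have "x = \<one> \<otimes> x \<otimes> inv \<one>" using Lc by auto
    then show "x \<in> K" using x subgroup.one_closed[OF U(1)] unfolding K_def by blast
  qed
  ultimately have "L \<subseteq> {\<one>}" using subset_generate[of K G] by simp
  then show ?thesis using subgroup.one_closed[OF L(1)] by blast
qed

text \<open>Otherwise conjugation by the conjugates under \<open>U\<close> of spanning elements would keep \<open>Y \<inter> U\<close> inside \<open>U\<close>,
and the preceding lemma would make it trivial.\<close>
lemma meets_moved:
  assumes N: "N \<subseteq> carrier G" "normalizes G U N" "spans N"
    and Y: "subgroup Y G" "normalizes G N Y" "Y \<inter> U \<noteq> {\<one>}"
  shows "Y \<inter> moved \<noteq> {}"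
proof
  assume empty: "Y \<inter> moved = {}"
  obtain n where n: "\<And>s. s \<in> S \<Longrightarrow> n s \<in> N" "\<And>s. s \<in> S \<Longrightarrow> inv s \<otimes> n s \<in> U"
    using N(3) unfolding spans_def by metis
  have "Y \<inter> U = {\<one>}"
  proof (rule invariant_trivial)
    show "subgroup (Y \<inter> U) G" using subgroups_Inter_pair Y(1) U(1) .
    show "Y \<inter> U \<subseteq> U" by blast
    show "n s \<in> carrier G" "inv s \<otimes> n s \<in> U" if "s \<in> S" for s using n that N(1) by auto
    fix s u x assume s: "s \<in> S" and u: "u \<in> U" and x: "x \<in> Y \<inter> U"
    let ?g = "u \<otimes> n s \<otimes> inv u"
    have "?g \<in> N" using normalizesD[OF N(2) u n(1)[OF s]] .
    then have gY: "?g \<otimes> x \<otimes> inv ?g \<in> Y" using normalizesD[OF Y(2)] x by simp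
    have c: "s \<in> carrier G" "n s \<in> carrier G" "u \<in> carrier G" "x \<in> carrier G"
      using s S n(1) N(1) u x U_carrier by auto
    \<comment> \<open>This choice gives \<open>?g = u \<otimes> s \<otimes> w\<close>, so \<open>?g\<close> conjugates \<open>x\<close> to the \<open>u\<close>-conjugate of \<open>z\<close>.\<close>
    define w where "w = inv s \<otimes> n s \<otimes> inv u"
    have w: "w \<in> U" using n(2)[OF s] u U(1) by (simp add: w_def subgroup.m_closed subgroup.m_inv_closed)
    have wx: "w \<otimes> x \<otimes> inv w \<in> U" using w x U(1) by (simp add: subgroup.m_closed subgroup.m_inv_closed)
    define z where "z = s \<otimes> (w \<otimes> x \<otimes> inv w) \<otimes> inv s"
    have eq: "?g \<otimes> x \<otimes> inv ?g = u \<otimes> z \<otimes> inv u"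
      using c by (simp add: z_def w_def m_assoc inv_mult_group)
    have "z \<in> U"
    proof (rule ccontr)
      assume "z \<notin> U"
      then have "z \<in> {s \<otimes> w \<otimes> inv s |s w. s \<in> S \<and> w \<in> U} - U" using s wx z_def by blast
      then have "u \<otimes> z \<otimes> inv u \<in> moved" using u unfolding moved_def by blast
      then show False using gY eq empty by auto
    qed
    then have "u \<otimes> z \<otimes> inv u \<in> U" using u U(1) by (simp add: subgroup.m_closed subgroup.m_inv_closed)
    then show "?g \<otimes> x \<otimes> inv ?g \<in> Y \<inter> U" using gY eq by simp
  qed
  then show False using Y(3) by simp
qed

text \<open>The two uses of \<open>hitting\<close> in one condition: subgroups normalized by \<open>F\<close> that meet the compact set span,
and no two of them commute (in particular none of them is abelian).\<close>
definition hits :: "'a set \<Rightarrow> bool" where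
  "hits F \<longleftrightarrow> (\<forall>Y Z. subgroup Y G \<longrightarrow> normalizes G F Y \<longrightarrow> Y \<inter> moved \<noteq> {} \<longrightarrow>
     subgroup Z G \<longrightarrow> normalizes G F Z \<longrightarrow> Z \<inter> moved \<noteq> {} \<longrightarrow>
     spans Y \<and> (\<exists>y\<in>Y. \<exists>z\<in>Z. y \<otimes> z \<noteq> z \<otimes> y))"

text \<open>If the group were abelian, \<open>U\<close> would be normalized by \<open>S\<close>, hence trivial, and the group discrete.\<close>
lemma noncommuting:
  obtains V W where "openin T V" "openin T W" "V \<noteq> {}" "W \<noteq> {}"
    "\<And>x y. x \<in> V \<Longrightarrow> y \<in> W \<Longrightarrow> x \<otimes> y \<noteq> y \<otimes> x"
proof -
  have "\<exists>a\<in>carrier G. \<exists>b\<in>carrier G. a \<otimes> b \<noteq> b \<otimes> a"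
  proof (rule ccontr)
    assume "\<not> ?thesis"
    then have comm: "a \<otimes> b = b \<otimes> a" if "a \<in> carrier G" "b \<in> carrier G" for a b using that by blast
    have "normalizes G S U"
    proof (rule normalizesI)
      fix s x assume sx: "s \<in> S" "x \<in> U"
      have c: "s \<in> carrier G" "x \<in> carrier G" using sx S U_carrier by auto
      have "s \<otimes> x \<otimes> inv s = x \<otimes> s \<otimes> inv s" using comm[OF c] by simp
      then show "s \<otimes> x \<otimes> inv s \<in> U" using c sx by (simp add: m_assoc)
    qed
    then have "U = {\<one>}" using expansive U normalizes_self by blast
    then show False using U(3) nondiscrete by simp
  qed
  then obtain a b where ab: "a \<in> carrier G" "b \<in> carrier G" "a \<otimes> b \<noteq> b \<otimes> a" by blast
  let ?f = "\<lambda>p. (fst p \<otimes> snd p) \<otimes> inv (snd p \<otimes> fst p)"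
  have f: "continuous_map (prod_topology T T) T ?f" by (intro continuous_intro)
  have "openin T (topspace T - {\<one>})" using closed_one by blast
  then have o: "openin (prod_topology T T) {p \<in> topspace (prod_topology T T). ?f p \<in> topspace T - {\<one>}}"
    (is "openin _ ?O") by (rule openin_continuous_map_preimage[OF f])
  have ne: "(x \<otimes> y) \<otimes> inv (y \<otimes> x) = \<one> \<longleftrightarrow> x \<otimes> y = y \<otimes> x" if "x \<in> carrier G" "y \<in> carrier G" for x y
    using that inv_equality[of "x \<otimes> y" "inv (y \<otimes> x)"] by (metis inv_closed inv_inv m_closed r_inv)
  have "(a, b) \<in> ?O" using ab ne by simp
  then obtain V W where VW: "openin T V" "openin T W" "a \<in> V" "b \<in> W" "V \<times> W \<subseteq> ?O"
    using o unfolding openin_prod_topology_alt by meson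
  have "x \<otimes> y \<noteq> y \<otimes> x" if xy: "x \<in> V" "y \<in> W" for x y
  proof -
    have "(x, y) \<in> ?O" using VW(5) xy by blast
    then show ?thesis using ne by auto
  qed
  then show ?thesis using that VW by blast
qed

lemma hits_ex:
  assumes E: "subgroup E G" "dense E"
  obtains F where "finite F" "F \<subseteq> E" "hits F"
proof -
  obtain V W where VW: "openin T V" "openin T W" "V \<noteq> {}" "W \<noteq> {}"
    "\<And>x y. x \<in> V \<Longrightarrow> y \<in> W \<Longrightarrow> x \<otimes> y \<noteq> y \<otimes> x"
    by (rule noncommuting) (blast intro: that)
  let ?P = "\<lambda>s. {x \<in> carrier G. inv s \<otimes> x \<in> U}"
  have P: "openin T (?P s) \<and> ?P s \<noteq> {}" if "s \<in> S" for s
  proof -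
    have sc: "s \<in> carrier G" using that S by auto
    have "openin T (?P s)" using sc by (intro open_preimage continuous_intro U(3)) auto
    moreover have "s \<in> ?P s" using sc subgroup.one_closed[OF U(1)] by simp
    ultimately show ?thesis by blast
  qed
  obtain F where F: "finite F" "F \<subseteq> E"
    "\<And>Y V'. subgroup Y G \<Longrightarrow> normalizes G F Y \<Longrightarrow> Y \<inter> moved \<noteq> {} \<Longrightarrow> V' \<in> insert V (insert W (?P ` S)) \<Longrightarrow> Y \<inter> V' \<noteq> {}"
  proof (rule hitting[OF E, of "insert V (insert W (?P ` S))"])
    show "finite (insert V (insert W (?P ` S)))" using S by simp
    show "openin T V' \<and> V' \<noteq> {}" if "V' \<in> insert V (insert W (?P ` S))" for V'
      using that VW P by auto
  qed blast
  have "hits F"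
    unfolding hits_def
  proof (intro allI impI conjI)
    fix Y Z assume Y: "subgroup Y G" "normalizes G F Y" "Y \<inter> moved \<noteq> {}"
      and Z: "subgroup Z G" "normalizes G F Z" "Z \<inter> moved \<noteq> {}"
    show "spans Y"
      unfolding spans_def
    proof
      fix s assume "s \<in> S"
      then have "Y \<inter> ?P s \<noteq> {}" using F(3)[OF Y] by simp
      then show "\<exists>n\<in>Y. inv s \<otimes> n \<in> U" by blast
    qed
    have "Y \<inter> V \<noteq> {}" "Z \<inter> W \<noteq> {}" using F(3)[OF Y, of V] F(3)[OF Z, of W] by simp_all
    then show "\<exists>y\<in>Y. \<exists>z\<in>Z. y \<otimes> z \<noteq> z \<otimes> y" using VW(5) by blast
  qed
  then show ?thesis using that F by blast
qed

text \<open>Spanning elements \<open>n s\<close> with open centralizer centralize a common open subgroup of \<open>N \<inter> U\<close>, which can be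
made invariant under \<open>U\<close>. It is then normalized by \<open>S\<close>, so it is trivial.\<close>
lemma quasi_centre_spans:
  assumes N: "subgroup N G" "normalizes G U N" and sp: "spans (quasi_centre N)"
  obtains V where "openin T V" "\<one> \<in> V" "N \<inter> V \<subseteq> {\<one>}"
proof -
  obtain n where n: "\<And>s. s \<in> S \<Longrightarrow> n s \<in> quasi_centre N" "\<And>s. s \<in> S \<Longrightarrow> inv s \<otimes> n s \<in> U"
    using sp unfolding spans_def by metis
  have Nc: "N \<subseteq> carrier G" using N by (simp add: subgroup.subset)
  have nN: "n s \<in> N" if "s \<in> S" for s using n(1)[OF that] by (simp add: quasi_centre_def)
  define Q where "Q = N \<inter> U"
  have Q: "subgroup Q G" "Q \<subseteq> U" "normalizes G U Q"
    using N U normalizes_self by (auto simp: Q_def subgroups_Inter_pair normalizes_Int)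
  define W where "W = {x \<in> Q. \<forall>s\<in>S. x \<otimes> n s = n s \<otimes> x}"
  have Qc: "Q \<subseteq> carrier G" using Q U_carrier by auto
  have nc: "n s \<in> carrier G" if "s \<in> S" for s using nN[OF that] Nc by auto
  have W: "subgroup W G"
  proof (rule subgroupI)
    show "W \<noteq> {}" using subgroup.one_closed[OF Q(1)] nc by (auto simp: W_def intro!: exI[of _ "\<one>"])
    show "inv a \<in> W" if "a \<in> W" for a
    proof -
      have "n s \<otimes> inv a = inv a \<otimes> n s" if "s \<in> S" for s
        using commute_inv[of "n s" a] \<open>a \<in> W\<close> that nc Qc by (auto simp: W_def)
      then show ?thesis using that Q(1) by (simp add: W_def subgroup.m_inv_closed)
    qed
    show "a \<otimes> b \<in> W" if "a \<in> W" "b \<in> W" for a b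
    proof -
      have "n s \<otimes> (a \<otimes> b) = (a \<otimes> b) \<otimes> n s" if "s \<in> S" for s
        using commute_mult[of "n s" a b] \<open>a \<in> W\<close> \<open>b \<in> W\<close> that nc Qc by (auto simp: W_def)
      then show ?thesis using that Q(1) by (simp add: W_def subgroup.m_closed)
    qed
  qed (use Qc in \<open>auto simp: W_def\<close>)
  have "\<forall>s\<in>S. \<exists>V. openin T V \<and> \<one> \<in> V \<and> (\<forall>x\<in>V \<inter> N. x \<otimes> n s = n s \<otimes> x)"
    using n(1) by (auto simp: quasi_centre_def)
  then obtain V where V: "\<forall>s\<in>S. openin T (V s) \<and> \<one> \<in> V s \<and> (\<forall>x\<in>V s \<inter> N. x \<otimes> n s = n s \<otimes> x)"
    by metis
  define V0 where "V0 = carrier G \<inter> \<Inter>(V ` S)"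
  have V0: "openin T V0" "\<one> \<in> V0"
  proof -
    have "openin T (\<Inter>(insert (topspace T) (V ` S)))" using V S(1) openin_topspace[of T] by (intro openin_Inter) auto
    then show "openin T V0" by (simp add: V0_def)
    show "\<one> \<in> V0" using V by (auto simp: V0_def)
  qed
  have "V0 \<inter> Q \<subseteq> W" using V by (auto simp: W_def V0_def Q_def)
  then have oW: "openin (subtopology T Q) W" 
    using open_subgroup[OF Q(1) W _ V0] by (auto simp: W_def)
  have WQ: "W \<subseteq> Q" by (auto simp: W_def)
  define L where "L = {x \<in> Q. \<forall>v\<in>U. v \<otimes> x \<otimes> inv v \<in> W}"
  note L = invariant_core[OF Q(1) W WQ oW U(1,2) Q(3), folded L_def]
  have "L = {\<one>}"
  proof (rule expansive[OF L(1) _ L(4)])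
    show "L \<subseteq> U" using L(3) WQ Q(2) by blast
    show "normalizes G S L"
    proof (rule normalizesI)
      fix s x assume s: "s \<in> S" and x: "x \<in> L"
      have c: "s \<in> carrier G" "n s \<in> carrier G" "x \<in> carrier G"
        using s S nc x L(3) WQ Qc by auto
      have "inv (inv s \<otimes> n s) \<in> U" using n(2)[OF s] U(1) by (simp add: subgroup.m_inv_closed)
      then have v: "inv (n s) \<otimes> s \<in> U" using c by (simp add: inv_mult_group)
      define y where "y = (inv (n s) \<otimes> s) \<otimes> x \<otimes> inv (inv (n s) \<otimes> s)"
      have y: "y \<in> L" using normalizesD[OF L(4) v x] by (simp add: y_def)
      then have yc: "y \<in> carrier G" and "y \<otimes> n s = n s \<otimes> y" using L(3) WQ Qc s by (auto simp: W_def)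
      then have "n s \<otimes> y \<otimes> inv (n s) = y \<otimes> n s \<otimes> inv (n s)" by simp
      then have "n s \<otimes> y \<otimes> inv (n s) = y" using c yc by (simp add: m_assoc)
      moreover have "n s \<otimes> y \<otimes> inv (n s) = s \<otimes> x \<otimes> inv s"
        using c by (simp add: y_def m_assoc inv_mult_group)
      ultimately show "s \<otimes> x \<otimes> inv s \<in> L" using y by simp
    qed
  qed
  then obtain V1 where V1: "openin T V1" "\<one> \<in> V1" "V1 \<inter> Q \<subseteq> {\<one>}"
    using open_nbhd[OF L(2)] by auto
  show ?thesis
    by (rule that[of "V1 \<inter> U"]) (use V1 U in \<open>auto simp: Q_def subgroup.one_closed\<close>)
qed

lemma quasi_centre_carrier: "quasi_centre (carrier G) = {\<one>}"
proof (rule ccontr)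
  assume ne: "quasi_centre (carrier G) \<noteq> {\<one>}"
  have n: "normalizes G A (carrier G)" if "A \<subseteq> carrier G" for A 
    using that by (auto simp: normalizes_def)
  have "dense (quasi_centre (carrier G))"
    using dense_of_normalized[OF quasi_centre_subgroup[OF subgroup_self] ne 
      quasi_centre_normalized[OF subgroup_self subgroup_self n] dense_carrier] by simp
  then obtain V where V: "openin T V" "\<one> \<in> V" "carrier G \<inter> V \<subseteq> {\<one>}"
    using quasi_centre_spans[OF subgroup_self n[OF U_carrier] dense_spans] by blast
  then have "V = {\<one>}" using open_carrier by blast
  then show False using V nondiscrete by simp
qed

text \<open>The subgroups to which the search for a smallest closed normal subgroup applies. Triviality of the
quasi-centre rules out non-trivial discrete normal subgroups.\<close>
definition ample :: "'a set \<Rightarrow> bool" where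
  "ample N \<longleftrightarrow> subgroup N G \<and> closedin T N \<and> N \<noteq> {\<one>} \<and> normalizes G U N \<and> spans N \<and>
     quasi_centre N = {\<one>}"

lemma ample_meets:
  assumes N: "ample N" and Y: "Y \<in> closed_normals N"
  shows "Y \<inter> U \<noteq> {\<one>}" "Y \<inter> moved \<noteq> {}"
proof -
  show YU: "Y \<inter> U \<noteq> {\<one>}"
  proof
    assume "Y \<inter> U = {\<one>}"
    then have "Y \<subseteq> quasi_centre N"
      using discrete_normal_quasi_central[of N Y U] N Y U(3) subgroup.one_closed[OF U(1)]
      by (auto simp: ample_def closed_normals_def)
    then show False using N Y subgroup.one_closed unfolding ample_def closed_normals_def by blast
  qed
  show "Y \<inter> moved \<noteq> {}"
    by (rule meets_moved[of N]) (use N Y YU in \<open>auto simp: ample_def closed_normals_def subgroup.subset\<close>)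
qed

text \<open>Any two non-trivial closed normal subgroups fail to commute, so they contain a non-trivial commutator in their
intersection. All of them meet the compact set, so by compactness their total intersection does
too.\<close>
lemma ample_monolith:
  assumes N: "ample N" and F: "F \<subseteq> N" "hits F"
  shows "\<Inter>(closed_normals N) \<in> closed_normals N" "\<And>Y. Y \<in> closed_normals N \<Longrightarrow> spans Y"
proof -
  have Nsub: "subgroup N G" "closedin T N" "N \<noteq> {\<one>}" using N by (auto simp: ample_def)
  have NN: "N \<in> closed_normals N" using Nsub normalizes_self by (simp add: closed_normals_def)
  have *: "subgroup Y G" "normalizes G F Y" "Y \<inter> moved \<noteq> {}" if "Y \<in> closed_normals N" for Y
    using that ample_meets[OF N that] F normalizes_mono by (auto simp: closed_normals_def)
  show "spans Y" if "Y \<in> closed_normals N" for Y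
    using F(2) *[OF that] unfolding hits_def by blast
  have int: "Y \<inter> Z \<in> closed_normals N" if Y: "Y \<in> closed_normals N" and Z: "Z \<in> closed_normals N" for Y Z
  proof -
    obtain y z where yz: "y \<in> Y" "z \<in> Z" "y \<otimes> z \<noteq> z \<otimes> y"
      using F(2) *[OF Y] *[OF Z] unfolding hits_def by blast
    have sY: "subgroup Y G" "Y \<subseteq> N" "normalizes G N Y" and sZ: "subgroup Z G" "Z \<subseteq> N" "normalizes G N Z"
      using Y Z by (auto simp: closed_normals_def)
    have c: "y \<in> carrier G" "z \<in> carrier G" using yz sY sZ by (auto simp: subgroup.mem_carrier)
    let ?c = "y \<otimes> z \<otimes> inv y \<otimes> inv z"
    have "?c \<in> Z" using normalizesD[OF sZ(3) _ yz(2), of y] yz sY sZ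
      by (auto simp: subgroup.m_closed subgroup.m_inv_closed)
    moreover have "y \<otimes> (z \<otimes> inv y \<otimes> inv z) \<in> Y" 
      using normalizesD[OF sY(3) _ subgroup.m_inv_closed[OF sY(1) yz(1)], of z] yz sY sZ
      by (auto simp: subgroup.m_closed)
    then have "?c \<in> Y" using c by (simp add: m_assoc)
    moreover have "?c \<noteq> \<one>"
    proof
      assume "?c = \<one>"
      then have "y \<otimes> z = z \<otimes> y" 
      proof -
        have "?c \<otimes> z \<otimes> y = y \<otimes> z" using c by (simp add: m_assoc)
        then show ?thesis using c \<open>?c = \<one>\<close> by simp
      qed
      then show False using yz by simp
    qed
    ultimately have "Y \<inter> Z \<noteq> {\<one>}" by blast
    then show ?thesis using Y Z
      by (auto simp: closed_normals_def subgroups_Inter_pair normalizes_Int)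
  qed
  have "\<Inter>(closed_normals N) \<inter> moved \<noteq> {}"
  proof
    assume "\<Inter>(closed_normals N) \<inter> moved = {}"
    then have "moved \<subseteq> \<Union>((\<lambda>Y. topspace T - Y) ` closed_normals N)" using moved_carrier by auto
    moreover have "\<forall>B\<in>(\<lambda>Y. topspace T - Y) ` closed_normals N. openin T B"
      by (auto simp: closed_normals_def closedin_def)
    ultimately obtain \<F> where \<F>: "finite \<F>" "\<F> \<subseteq> (\<lambda>Y. topspace T - Y) ` closed_normals N" "moved \<subseteq> \<Union>\<F>"
      using moved_compact unfolding compactin_def by meson
    have "\<exists>Y\<in>closed_normals N. Y \<inter> \<Union>\<F> = {}" using \<F>(1,2)
    proof (induction rule: finite_induct)
      case empty then show ?case using NN by auto
    next
      case (insert B \<F>)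
      then obtain Y where Y: "Y \<in> closed_normals N" "Y \<inter> \<Union>\<F> = {}" by auto
      obtain Z where Z: "Z \<in> closed_normals N" "B = topspace T - Z" using insert.prems by auto
      have "(Y \<inter> Z) \<inter> \<Union>(insert B \<F>) = {}" using Y Z by auto
      then show ?case using int[OF Y(1) Z(1)] by blast
    qed
    then obtain Y where "Y \<in> closed_normals N" "Y \<inter> \<Union>\<F> = {}" by blast
    then show False using *(3) \<F>(3) by blast
  qed
  then have ne: "\<Inter>(closed_normals N) \<noteq> {\<one>}" using one_not_moved by auto
  have "subgroup (\<Inter>(closed_normals N)) G" 
    by (rule subgroups_Inter) (use NN in \<open>auto simp: closed_normals_def\<close>)
  moreover have "closedin T (\<Inter>(closed_normals N))"
    by (rule closedin_Inter) (use NN in \<open>auto simp: closed_normals_def\<close>)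
  moreover have "normalizes G N (\<Inter>(closed_normals N))"
    by (auto simp: normalizes_def closed_normals_def)
  ultimately show "\<Inter>(closed_normals N) \<in> closed_normals N"
    using ne NN unfolding closed_normals_def by blast
qed

text \<open>The group generated by \<open>U\<close> and a large finite set is ample, and its smallest non-trivial closed normal
subgroup grows with the finite set. The union of these smallest subgroups is normal in the whole group,
so it is dense, and a finite set \<open>FB\<close> with \<open>hits FB\<close> can be taken from it. The subgroup \<open>N\<close> sought is the
smallest normal subgroup of a group \<open>Q\<close> so large that \<open>N\<close> contains \<open>FB\<close>.\<close>
lemma smaller_expansive_simple:
  obtains Q N where "subgroup Q G" "openin T Q" "cpt_generated G T Q" "N \<subseteq> residual G T Q"
    "expansive_simple G T N"
proof -
  obtain FA where FA: "finite FA" "FA \<subseteq> carrier G" "hits FA"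
    using hits_ex[OF subgroup_self dense_carrier] by blast
  define gen where "gen F = generate G (U \<union> F)" for F
  define good where "good F \<longleftrightarrow> finite F \<and> S \<union> FA \<subseteq> F \<and> F \<subseteq> carrier G" for F
  have gen: "subgroup (gen F) G" "openin T (gen F)" "closedin T (gen F)" "U \<subseteq> gen F" "F \<subseteq> gen F"
    if "good F" for F
  proof -
    have c: "U \<union> F \<subseteq> carrier G" using that U_carrier by (auto simp: good_def)
    show s: "subgroup (gen F) G" using generate_is_subgroup[OF c] by (simp add: gen_def)
    show u: "U \<subseteq> gen F" "F \<subseteq> gen F" using subset_generate[of "U \<union> F" G] by (auto simp: gen_def)
    show "openin T (gen F)" "closedin T (gen F)"
      using open_subgroup_of_nbhd[OF s U(3) subgroup.one_closed[OF U(1)] u(1)] by auto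
  qed
  have ample_gen: "ample (gen F)" if F: "good F" for F
    unfolding ample_def
  proof (intro conjI)
    show "gen F \<noteq> {\<one>}" using gen(2)[OF F] nondiscrete by auto
    show "normalizes G U (gen F)"
      using normalizes_mono[OF normalizes_self[OF gen(1)[OF F]] gen(4)[OF F]] .
    show "spans (gen F)"
      unfolding spans_def
    proof
      fix s assume s: "s \<in> S"
      then have "s \<in> gen F" using F gen(5)[OF F] by (auto simp: good_def)
      moreover have "inv s \<otimes> s \<in> U" using s S subgroup.one_closed[OF U(1)] by auto
      ultimately show "\<exists>n\<in>gen F. inv s \<otimes> n \<in> U" by blast
    qed
    have "quasi_centre (gen F) \<subseteq> quasi_centre (carrier G)"
    proof
      fix g assume "g \<in> quasi_centre (gen F)"
      then obtain V where V: "g \<in> gen F" "openin T V" "\<one> \<in> V" "\<forall>x\<in>V \<inter> gen F. x \<otimes> g = g \<otimes> x"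
        by (auto simp: quasi_centre_def)
      have "openin T (V \<inter> gen F)" using V(2) gen(2)[OF F] by blast
      moreover have "\<one> \<in> V \<inter> gen F" using V(3) subgroup.one_closed[OF gen(1)[OF F]] by blast
      moreover have "g \<in> carrier G" using V(1) subgroup.subset[OF gen(1)[OF F]] by blast
      moreover have "\<forall>x\<in>(V \<inter> gen F) \<inter> carrier G. x \<otimes> g = g \<otimes> x" using V(4) by blast
      ultimately show "g \<in> quasi_centre (carrier G)" unfolding quasi_centre_def by blast
    qed
    then show "quasi_centre (gen F) = {\<one>}"
      using quasi_centre_carrier subgroup.one_closed[OF quasi_centre_subgroup[OF gen(1)[OF F]]] by blast
  qed (use gen[OF F] in auto)
  define J where "J F = \<Inter>(closed_normals (gen F))" for F
  have J: "J F \<in> closed_normals (gen F)" "spans (J F)" if F: "good F" for F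
  proof -
    have "FA \<subseteq> gen F" using gen(5)[OF F] F by (auto simp: good_def)
    note m = ample_monolith[OF ample_gen[OF F] this FA(3)]
    show "J F \<in> closed_normals (gen F)" using m(1) by (simp add: J_def)
    then show "spans (J F)" using m(2) by blast
  qed
  have J': "subgroup (J F) G" "closedin T (J F)" "J F \<subseteq> gen F" "normalizes G (gen F) (J F)" "J F \<noteq> {\<one>}"
    if "good F" for F using J(1)[OF that] by (auto simp: closed_normals_def)
  have J_least: "J F \<subseteq> Y" if "Y \<in> closed_normals (gen F)" for F Y using that by (auto simp: J_def)
  have J_mono: "J F \<subseteq> J F'" if F: "good F" "good F'" "F \<subseteq> F'" for F F'
  proof -
    have "gen F \<subseteq> gen F'" unfolding gen_def using F(3) by (intro mono_generate) auto
    then have n: "normalizes G (gen F) (J F' \<inter> gen F)"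
      using normalizes_mono[OF J'(4)[OF F(2)]] normalizes_self[OF gen(1)[OF F(1)]]
      by (intro normalizes_Int) auto
    have "J F' \<inter> U \<noteq> {\<one>}" using ample_meets(1)[OF ample_gen[OF F(2)] J(1)[OF F(2)]] .
    moreover have "\<one> \<in> J F' \<inter> U" using subgroup.one_closed J'(1)[OF F(2)] U(1) by blast
    ultimately have "J F' \<inter> gen F \<noteq> {\<one>}" using gen(4)[OF F(1)] by blast
    then have "J F' \<inter> gen F \<in> closed_normals (gen F)"
      using n J'(1,2)[OF F(2)] gen(1,3)[OF F(1)]
      by (auto simp: closed_normals_def subgroups_Inter_pair)
    then show ?thesis using J_least by blast
  qed
  have good_Un: "good (F \<union> F')" if "good F" "good F'" for F F' using that by (auto simp: good_def)
  have good0: "good (S \<union> FA)" using S FA by (auto simp: good_def)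
  \<comment> \<open>Adding \<open>g\<close> to the finite set shows that conjugation by \<open>g\<close> preserves this directed union.\<close>
  define D where "D = \<Union>(J ` {F. good F})"
  have JD: "J F \<subseteq> D" if "good F" for F using that by (auto simp: D_def)
  have D: "subgroup D G"
  proof (rule subgroupI)
    show "D \<subseteq> carrier G" using subgroup.subset[OF J'(1)] by (auto simp: D_def)
    show "D \<noteq> {}" using JD[OF good0] subgroup.one_closed[OF J'(1)[OF good0]] by blast
    show "inv a \<in> D" if "a \<in> D" for a
      using that subgroup.m_inv_closed[OF J'(1)] by (auto simp: D_def)
    show "a \<otimes> b \<in> D" if "a \<in> D" "b \<in> D" for a b
    proof -
      obtain F F' where F: "good F" "a \<in> J F" "good F'" "b \<in> J F'" using \<open>a \<in> D\<close> \<open>b \<in> D\<close> by (auto simp: D_def)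
      have g: "good (F \<union> F')" using good_Un F by simp
      have "a \<in> J (F \<union> F')" "b \<in> J (F \<union> F')"
        using J_mono[OF F(1) g] J_mono[OF F(3) g] F by auto
      then show ?thesis using JD[OF g] subgroup.m_closed[OF J'(1)[OF g]] by blast
    qed
  qed
  have "normalizes G (carrier G) D"
  proof (rule normalizesI)
    fix g x assume g: "g \<in> carrier G" and "x \<in> D"
    then obtain F where F: "good F" "x \<in> J F" by (auto simp: D_def)
    have F': "good (insert g F)" using F(1) g by (auto simp: good_def)
    have "x \<in> J (insert g F)" using J_mono[OF F(1) F'] F(2) by blast
    moreover have "g \<in> gen (insert g F)" using gen(5)[OF F'] by blast
    ultimately show "g \<otimes> x \<otimes> inv g \<in> D" using normalizesD[OF J'(4)[OF F']] JD[OF F'] by blast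
  qed
  moreover have "D \<noteq> {\<one>}" 
    using JD[OF good0] J'(5)[OF good0] subgroup.one_closed[OF J'(1)[OF good0]] by blast
  ultimately have "dense D" using dense_of_normalized[OF D _ _ dense_carrier] by simp
  then obtain FB where FB: "finite FB" "FB \<subseteq> D" "hits FB" using hits_ex[OF D] by blast
  have "\<exists>F. good F \<and> FB \<subseteq> J F" using FB(1,2)
  proof (induction rule: finite_induct)
    case empty then show ?case using good0 by blast
  next
    case (insert x B)
    then obtain F where F: "good F" "B \<subseteq> J F" by auto
    obtain F' where F': "good F'" "x \<in> J F'" using insert.prems by (auto simp: D_def)
    have g: "good (F \<union> F')" using good_Un F F' by simp
    have "insert x B \<subseteq> J (F \<union> F')" using J_mono[OF F(1) g] J_mono[OF F'(1) g] F F' by auto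
    then show ?case using g by blast
  qed
  then obtain F where F: "good F" "FB \<subseteq> J F" by blast
  define N where "N = J F"
  define Q where "Q = gen F"
  note gQ = gen[OF F(1), folded Q_def]
  note N = J'[OF F(1), folded N_def Q_def]
  have Nc: "N \<subseteq> carrier G" using N(1) by (simp add: subgroup.subset)
  have NU: "normalizes G U N" using normalizes_mono[OF N(4) gQ(4)] .
  have spN: "spans N" using J(2)[OF F(1)] by (simp add: N_def)
  have least: "N \<subseteq> Y" if "Y \<in> closed_normals Q" for Y using J_least that by (simp add: N_def Q_def)
  have qQ: "quasi_centre Q = {\<one>}" using ample_gen[OF F(1)] by (simp add: ample_def Q_def)
  have nd: False if V: "openin T V" "\<one> \<in> V" "N \<inter> V \<subseteq> {\<one>}" for V
  proof -
    have "N \<subseteq> {\<one>}" using discrete_normal_quasi_central[OF gQ(1) N(1,3,4) V] qQ by simp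
    then show False using N(5) subgroup.one_closed[OF N(1)] by blast
  qed
  \<comment> \<open>The closure of the quasi-centre is normal in \<open>Q\<close>; were it non-trivial, it would be all of \<open>N\<close> by minimality.\<close>
  have qN: "quasi_centre N = {\<one>}"
  proof (rule ccontr)
    assume ne: "quasi_centre N \<noteq> {\<one>}"
    let ?Z = "quasi_centre N"
    have Z: "subgroup ?Z G" using quasi_centre_subgroup[OF N(1)] .
    have ZN: "?Z \<subseteq> N" by (auto simp: quasi_centre_def)
    have "subgroup (cl ?Z) G" using closure_subgroup[OF Z] .
    moreover have "cl ?Z \<subseteq> Q" using closure_of_minimal[OF ZN N(2)] N(3) by blast
    moreover have "normalizes G Q (cl ?Z)"
      using closure_normalized[OF quasi_centre_normalized[OF N(1) gQ(1) N(4)] subgroup.subset[OF gQ(1)]] .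
    moreover have "cl ?Z \<noteq> {\<one>}" 
      using closure_of_subset[of ?Z T] subgroup.subset[OF Z] ne subgroup.one_closed[OF Z] by auto
    ultimately have "cl ?Z \<in> closed_normals Q" by (simp add: closed_normals_def)
    then have NZ: "N \<subseteq> cl ?Z" using least by blast
    have "spans ?Z"
      unfolding spans_def
    proof
      fix s assume s: "s \<in> S"
      then have sc: "s \<in> carrier G" using S by auto
      obtain n where n: "n \<in> N" "inv s \<otimes> n \<in> U" using spN s unfolding spans_def by blast
      let ?P = "{x \<in> carrier G. inv s \<otimes> x \<in> U}"
      have "openin T ?P" using sc by (intro open_preimage continuous_intro U(3)) auto
      moreover have "n \<in> ?P \<inter> cl ?Z" using n Nc NZ by auto
      ultimately have "?P \<inter> ?Z \<noteq> {}" using openin_Int_closure_of_eq_empty[of T ?P ?Z] by blast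
      then show "\<exists>n\<in>?Z. inv s \<otimes> n \<in> U" by blast
    qed
    then show False using quasi_centre_spans[OF N(1) NU] nd by blast
  qed
  have ampleN: "ample N" using N NU spN qN by (simp add: ample_def)
  have FBN: "FB \<subseteq> N" using F(2) by (simp add: N_def)
  define M where "M = \<Inter>(closed_normals N)"
  have MN: "M \<in> closed_normals N" using ample_monolith(1)[OF ampleN FBN FB(3)] by (simp add: M_def)
  have "normalizes G Q M"
  proof (rule normalizesI)
    fix g x assume g: "g \<in> Q" and x: "x \<in> M"
    have gc: "g \<in> carrier G" using g gQ(1) by (simp add: subgroup.mem_carrier)
    have "g \<otimes> x \<otimes> inv g \<in> Y" if Y: "Y \<in> closed_normals N" for Y
    proof -
      have sY: "subgroup Y G" "closedin T Y" "Y \<subseteq> N" "normalizes G N Y" "Y \<noteq> {\<one>}"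
        using Y by (auto simp: closed_normals_def)
      \<comment> \<open>Conjugation by \<open>g\<close> permutes the closed normal subgroups of \<open>N\<close>, so it preserves their intersection.\<close>
      let ?Y = "{y \<in> carrier G. g \<otimes> y \<otimes> inv g \<in> Y}"
      have c: "continuous_map T T (\<lambda>y. g \<otimes> y \<otimes> inv g)" using gc by (intro continuous_intro) auto
      have "subgroup ?Y G"
      proof (rule subgroupI)
        have "\<one> \<in> ?Y" using gc subgroup.one_closed[OF sY(1)] by simp
        then show "?Y \<noteq> {}" by blast
        show "inv a \<in> ?Y" if "a \<in> ?Y" for a
          using that gc subgroup.m_inv_closed[OF sY(1)] by (simp add: conj_inv)
        show "a \<otimes> b \<in> ?Y" if "a \<in> ?Y" "b \<in> ?Y" for a b
          using that gc subgroup.m_closed[OF sY(1)] by (simp add: conj_mult)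
      qed auto
      moreover have "closedin T ?Y"
        using closedin_continuous_map_preimage[OF c sY(2)] by simp
      moreover have "?Y \<subseteq> N"
      proof
        fix y assume y: "y \<in> ?Y"
        have "inv g \<otimes> (g \<otimes> y \<otimes> inv g) \<otimes> inv (inv g) \<in> N"
          using y sY(3) normalizesD[OF N(4), of "inv g"] g gQ(1) by (auto simp: subgroup.m_inv_closed)
        then show "y \<in> N" using y gc by (simp add: m_assoc)
      qed
      moreover have "normalizes G N ?Y"
      proof (rule normalizesI)
        fix n y assume n: "n \<in> N" and y: "y \<in> ?Y"
        have nc: "n \<in> carrier G" using n Nc by auto
        have "g \<otimes> (n \<otimes> y \<otimes> inv n) \<otimes> inv g =
          (g \<otimes> n \<otimes> inv g) \<otimes> (g \<otimes> y \<otimes> inv g) \<otimes> inv (g \<otimes> n \<otimes> inv g)"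
          using gc nc y by (intro conj_of_conj) auto
        also have "\<dots> \<in> Y" using normalizesD[OF sY(4) normalizesD[OF N(4) g n]] y by simp
        finally show "n \<otimes> y \<otimes> inv n \<in> ?Y" using nc y by simp
      qed
      moreover have "?Y \<noteq> {\<one>}"
      proof
        assume eq: "?Y = {\<one>}"
        obtain y where y: "y \<in> Y" "y \<noteq> \<one>" using sY(1,5) subgroup.one_closed by blast
        have yc: "y \<in> carrier G" using y sY(1) by (simp add: subgroup.mem_carrier)
        have "inv g \<otimes> y \<otimes> g \<in> ?Y" using y yc gc by (simp add: m_assoc)
        then have "inv g \<otimes> y \<otimes> g = \<one>" using eq by blast
        then have "g \<otimes> (inv g \<otimes> y \<otimes> g) \<otimes> inv g = \<one>" using gc by simp
        then show False using y yc gc by (simp add: m_assoc)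
      qed
      ultimately have "?Y \<in> closed_normals N" by (simp add: closed_normals_def)
      then have "x \<in> ?Y" using x by (auto simp: M_def)
      then show ?thesis by simp
    qed
    then show "g \<otimes> x \<otimes> inv g \<in> M" by (simp add: M_def)
  qed
  then have "M \<in> closed_normals Q" using MN N(3) by (auto simp: closed_normals_def)
  then have NM: "N \<subseteq> M" using least by blast
  obtain n where n: "\<And>s. s \<in> S \<Longrightarrow> n s \<in> N" "\<And>s. s \<in> S \<Longrightarrow> inv s \<otimes> n s \<in> U"
    using spN unfolding spans_def by metis
  \<comment> \<open>The elements \<open>n s\<close> alone do not suffice, because \<open>U\<close> need not lie in \<open>N\<close>; their conjugates under \<open>U\<close> do.\<close>
  define F' where "F' = {u \<otimes> x \<otimes> inv u |u x. u \<in> U \<and> x \<in> n ` S}"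
  have "compactin T (n ` S)" using n(1) Nc S(1) by (intro finite_imp_compactin) auto
  then have F'c: "compactin T F'" unfolding F'_def by (rule compact_conj[OF U(2)])
  have F'N: "F' \<subseteq> N" using n(1) normalizesD[OF NU] by (auto simp: F'_def)
  have "expansive_simple G T N"
    unfolding expansive_simple_def
  proof (intro conjI allI impI)
    show "subgroup N G" "closedin T N" using N by auto
    show "\<not> openin (subtopology T N) {\<one>}"
    proof
      assume "openin (subtopology T N) {\<one>}"
      then obtain V where "openin T V" "\<one> \<in> V" "V \<inter> N \<subseteq> {\<one>}" by (rule open_nbhd) auto
      then show False using nd[of V] by blast
    qed
    show "Y = {\<one>} \<or> Y = N" if "subgroup Y G \<and> closedin T Y \<and> Y \<subseteq> N \<and> normalizes G N Y" for Y
    proof (cases "Y = {\<one>}")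
      case False
      then have "Y \<in> closed_normals N" using that by (simp add: closed_normals_def)
      then show ?thesis using NM that by (auto simp: M_def)
    qed simp
    have "subgroup (N \<inter> U) G" using N(1) U(1) by (simp add: subgroups_Inter_pair)
    moreover have "compactin T (N \<inter> U)" using N(2) U(2) by (simp add: closed_Int_compactin)
    moreover have "openin (subtopology T N) (N \<inter> U)" using U(3) by (auto simp: openin_subtopology)
    moreover have "L = {\<one>}" if L: "subgroup L G" "L \<subseteq> N \<inter> U" "normalizes G F' L" for L
    proof (rule invariant_trivial[OF L(1)])
      show "L \<subseteq> U" using L by blast
      show "n s \<in> carrier G" "inv s \<otimes> n s \<in> U" if "s \<in> S" for s using n that Nc by auto
      show "(u \<otimes> n s \<otimes> inv u) \<otimes> x \<otimes> inv (u \<otimes> n s \<otimes> inv u) \<in> L" if "s \<in> S" "u \<in> U" "x \<in> L" for s u x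
        using normalizesD[OF L(3) _ that(3)] that by (auto simp: F'_def)
    qed
    ultimately show "\<exists>U F. subgroup U G \<and> compactin T U \<and> U \<subseteq> N \<and> openin (subtopology T N) U \<and>
        compactin T F \<and> F \<subseteq> N \<and>
        (\<forall>L. subgroup L G \<and> L \<subseteq> U \<and> normalizes G U L \<and> normalizes G F L \<longrightarrow> L = {\<one>})"
      using F'c F'N by (intro exI[of _ "N \<inter> U"] exI[of _ F']) blast
  qed
  moreover have cgQ: "cpt_generated G T Q"
  proof -
    have "compactin T F" using F(1) by (intro finite_imp_compactin) (auto simp: good_def)
    then have "compactin T (U \<union> F)" using U(2) by (simp add: compactin_Un)
    then show ?thesis by (auto simp: cpt_generated_def Q_def gen_def)
  qed
  moreover have "N \<subseteq> residual G T Q"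
  proof -
    define R where "R = residual G T Q"
    have R: "subgroup R G" "R \<subseteq> Q" "normalizes G Q R" "closedin T R"
      using residual_subgroup residual_subset residual_normal residual_closed gQ by (auto simp: R_def)
    \<comment> \<open>If \<open>R\<close> were trivial, some open normal subgroup of \<open>Q\<close> would lie in \<open>U\<close>, against expansiveness.\<close>
    have "R \<noteq> {\<one>}"
    proof
      assume R1: "R = {\<one>}"
      have "openin (subtopology T Q) U" using U(3) gQ(4) by (auto simp: openin_subtopology)
      then obtain W where W: "W \<in> open_normals G T Q" "W \<subseteq> R <#> U"
        using open_normal_near_residual[OF gQ(1) cgQ U(1,2) gQ(4)] unfolding R_def by blast
      have WU: "W \<subseteq> U"
      proof
        fix x assume "x \<in> W"
        then have "x \<in> {\<one>} <#> U" using W(2) R1 by auto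
        then obtain u where "u \<in> U" "x = \<one> \<otimes> u" by (auto simp: set_mult_iff)
        then show "x \<in> U" using U_carrier by auto
      qed
      have sW: "subgroup W G" "normalizes G Q W" "openin (subtopology T Q) W" 
        using W(1) by (auto simp: open_normals_def)
      have "S \<subseteq> Q" using F(1) gQ(5) by (auto simp: good_def)
      then have "W = {\<one>}" using expansive[OF sW(1) WU] normalizes_mono[OF sW(2)] gQ(4) by blast
      then have "openin T {\<one>}" using sW(3) gQ(2) openin_trans_full by blast
      then show False using nondiscrete by simp
    qed
    then have "R \<in> closed_normals Q" using R by (simp add: closed_normals_def)
    then show ?thesis using least by (simp add: R_def)
  qed
  ultimately show ?thesis using that gQ by blast
qed

end

section \<open>Expansive simple groups are not residually founded\<close>

context top_group begin

lemma subgroup_sub_iff: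
  assumes "subgroup X G" shows "subgroup N (G\<lparr>carrier := X\<rparr>) \<longleftrightarrow> subgroup N G \<and> N \<subseteq> X"
proof
  assume N: "subgroup N (G\<lparr>carrier := X\<rparr>)"
  then show "subgroup N G \<and> N \<subseteq> X" using incl_subgroup[OF assms N] subgroup.subset[OF N] by simp
next
  assume "subgroup N G \<and> N \<subseteq> X"
  then show "subgroup N (G\<lparr>carrier := X\<rparr>)" using subgroup_incl[OF _ assms] by blast
qed

lemma normalizes_sub:
  assumes "subgroup X G" "A \<subseteq> X" shows "normalizes (G\<lparr>carrier := X\<rparr>) A N \<longleftrightarrow> normalizes G A N"
  using assms by (auto simp: normalizes_def subset_iff)

lemma residual_sub:
  assumes X: "subgroup X G" and Q: "Q \<subseteq> X"
  shows "residual (G\<lparr>carrier := X\<rparr>) (subtopology T X) Q = residual G T Q"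
proof -
  have "open_normals (G\<lparr>carrier := X\<rparr>) (subtopology T X) Q = open_normals G T Q"
    using Q normalizes_sub[OF X Q] subtopology_nested[OF Q] by (auto simp: open_normals_def subgroup_sub_iff[OF X])
  then show ?thesis by (simp add: residual_def)
qed

lemma cpt_generated_sub:
  assumes X: "subgroup X G" and Q: "cpt_generated (G\<lparr>carrier := X\<rparr>) (subtopology T X) Q"
  shows "cpt_generated G T Q"
proof -
  obtain K where K: "compactin (subtopology T X) K" "generate (G\<lparr>carrier := X\<rparr>) K = Q"
    using Q by (auto simp: cpt_generated_def)
  then have "compactin T K" "K \<subseteq> X" by (auto simp: compactin_subtopology)
  then show ?thesis using K(2) generate_consistent[OF \<open>K \<subseteq> X\<close> X] by (auto simp: cpt_generated_def)
qed

lemma expansive_simple_sub: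
  assumes X: "subgroup X G" "closedin T X" 
    and N: "expansive_simple (G\<lparr>carrier := X\<rparr>) (subtopology T X) N"
  shows "expansive_simple G T N"
proof -
  let ?G = "G\<lparr>carrier := X\<rparr>" and ?T = "subtopology T X"
  have sN: "subgroup N G" "N \<subseteq> X" "closedin T N" "\<not> openin (subtopology T N) {\<one>}"
    using N subtopology_nested[of N X] closedin_trans_full[OF _ X(2)]
    by (auto simp: expansive_simple_def subgroup_sub_iff[OF X(1)])
  have c: "closedin ?T Y" if "closedin T Y" "Y \<subseteq> N" for Y
    using that sN(2) X(2) by (simp add: closedin_closed_subtopology)
  have simple: "Y = {\<one>} \<or> Y = N" if "subgroup Y G" "closedin T Y" "Y \<subseteq> N" "normalizes G N Y" for Y
    using N that c sN(2) normalizes_sub[OF X(1) sN(2)]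
    by (auto simp: expansive_simple_def subgroup_sub_iff[OF X(1)])
  obtain U F where UF: "subgroup U ?G" "compactin ?T U" "U \<subseteq> N" "openin (subtopology ?T N) U"
    "compactin ?T F" "F \<subseteq> N"
    "\<And>L. subgroup L ?G \<and> L \<subseteq> U \<and> normalizes ?G U L \<and> normalizes ?G F L \<Longrightarrow> L = {\<one>}"
    using N by (auto simp: expansive_simple_def)
  have UX: "U \<subseteq> X" "F \<subseteq> X" using UF sN by auto
  have "L = {\<one>}" if "subgroup L G" "L \<subseteq> U" "normalizes G U L" "normalizes G F L" for L
    using UF(7)[of L] that UX by (auto simp: normalizes_sub[OF X(1)] subgroup_sub_iff[OF X(1)])
  moreover have "subgroup U G" "compactin T U" "openin (subtopology T N) U" "compactin T F"
    using UF subtopology_nested[OF sN(2)] by (auto simp: subgroup_sub_iff[OF X(1)] compactin_subtopology)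
  ultimately show ?thesis
    unfolding expansive_simple_def using sN simple UF(3,6) by blast
qed

text \<open>The preceding construction carried out inside a closed subgroup of a larger group, which is where it
has to be iterated.\<close>
lemma smaller_expansive_simple_in:
  assumes X: "expansive_simple G T X"
  obtains Q N where "subgroup Q G" "Q \<subseteq> X" "openin (subtopology T X) Q" "cpt_generated G T Q"
    "N \<subseteq> residual G T Q" "expansive_simple G T N"
proof -
  have sX: "subgroup X G" "closedin T X" "\<not> openin (subtopology T X) {\<one>}"
    "\<And>Y. subgroup Y G \<Longrightarrow> closedin T Y \<Longrightarrow> Y \<subseteq> X \<Longrightarrow> normalizes G X Y \<Longrightarrow> Y = {\<one>} \<or> Y = X"
    using X by (auto simp: expansive_simple_def)
  obtain U F where UF: "subgroup U G" "compactin T U" "U \<subseteq> X" "openin (subtopology T X) U"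
    "compactin T F" "F \<subseteq> X"
    "\<And>L. subgroup L G \<Longrightarrow> L \<subseteq> U \<Longrightarrow> normalizes G U L \<Longrightarrow> normalizes G F L \<Longrightarrow> L = {\<one>}"
    using X unfolding expansive_simple_def by metis
  obtain S where S: "finite S" "S \<subseteq> F" "\<And>k. k \<in> F \<Longrightarrow> \<exists>s\<in>S. inv s \<otimes> k \<in> U"
    using compact_cover[OF UF(5,6) sX(1) UF(1,4)] by blast
  let ?G = "G\<lparr>carrier := X\<rparr>" and ?T = "subtopology T X"
  have Xc: "X \<subseteq> carrier G" using sX(1) by (simp add: subgroup.subset)
  have SX: "S \<subseteq> X" using S UF by auto
  interpret X: top_group ?G ?T using top_group_subgroup[OF sX(1)] .
  interpret X: expansive_simple_group ?G ?T U S
  proof (intro expansive_simple_group.intro expansive_simple_group_axioms.intro X.top_group_axioms)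
    show "\<not> openin ?T {\<one>\<^bsub>?G\<^esub>}" using sX(3) by simp
    show "Y = {\<one>\<^bsub>?G\<^esub>} \<or> Y = carrier ?G" 
      if "subgroup Y ?G" "closedin ?T Y" "normalizes ?G (carrier ?G) Y" for Y
      using sX(4)[of Y] that closedin_trans_full[OF that(2) sX(2)]
      by (simp add: subgroup_sub_iff[OF sX(1)] normalizes_sub[OF sX(1)])
    show "subgroup U ?G" "compactin ?T U" "openin ?T U"
      using UF by (auto simp: subgroup_sub_iff[OF sX(1)] compactin_subtopology)
    show "finite S" "S \<subseteq> carrier ?G" using S SX by auto
    show "L = {\<one>\<^bsub>?G\<^esub>}" if L: "subgroup L ?G" "L \<subseteq> U" "normalizes ?G U L" "normalizes ?G S L" for L
    proof -
      have L': "subgroup L G" "normalizes G U L" "normalizes G S L"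
        using L UF(3) SX by (auto simp: subgroup_sub_iff[OF sX(1)] normalizes_sub[OF sX(1)])
      have "normalizes G F L"
      proof (rule normalizesI)
        fix k x assume k: "k \<in> F" and x: "x \<in> L"
        obtain s where s: "s \<in> S" "inv s \<otimes> k \<in> U" using S(3)[OF k] by blast
        have c: "s \<in> carrier G" "k \<in> carrier G" "x \<in> carrier G"
          using s SX Xc k UF(6) x L'(1) by (auto simp: subgroup.mem_carrier)
        have "s \<otimes> ((inv s \<otimes> k) \<otimes> x \<otimes> inv (inv s \<otimes> k)) \<otimes> inv s \<in> L"
          using normalizesD[OF L'(3) s(1) normalizesD[OF L'(2) s(2) x]] .
        then show "k \<otimes> x \<otimes> inv k \<in> L" using c by (simp add: m_assoc inv_mult_group)
      qed
      then show ?thesis using UF(7)[OF L'(1) L(2) L'(2)] by simp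
    qed
  qed
  obtain Q N where QN: "subgroup Q ?G" "openin ?T Q" "cpt_generated ?G ?T Q" "N \<subseteq> residual ?G ?T Q"
    "expansive_simple ?G ?T N"
    by (rule X.smaller_expansive_simple)
  have Q: "subgroup Q G" "Q \<subseteq> X" using QN(1) by (auto simp: subgroup_sub_iff[OF sX(1)])
  show ?thesis
    using that[OF Q QN(2) cpt_generated_sub[OF sX(1) QN(3)]] QN(4) residual_sub[OF sX(1) Q(2)]
      expansive_simple_sub[OF sX(1,2) QN(5)] by simp
qed

end

text \<open>Quantifying over all closed subgroups of \<open>A\<close> makes the induction go through: the subgroup found in the
residual of \<open>Q\<close> also lies in the residual of a compactly generated open subgroup of \<open>A\<close>
containing \<open>Q\<close>.\<close>
lemma (in van_dantzig_group) residually_founded_not_expansive_simple: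
  assumes "residually_founded G T A" "X \<subseteq> A"
  shows "\<not> expansive_simple G T X"
  using assms
proof (induction arbitrary: X rule: residually_founded.induct)
  case trivial
  show ?case
  proof
    assume X: "expansive_simple G T X"
    then have "\<one> \<in> X" using subgroup.one_closed[of X G] by (simp add: expansive_simple_def)
    then have "X = {\<one>}" using trivial by blast
    moreover have "openin (subtopology T {\<one>}) {\<one>}"
      using openin_topspace[of "subtopology T {\<one>}"] by simp
    ultimately show False using X by (simp add: expansive_simple_def)
  qed
next
  case (step A)
  show ?case
  proof
    assume "expansive_simple G T X"
    then obtain Q N where Q: "subgroup Q G" "Q \<subseteq> X" "cpt_generated G T Q" "N \<subseteq> residual G T Q"
      "expansive_simple G T N" by (rule smaller_expansive_simple_in)
    obtain K where K: "compactin T K" "generate G K = Q" using Q(3) by (auto simp: cpt_generated_def)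
    have "K \<subseteq> A" using subset_generate[of K G] K Q(2) step.prems by auto
    then obtain P where P: "subgroup P G" "P \<subseteq> A" "openin (subtopology T A) P" "cpt_generated G T P" "K \<subseteq> P"
      using envelope[OF step.hyps(1,2) K(1)] by blast
    have "Q \<subseteq> P" using generate_subgroup_incl[OF P(5,1)] K by simp
    then have "N \<subseteq> residual G T P" using residual_mono[OF Q(1) P(1)] Q(4) by blast
    then show False using step.IH[OF P(1-4)] Q(5) by blast
  qed
qed

section \<open>Robustly monolithic groups\<close>

text \<open>This translates the definition. Adding inverses to a compact generating set of the open subgroup \<open>P\<close>
ensures that a subgroup normalized by \<open>F\<close> is normalized by \<open>P\<close>, so that it lies in the normal core.\<close>
lemma robustly_monolithic_expansive_simple:
  fixes G (structure)
  assumes "robustly_monolithic G T"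
  shows "expansive_simple G T (monolith G T)"
proof -
  define M where "M = monolith G T"
  let ?G = "G\<lparr>carrier := M\<rparr>" and ?T = "subtopology T M"
  have td: "tdlc_group G T" and mon: "monolith G T \<noteq> {\<one>\<^bsub>G\<^esub>}"
    and nd: "\<not> discrete_group ?G ?T" and re: "regionally_expansive ?G ?T" and ts: "topologically_simple ?G ?T"
    using assms by (auto simp: robustly_monolithic_def monolithic_def Let_def M_def)
  interpret van_dantzig_group G T using td by (rule tdlc_imp_van_dantzig_group)
  have M: "subgroup M G" "closedin T M"
  proof -
    let ?\<F> = "insert (carrier G) {N. N \<lhd> G \<and> closedin T N \<and> N \<noteq> {\<one>\<^bsub>G\<^esub>}}"
    have eq: "M = \<Inter>?\<F>" by (auto simp: M_def monolith_def)
    show "subgroup M G" unfolding eq 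
      by (rule subgroups_Inter) (auto simp: subgroup_self normal_inv_iff)
    have "closedin T (carrier G)" by (metis topspace closedin_topspace)
    then show "closedin T M" unfolding eq by (intro closedin_Inter) auto
  qed
  have Mc: "M \<subseteq> carrier G" using M by (simp add: subgroup.subset)
  interpret M: top_group ?G ?T using top_group_subgroup[OF M(1)] .
  have nd': "\<not> openin ?T {\<one>}"
  proof
    assume o: "openin ?T {\<one>}"
    have "openin ?T {x}" if x: "x \<in> M" for x
    proof -
      have "openin ?T {y \<in> carrier ?G. inv\<^bsub>?G\<^esub> x \<otimes>\<^bsub>?G\<^esub> y \<in> {\<one>}}"
        using x by (intro M.open_preimage M.continuous_intro o) auto
      moreover have "{y \<in> carrier ?G. inv\<^bsub>?G\<^esub> x \<otimes>\<^bsub>?G\<^esub> y \<in> {\<one>}} = {x}"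
      proof -
        have "inv x \<otimes> y = \<one> \<longleftrightarrow> y = x" if "y \<in> M" for y
          using x that Mc inv_solve_left[of \<one> x y] by (auto simp: subset_iff)
        then show ?thesis using x M(1) by auto
      qed
      ultimately show ?thesis by simp
    qed
    then have "discrete_topology M = ?T" using M.topspace by (simp add: discrete_topology_unique)
    then show False using nd M.top_group by (simp add: discrete_group_def)
  qed
  have simple: "Y = {\<one>} \<or> Y = M" if "subgroup Y G" "closedin T Y" "Y \<subseteq> M" "normalizes G M Y" for Y
  proof -
    have "Y \<lhd> ?G"
      using that normalizes_sub[OF M(1), of M Y]
      by (auto simp: M.normal_inv_iff subgroup_sub_iff[OF M(1)] normalizes_def)
    moreover have "closedin ?T Y" using that M(2) by (simp add: closedin_closed_subtopology)
    ultimately show ?thesis using ts by (auto simp: topologically_simple_def)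
  qed
  obtain P U where P: "subgroup P ?G" "openin ?T P" 
    "compactly_generated (?G\<lparr>carrier := P\<rparr>) (subtopology ?T P)"
    "subgroup U (?G\<lparr>carrier := P\<rparr>)" "compactin (subtopology ?T P) U" "openin (subtopology ?T P) U"
    "normal_core (?G\<lparr>carrier := P\<rparr>) U = {\<one>}"
    using re unfolding regionally_expansive_def by auto
  have P': "subgroup P G" "P \<subseteq> M" using P(1) by (auto simp: subgroup_sub_iff[OF M(1)])
  have rec: "?G\<lparr>carrier := P\<rparr> = G\<lparr>carrier := P\<rparr>" by simp
  have top: "subtopology ?T P = subtopology T P" using subtopology_nested[OF P'(2)] .
  have U: "subgroup U G" "U \<subseteq> P" using P(4) unfolding rec by (auto simp: subgroup_sub_iff[OF P'(1)])
  have cU: "compactin T U" using P(5) by (simp add: top compactin_subtopology)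
  have oU: "openin ?T U" using P(6,2) openin_trans_full by blast
  obtain K where K: "compactin T K" "K \<subseteq> P" "generate G K = P"
    using P(3) generate_consistent[OF _ P'(1)] 
    unfolding compactly_generated_def rec top by (auto simp: compactin_subtopology)
  have Kc: "K \<subseteq> carrier G" using K(1) compact_carrier by blast
  define F where "F = K \<union> (\<lambda>k. inv k) ` K"
  have "compactin T ((\<lambda>k. inv k) ` K)"
    by (rule image_compactin[OF K(1)]) (intro continuous_intro)
  then have cF: "compactin T F" using K(1) by (simp add: F_def compactin_Un)
  have FM: "F \<subseteq> M" using K(2) P' M(1) by (auto simp: F_def subgroup.m_inv_closed)
  have exp: "L = {\<one>}" if L: "subgroup L G" "L \<subseteq> U" "normalizes G F L" for L
  proof -
    have Lc: "L \<subseteq> carrier G" using L by (simp add: subgroup.subset)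
    have nP: "normalizes G P L"
      unfolding K(3)[symmetric]
    proof (rule normalizes_generate[OF Kc Lc])
      show "k \<otimes> x \<otimes> inv k \<in> L" if "k \<in> K" "x \<in> L" for k x
        using normalizesD[OF L(3), of k x] that by (simp add: F_def)
      show "inv k \<otimes> x \<otimes> k \<in> L" if "k \<in> K" "x \<in> L" for k x
        using normalizesD[OF L(3), of "inv k" x] that Kc by (auto simp: F_def)
    qed
    have "L \<subseteq> normal_core (?G\<lparr>carrier := P\<rparr>) U"
    proof
      fix x assume x: "x \<in> L"
      have "x \<in> (k <#\<^bsub>G\<lparr>carrier := P\<rparr>\<^esub> U) #>\<^bsub>G\<lparr>carrier := P\<rparr>\<^esub> (inv\<^bsub>G\<lparr>carrier := P\<rparr>\<^esub> k)" if k: "k \<in> P" for k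
      proof -
        have c: "k \<in> carrier G" "x \<in> carrier G" using k x P'(1) Lc by (auto simp: subgroup.mem_carrier)
        have "inv k \<otimes> x \<otimes> inv (inv k) \<in> L" 
          using normalizesD[OF nP _ x] k P'(1) by (simp add: subgroup.m_inv_closed)
        then have u: "inv k \<otimes> x \<otimes> k \<in> U" using c L(2) by auto
        have "x = k \<otimes> (inv k \<otimes> x \<otimes> k) \<otimes> inv k" using c by (simp add: m_assoc)
        then show ?thesis using u k P'(1) unfolding l_coset_def r_coset_def by auto
      qed
      then show "x \<in> normal_core (?G\<lparr>carrier := P\<rparr>) U" by (simp add: normal_core_def)
    qed
    then show ?thesis using P(7) subgroup.one_closed[OF L(1)] by auto
  qed
  have "expansive_simple G T M"
    unfolding expansive_simple_def
    using M nd' simple U P'(2) cU oU cF FM exp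
    by (intro conjI allI impI exI[of _ U] exI[of _ F]) auto
  then show ?thesis by (simp add: M_def)
qed

theorem theorem1p2p3:
  fixes G :: "'a monoid" and T :: "'a topology"
  assumes "robustly_monolithic G T"
  shows "\<not> regionally_elementary TYPE('u) G T"
proof
  assume "regionally_elementary TYPE('u) G T"
  then obtain H :: "'u monoid" and S where H: "regionally_elementary_over H S" "topologically_isomorphic G T H S"
    and td: "tdlc_group G T"
    by (auto simp: regionally_elementary_def)
  interpret G: van_dantzig_group G T using td by (rule tdlc_imp_van_dantzig_group)
  interpret H: van_dantzig_group H S using regionally_elementary_over_imp[OF H(1)] by simp
  have R: "residually_founded H S (carrier H)" using regionally_elementary_over_imp[OF H(1)] by simp
  obtain h where h: "h \<in> iso G H" "homeomorphic_map T S h"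
    using H(2) by (auto simp: topologically_isomorphic_def)
  have hom: "h \<in> hom G H" and inj: "inj_on h (carrier G)" using h(1) by (auto simp: iso_def bij_betw_def)
  interpret h: group_hom G H h
    using hom by (simp add: group_hom_def group_hom_axioms_def G.is_group H.is_group)
  have ex: "expansive_simple G T (monolith G T)" using robustly_monolithic_expansive_simple[OF assms] .
  then have M: "subgroup (monolith G T) G" "closedin T (monolith G T)" by (auto simp: expansive_simple_def)
  have "residually_founded G T (monolith G T)"
  proof (rule residually_founded_hom[OF R G.van_dantzig_group_axioms H.van_dantzig_group_axioms residually_founded.trivial M, where f = h])
    have Mc: "monolith G T \<subseteq> carrier G" using M by (simp add: subgroup.subset)
    show "h \<in> hom (G\<lparr>carrier := monolith G T\<rparr>) H" using hom Mc by (auto simp: hom_def Pi_iff subset_iff)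
    show "continuous_map (subtopology T (monolith G T)) S h"
      by (intro continuous_map_from_subtopology homeomorphic_imp_continuous_map h(2))
    show "h ` monolith G T \<subseteq> carrier H" using hom Mc by (auto simp: hom_def)
    show "x \<in> {\<one>\<^bsub>G\<^esub>}" if "x \<in> monolith G T" "h x = \<one>\<^bsub>H\<^esub>" for x
      using that Mc inj h.hom_one unfolding inj_on_def by (metis G.one_closed singletonI subsetD)
  qed
  then show False using G.residually_founded_not_expansive_simple ex by blast
qed

end
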